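(* Let $n,m\in\mathbb{R}$ satisfy $n+m\ge3$, $n+3m\ge4$ and $n+3m<6$. Let $\phi_0$ satisfy $$\|\phi_0-1\|_{H^1}<\infty,\qquad\Big\|\frac1{\phi_0}\Big\|_\infty<\infty .$$ Then there exists a unique $\phi$, with $\phi-1\in C^1([0,\infty);H^1(\mathbb{R}))$, that solves $$\phi_t+(\phi^n)_z-(\phi^n(\phi^{-m}\phi_t)_z)_z=0$$ with $\phi(\cdot,0)=\phi_0$. Moreover, $\|1/\phi(\cdot,t)\|_\infty<\infty$ for all $t\ge0$.
   Context: $H^k=W^{k,2}(\mathbb{R})$; functions are real valued. A solution with data $\phi_0$ is a function $\phi>0$ with $\phi-1\in C^1([0,\infty);H^1(\mathbb{R}))$ such that $$\phi(\cdot,t)=\phi_0+\int_0^t\phi(\cdot,s)^m u(\cdot,s)\,ds,$$ where for each $s$, $u(\cdot,s)\in H^1(\mathbb{R})$ is the unique weak solution of $-(\phi(\cdot,s)^n u_z)_z+\phi(\cdot,s)^m u=-(\phi(\cdot,s)^n)_z$. *)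

theory Defs
  imports "HOL-Analysis.Analysis" "HOL-Computational_Algebra.Polynomial"
    "HOL-Probability.Essential_Supremum"
begin

section \<open>Test functions on the real line\<close>

definition smooth :: "(real \<Rightarrow> real) \<Rightarrow> bool" where
  "smooth f \<longleftrightarrow> (\<forall>k x. (deriv ^^ k) f field_differentiable at x)"

definition test_fun :: "(real \<Rightarrow> real) \<Rightarrow> bool" where
  "test_fun \<eta> \<longleftrightarrow> smooth \<eta> \<and> compact (closure {x. \<eta> x \<noteq> 0})"

text \<open>
  The lemmas up to the definition of the type \<open>H1\<close> establish that square integrable weak derivatives
  are unique almost everywhere, so that the inner product of \<open>H\<^sup>1\<close> is well defined.
\<close>

lemma smooth_coinduct:
  assumes "f \<in> S" "\<And>f x. f \<in> S \<Longrightarrow> f field_differentiable at x" "\<And>f. f \<in> S \<Longrightarrow> deriv f \<in> S"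
  shows "smooth f"
proof -
  have "(deriv ^^ k) f \<in> S" for k
    by (induction k) (use assms in auto)
  then show ?thesis
    using assms(2) by (auto simp: smooth_def)
qed

lemma smooth_deriv: "smooth f \<Longrightarrow> smooth (deriv f)"
  unfolding smooth_def by (metis comp_apply funpow_Suc_right)

lemma smooth_field_differentiable: "smooth f \<Longrightarrow> f field_differentiable at x"
  unfolding smooth_def by (metis funpow_0)

lemma smooth_DERIV: "smooth f \<Longrightarrow> (f has_real_derivative deriv f x) (at x)"
  using smooth_field_differentiable DERIV_deriv_iff_field_differentiable by blast

lemma smooth_continuous_on: "smooth f \<Longrightarrow> continuous_on A f"
  by (meson smooth_DERIV DERIV_isCont continuous_at_imp_continuous_on)

lemma smooth_affine:
  assumes "smooth f" shows "smooth (\<lambda>x. f (a * x + b))"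
proof (rule smooth_coinduct[where S = "{\<lambda>x. c * g (a * x + b) | c g. smooth g}"])
  have "(\<lambda>x. f (a * x + b)) = (\<lambda>x. 1 * f (a * x + b))" by simp
  then show "(\<lambda>x. f (a * x + b)) \<in> {\<lambda>x. c * g (a * x + b) | c g. smooth g}"
    using assms by blast
next
  have D: "((\<lambda>x. c * g (a * x + b)) has_real_derivative (c * a) * deriv g (a * x + b)) (at x)"
    if "smooth g" for c g x
  proof -
    have "((\<lambda>x. a * x + b) has_real_derivative a) (at x)"
      by (auto intro!: derivative_eq_intros)
    from DERIV_cmult[OF DERIV_chain2[OF smooth_DERIV[OF that] this], of c]
    show ?thesis by (simp add: mult_ac)
  qed
  fix F assume "F \<in> {\<lambda>x. c * g (a * x + b) | c g. smooth g}"
  then obtain c g where F: "F = (\<lambda>x. c * g (a * x + b))" "smooth g" by blast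
  show "F field_differentiable at x" for x
    using D[OF F(2)] F(1) by (auto simp: field_differentiable_def)
  have "deriv F = (\<lambda>x. (c * a) * deriv g (a * x + b))"
    using D[OF F(2)] F(1) by (auto intro!: DERIV_imp_deriv)
  then show "deriv F \<in> {\<lambda>x. c * g (a * x + b) | c g. smooth g}"
    using smooth_deriv[OF F(2)] by blast
qed

inductive_set smooth_products :: "(real \<Rightarrow> real) set" where
  mult: "smooth f \<Longrightarrow> smooth g \<Longrightarrow> (\<lambda>x. f x * g x) \<in> smooth_products"
| add: "f \<in> smooth_products \<Longrightarrow> g \<in> smooth_products \<Longrightarrow> (\<lambda>x. f x + g x) \<in> smooth_products"

lemma smooth_products_deriv:
  "F \<in> smooth_products \<Longrightarrow> (\<forall>x. F field_differentiable at x) \<and> deriv F \<in> smooth_products"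
proof (induction rule: smooth_products.induct)
  case (mult f g)
  have D: "((\<lambda>x. f x * g x) has_real_derivative (deriv f x * g x + deriv g x * f x)) (at x)" for x
    using mult by (intro DERIV_mult smooth_DERIV)
  then have "deriv (\<lambda>x. f x * g x) = (\<lambda>x. deriv f x * g x + deriv g x * f x)"
    by (auto intro!: DERIV_imp_deriv)
  moreover have "(\<lambda>x. deriv f x * g x + deriv g x * f x) \<in> smooth_products"
    using mult by (intro smooth_products.intros smooth_deriv)
  ultimately show ?case using D field_differentiable_def by metis
next
  case (add f g)
  then have D: "((\<lambda>x. f x + g x) has_real_derivative (deriv f x + deriv g x)) (at x)" for x
    by (intro DERIV_add) (auto simp: DERIV_deriv_iff_field_differentiable)
  then have "deriv (\<lambda>x. f x + g x) = (\<lambda>x. deriv f x + deriv g x)"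
    by (auto intro!: DERIV_imp_deriv)
  moreover have "(\<lambda>x. deriv f x + deriv g x) \<in> smooth_products"
    using add by (intro smooth_products.add) auto
  ultimately show ?case using D field_differentiable_def by metis
qed

lemma smooth_mult: "smooth f \<Longrightarrow> smooth g \<Longrightarrow> smooth (\<lambda>x. f x * g x)"
  by (rule smooth_coinduct[where S = smooth_products])
    (use smooth_products_deriv in \<open>auto intro: smooth_products.mult\<close>)

definition exp_bump :: "real poly \<Rightarrow> real \<Rightarrow> real" where
  "exp_bump p x = (if x > 0 then poly p (1 / x) * exp (- (1 / x)) else 0)"

lemma poly_exp_tendsto_0:
  "((\<lambda>y. poly p y * exp (- y)) \<longlongrightarrow> (0::real)) at_top"
proof -
  have "((\<lambda>y. \<Sum>i\<le>degree p. coeff p i * (y ^ i / exp y)) \<longlongrightarrow> (\<Sum>i\<le>degree p. coeff p i * 0)) at_top"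
    by (intro tendsto_intros tendsto_power_div_exp_0)
  then show ?thesis
    by (simp add: poly_altdef sum_distrib_right sum_divide_distrib exp_minus divide_inverse mult.assoc)
qed

lemma exp_bump_deriv:
  "(exp_bump p has_real_derivative exp_bump ([:0, 0, 1:] * (p - pderiv p)) x) (at x)"
proof -
  consider "x > 0" | "x < 0" | "x = 0" by linarith
  then show ?thesis
  proof cases
    case 1
    have "((\<lambda>x. poly p (1 / x) * exp (- (1 / x))) has_real_derivative
        poly ([:0, 0, 1:] * (p - pderiv p)) (1 / x) * exp (- (1 / x))) (at x)"
      using 1
      by (auto intro!: derivative_eq_intros DERIV_chain2[OF poly_DERIV]
          simp: field_simps power2_eq_square)
    moreover have "\<forall>\<^sub>F y in nhds x. poly p (1 / y) * exp (- (1 / y)) = exp_bump p y"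
      using eventually_nhds_in_open[of "{0<..}" x] 1
      by (auto simp: exp_bump_def elim!: eventually_mono)
    ultimately show ?thesis
      using 1 by (subst (asm) DERIV_cong_ev[OF refl _ refl, where g = "exp_bump p"])
        (auto simp: exp_bump_def)
  next
    case 2
    have "\<forall>\<^sub>F y in nhds x. (0::real) = exp_bump p y"
      using eventually_nhds_in_open[of "{..<0}" x] 2
      by (auto simp: exp_bump_def elim!: eventually_mono)
    from iffD1[OF DERIV_cong_ev[OF refl this refl] DERIV_const]
    have "(exp_bump p has_real_derivative 0) (at x)" .
    moreover have "exp_bump ([:0, 0, 1:] * (p - pderiv p)) x = 0"
      using 2 by (simp add: exp_bump_def)
    ultimately show ?thesis by simp
  next
    case 3
    have "((\<lambda>h. poly ([:0, 1:] * p) (inverse h) * exp (- inverse h)) \<longlongrightarrow> 0) (at_right (0::real))"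
      by (rule filterlim_compose[OF poly_exp_tendsto_0 filterlim_inverse_at_top_right])
    moreover have "\<forall>\<^sub>F h in at_right 0. poly ([:0, 1:] * p) (inverse h) * exp (- inverse h)
        = (exp_bump p h - exp_bump p 0) / h"
      using eventually_at_right_less[of "0::real"]
      by eventually_elim (auto simp: exp_bump_def field_simps)
    ultimately have R: "((\<lambda>h. (exp_bump p h - exp_bump p 0) / h) \<longlongrightarrow> 0) (at_right 0)"
      by (rule Lim_transform_eventually)
    have "\<forall>\<^sub>F h in at_left 0. 0 = (exp_bump p h - exp_bump p 0) / h"
      by (auto simp: exp_bump_def eventually_at_filter)
    then have L: "((\<lambda>h. (exp_bump p h - exp_bump p 0) / h) \<longlongrightarrow> 0) (at_left 0)"
      by (rule Lim_transform_eventually[OF tendsto_const])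
    from L R have "((\<lambda>h. (exp_bump p h - exp_bump p 0) / h) \<longlongrightarrow> 0) (at 0)"
      by (simp add: filterlim_split_at)
    then show ?thesis
      using 3 by (simp add: DERIV_def exp_bump_def)
  qed
qed

lemma smooth_exp_bump: "smooth (exp_bump p)"
proof (rule smooth_coinduct[where S = "range exp_bump"])
  fix F assume "F \<in> range exp_bump"
  then obtain q where F: "F = exp_bump q" by blast
  show "F field_differentiable at x" for x
    using exp_bump_deriv F field_differentiable_def by blast
  have "deriv F = exp_bump ([:0, 0, 1:] * (q - pderiv q))"
    unfolding F by (intro ext DERIV_imp_deriv exp_bump_deriv)
  then show "deriv F \<in> range exp_bump" by blast
qed auto

definition interval_bump :: "real \<Rightarrow> real \<Rightarrow> nat \<Rightarrow> real \<Rightarrow> real" where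
  "interval_bump a b k x =
     exp_bump 1 (real (Suc k) * x + (- real (Suc k) * a)) * exp_bump 1 (- real (Suc k) * x + real (Suc k) * b)"

lemma interval_bump_altdef:
  "interval_bump a b k x =
    (if a < x \<and> x < b then exp (- (1 / (real (Suc k) * (x - a)))) * exp (- (1 / (real (Suc k) * (b - x)))) else 0)"
proof -
  have e: "real (Suc k) * x + (- real (Suc k) * a) = real (Suc k) * (x - a)"
    "- real (Suc k) * x + real (Suc k) * b = real (Suc k) * (b - x)"
    by (auto simp: algebra_simps)
  have "real (Suc k) * (x - a) > 0 \<longleftrightarrow> a < x" "real (Suc k) * (b - x) > 0 \<longleftrightarrow> x < b"
    by (simp_all add: zero_less_mult_iff del: of_nat_Suc)
  then show ?thesis unfolding interval_bump_def e exp_bump_def by auto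
qed

lemma test_fun_interval_bump: "test_fun (interval_bump a b k)"
proof -
  have "{x. interval_bump a b k x \<noteq> 0} \<subseteq> {a..b}"
    by (auto simp: interval_bump_altdef split: if_splits)
  then have "bounded {x. interval_bump a b k x \<noteq> 0}"
    using bounded_closed_interval bounded_subset by blast
  moreover have "smooth (interval_bump a b k)"
    unfolding interval_bump_def[abs_def] by (intro smooth_mult smooth_affine smooth_exp_bump)
  ultimately show ?thesis by (simp add: test_fun_def)
qed

lemma interval_bump_bounded: "\<bar>interval_bump a b k x\<bar> \<le> indicator {a<..<b} x"
  by (auto simp: interval_bump_altdef indicator_def abs_mult intro!: mult_le_one)

lemma interval_bump_tendsto: "(\<lambda>k. interval_bump a b k x) \<longlonglongrightarrow> indicator {a<..<b} x"
proof (cases "a < x \<and> x < b")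
  case True
  have T: "(\<lambda>k. exp (- (1 / (real (Suc k) * c)))) \<longlonglongrightarrow> 1" if "c > 0" for c :: real
  proof -
    have "(\<lambda>k. exp (- (inverse (real (Suc k)) * (1 / c)))) \<longlonglongrightarrow> exp (- (0 * (1 / c)))"
      by (intro tendsto_intros LIMSEQ_inverse_real_of_nat)
    then show ?thesis by (simp add: field_simps)
  qed
  have "(\<lambda>k. exp (- (1 / (real (Suc k) * (x - a)))) * exp (- (1 / (real (Suc k) * (b - x))))) \<longlonglongrightarrow> 1 * 1"
    using True by (intro tendsto_mult T) auto
  then show ?thesis using True by (simp add: interval_bump_altdef[abs_def] del: of_nat_Suc)
qed (auto simp: interval_bump_altdef)

lemma test_fun_deriv:
  assumes "test_fun \<eta>" shows "test_fun (deriv \<eta>)"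
proof -
  have "deriv \<eta> x = 0" if "x \<notin> closure {x. \<eta> x \<noteq> 0}" for x
  proof -
    have "\<forall>\<^sub>F y in nhds x. \<eta> y = 0"
      by (rule eventually_mono[OF eventually_nhds_in_open[of "- closure {x. \<eta> x \<noteq> 0}" x]])
        (use that closure_subset[of "{x. \<eta> x \<noteq> 0}"] in \<open>auto simp: open_Compl\<close>)
    from deriv_cong_ev[OF this refl] show ?thesis by simp
  qed
  then have "{x. deriv \<eta> x \<noteq> 0} \<subseteq> closure {x. \<eta> x \<noteq> 0}" by blast
  then have "bounded {x. deriv \<eta> x \<noteq> 0}"
    using assms bounded_subset compact_imp_bounded unfolding test_fun_def by blast
  then show ?thesis using assms smooth_deriv by (auto simp: test_fun_def)
qed

section \<open>Square integrable functions and weak derivatives\<close>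

definition square_integrable :: "(real \<Rightarrow> real) \<Rightarrow> bool" where
  "square_integrable f \<longleftrightarrow> f \<in> borel_measurable lebesgue \<and> integrable lebesgue (\<lambda>x. (f x)\<^sup>2)"

text \<open>Only used for square integrable \<open>f\<close> and \<open>g\<close>, where both integrals converge absolutely.\<close>

definition has_weak_deriv :: "(real \<Rightarrow> real) \<Rightarrow> (real \<Rightarrow> real) \<Rightarrow> bool" where
  "has_weak_deriv f g \<longleftrightarrow>
     (\<forall>\<eta>. test_fun \<eta> \<longrightarrow> (LINT x|lebesgue. f x * deriv \<eta> x) = - (LINT x|lebesgue. g x * \<eta> x))"

definition in_H1 :: "(real \<Rightarrow> real) \<Rightarrow> bool" where
  "in_H1 f \<longleftrightarrow> square_integrable f \<and> (\<exists>g. square_integrable g \<and> has_weak_deriv f g)"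

definition weak_deriv :: "(real \<Rightarrow> real) \<Rightarrow> real \<Rightarrow> real" where
  "weak_deriv f = (SOME g. square_integrable g \<and> has_weak_deriv f g)"

lemma square_integrable_mult:
  assumes "square_integrable f" "square_integrable g"
  shows "integrable lebesgue (\<lambda>x. f x * g x)"
proof (rule Bochner_Integration.integrable_bound)
  show "integrable lebesgue (\<lambda>x. (f x)\<^sup>2 + (g x)\<^sup>2)"
    using assms by (auto simp: square_integrable_def)
  show "(\<lambda>x. f x * g x) \<in> borel_measurable lebesgue"
    using assms by (auto simp: square_integrable_def)
  have "\<bar>a * b\<bar> \<le> a\<^sup>2 + b\<^sup>2" for a b :: real
  proof -
    have "0 \<le> (\<bar>a\<bar> - \<bar>b\<bar>)\<^sup>2" by simp
    also have "\<dots> = a\<^sup>2 + b\<^sup>2 - 2 * \<bar>a * b\<bar>" by (simp add: power2_diff abs_mult)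
    finally show ?thesis by (smt (verit) abs_ge_zero)
  qed
  then show "AE x in lebesgue. norm (f x * g x) \<le> norm ((f x)\<^sup>2 + (g x)\<^sup>2)"
    by simp
qed

lemma square_integrable_add:
  assumes "square_integrable f" "square_integrable g"
  shows "square_integrable (\<lambda>x. f x + g x)"
proof -
  have "integrable lebesgue (\<lambda>x. (f x)\<^sup>2 + (g x)\<^sup>2 + 2 * (f x * g x))"
    using assms square_integrable_mult[OF assms] by (auto simp: square_integrable_def)
  then show ?thesis
    using assms by (auto simp: square_integrable_def power2_sum algebra_simps)
qed

lemma square_integrable_scale: "square_integrable f \<Longrightarrow> square_integrable (\<lambda>x. c * f x)"
  by (auto simp: square_integrable_def power_mult_distrib)

lemma square_integrable_zero: "square_integrable (\<lambda>x. 0)"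
  by (auto simp: square_integrable_def)

lemma square_integrable_test_fun:
  assumes "test_fun \<eta>" shows "square_integrable \<eta>"
proof -
  have c: "continuous_on A \<eta>" for A
    using assms smooth_continuous_on by (auto simp: test_fun_def)
  have m: "\<eta> \<in> borel_measurable lebesgue"
    using borel_measurable_continuous_onI[OF c] by (intro measurable_completion) simp
  let ?K = "closure {x. \<eta> x \<noteq> 0}"
  have "integrable lborel (\<lambda>x. indicator ?K x *\<^sub>R (\<eta> x)\<^sup>2)"
    using assms by (intro borel_integrable_compact continuous_intros c) (auto simp: test_fun_def)
  then have "integrable lebesgue (\<lambda>x. indicator ?K x *\<^sub>R (\<eta> x)\<^sup>2)"
    by (subst integrable_completion) auto
  moreover have "(\<lambda>x. indicator ?K x *\<^sub>R (\<eta> x)\<^sup>2) = (\<lambda>x. (\<eta> x)\<^sup>2)"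
    using closure_subset[of "{x. \<eta> x \<noteq> 0}"] by (auto simp: indicator_def fun_eq_iff)
  ultimately show ?thesis using m by (simp add: square_integrable_def)
qed

lemma AE_zero_of_interval_integrals:
  fixes g :: "real \<Rightarrow> real"
  assumes g: "integrable lborel g"
    and 0: "\<And>x. (LINT y|lborel. indicator {x<..} y * g y) = 0"
  shows "AE x in lborel. g x = 0"
proof -
  note [measurable] = borel_measurable_integrable[OF g]
  let ?M = "density lborel (\<lambda>x. ennreal (g x))" and ?N = "density lborel (\<lambda>x. ennreal (- g x))"
  have i: "integrable lborel (\<lambda>y. indicator {x<..} y * g y)" for x
    using integrable_mult_indicator[OF _ g, of "{x<..}"] by simp
  have fin: "(\<integral>\<^sup>+y. ennreal (h y) \<partial>lborel) < \<infinity>" if "integrable lborel h" for h :: "real \<Rightarrow> real"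
  proof -
    have "(\<integral>\<^sup>+y. ennreal (h y) \<partial>lborel) \<le> (\<integral>\<^sup>+y. ennreal (norm (h y)) \<partial>lborel)"
      by (intro nn_integral_mono) (auto intro: ennreal_leI)
    also have "\<dots> < \<infinity>" using that by (simp add: integrable_iff_bounded)
    finally show ?thesis .
  qed
  have eM: "emeasure ?M {x<..} = (\<integral>\<^sup>+y. ennreal (indicator {x<..} y * g y) \<partial>lborel)" for x
    by (subst emeasure_density) (auto intro!: nn_integral_cong simp: indicator_def)
  have eN: "emeasure ?N {x<..} = (\<integral>\<^sup>+y. ennreal (- (indicator {x<..} y * g y)) \<partial>lborel)" for x
    by (subst emeasure_density) (auto intro!: nn_integral_cong simp: indicator_def)
  have "?M = ?N"
  proof (rule measure_eqI_lessThan)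
    fix x :: real
    show "emeasure ?M {x<..} < \<infinity>" unfolding eM by (rule fin[OF i])
    have fN: "emeasure ?N {x<..} < \<infinity>" unfolding eN by (rule fin[OF integrable_minus[OF i]])
    have "enn2real (emeasure ?M {x<..}) = enn2real (emeasure ?N {x<..})"
      using 0[of x] real_lebesgue_integral_def[OF i[of x]] unfolding eM eN by simp
    then have e: "ennreal (enn2real (emeasure ?M {x<..})) = ennreal (enn2real (emeasure ?N {x<..}))"
      by (rule arg_cong)
    have fM: "emeasure ?M {x<..} < \<infinity>" unfolding eM by (rule fin[OF i])
    show "emeasure ?M {x<..} = emeasure ?N {x<..}"
      using e unfolding ennreal_enn2real[OF fM[unfolded infinity_ennreal_def]]
        ennreal_enn2real[OF fN[unfolded infinity_ennreal_def]] .
  qed auto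
  then have "AE x in lborel. ennreal (g x) = ennreal (- g x)"
    by (intro iffD1[OF finite_density_unique]) (use fin[OF g] in auto)
  then show ?thesis
  proof eventually_elim
    case (elim x)
    show ?case
    proof (cases "g x \<ge> 0")
      case True
      then have "ennreal (g x) = 0" using elim by (simp add: ennreal_neg)
      then show ?thesis using True by simp
    next
      case False
      then have "ennreal (- g x) = 0" using elim by (simp add: ennreal_neg)
      then show ?thesis using False by simp
    qed
  qed
qed

lemma AE_zero_of_test_fun:
  assumes g: "square_integrable g"
    and 0: "\<And>\<eta>. test_fun \<eta> \<Longrightarrow> (LINT x|lebesgue. g x * \<eta> x) = 0"
  shows "AE x in lebesgue. g x = 0"
proof -
  note [measurable] = conjunct1[OF g[unfolded square_integrable_def]]
  obtain h where h[measurable]: "h \<in> borel_measurable lborel" and gh: "AE x in lborel. g x = h x"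
    using completion_ex_borel_measurable_real[of g lborel] by auto
  have gh': "AE x in lebesgue. g x = h x" using gh by (rule AE_completion)
  have hm[measurable]: "h \<in> borel_measurable lebesgue" using h by (rule measurable_completion)
  have im[measurable]: "(indicator {a<..<b} :: real \<Rightarrow> real) \<in> borel_measurable lebesgue" for a b :: real
    by (intro measurable_completion) simp
  have I: "square_integrable (indicator {a<..<b} :: real \<Rightarrow> real)" for a b :: real
  proof -
    have "integrable lborel (indicator {a<..<b} :: real \<Rightarrow> real)"
      by (intro integrable_real_indicator emeasure_bounded_finite) auto
    then have "integrable lebesgue (indicator {a<..<b} :: real \<Rightarrow> real)"
      by (simp add: integrable_completion)
    moreover have "(\<lambda>x. (indicator {a<..<b} x :: real)\<^sup>2) = indicator {a<..<b}"
      by (auto simp: indicator_def)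
    ultimately show ?thesis by (simp add: square_integrable_def borel_measurable_integrable)
  qed
  have Z: "(LINT x|lebesgue. g x * indicator {a<..<b} x) = 0" for a b
  proof -
    have "(\<lambda>k. LINT x|lebesgue. g x * interval_bump a b k x) \<longlonglongrightarrow> (LINT x|lebesgue. g x * indicator {a<..<b} x)"
    proof (rule integral_dominated_convergence[where w = "\<lambda>x. norm (g x * indicator {a<..<b} x)"])
      show "(\<lambda>x. g x * indicator {a<..<b} x) \<in> borel_measurable lebesgue"
        using square_integrable_mult[OF g I] by (rule borel_measurable_integrable)
      show "(\<lambda>x. g x * interval_bump a b k x) \<in> borel_measurable lebesgue" for k
        using square_integrable_mult[OF g square_integrable_test_fun[OF test_fun_interval_bump]]
        by (rule borel_measurable_integrable)
      show "integrable lebesgue (\<lambda>x. norm (g x * indicator {a<..<b} x))"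
        using square_integrable_mult[OF g I] by (rule integrable_norm)
      show "AE x in lebesgue. (\<lambda>k. g x * interval_bump a b k x) \<longlonglongrightarrow> g x * indicator {a<..<b} x"
        by (intro AE_I2 tendsto_intros interval_bump_tendsto)
      show "AE x in lebesgue. norm (g x * interval_bump a b k x) \<le> norm (g x * indicator {a<..<b} x)" for k
        using interval_bump_bounded[of a b k] by (intro AE_I2) (simp add: abs_mult mult_left_mono)
    qed
    then have "(\<lambda>k::nat. 0::real) \<longlonglongrightarrow> (LINT x|lebesgue. g x * indicator {a<..<b} x)"
      by (simp only: 0[OF test_fun_interval_bump])
    from LIMSEQ_unique[OF tendsto_const this] show ?thesis by simp
  qed
  have "AE x in lborel. h x * indicator {- real N<..<real N} x = 0" for N
  proof (rule AE_zero_of_interval_integrals)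
    have "integrable lebesgue (\<lambda>x. g x * indicator {- real N<..<real N} x)"
      by (rule square_integrable_mult[OF g I])
    then have "integrable lebesgue (\<lambda>x. h x * indicator {- real N<..<real N} x)"
    proof (rule integrable_cong_AE_imp)
      show "AE x in lebesgue. g x * indicator {- real N<..<real N} x = h x * indicator {- real N<..<real N} x"
        using gh' by eventually_elim simp
    qed measurable
    then show "integrable lborel (\<lambda>x. h x * indicator {- real N<..<real N} x)"
      by (simp add: integrable_completion)
    fix x
    have "(LINT y|lborel. indicator {x<..} y * (h y * indicator {- real N<..<real N} y))
      = (LINT y|lborel. h y * indicator {max x (- real N)<..<real N} y)"
      by (intro Bochner_Integration.integral_cong) (auto simp: indicator_def)
    also have "\<dots> = (LINT y|lebesgue. h y * indicator {max x (- real N)<..<real N} y)"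
      by (simp add: integral_completion)
    also have "\<dots> = (LINT y|lebesgue. g y * indicator {max x (- real N)<..<real N} y)"
    proof (rule integral_cong_AE)
      show "AE y in lebesgue. h y * indicator {max x (- real N)<..<real N} y
          = g y * indicator {max x (- real N)<..<real N} y"
        using gh' by eventually_elim simp
    qed measurable
    finally show "(LINT y|lborel. indicator {x<..} y * (h y * indicator {- real N<..<real N} y)) = 0"
      using Z by simp
  qed
  then have "AE x in lborel. \<forall>N. h x * indicator {- real N<..<real N} x = 0"
    unfolding AE_all_countable by blast
  then have "AE x in lborel. h x = 0"
  proof eventually_elim
    case (elim x)
    obtain N where "\<bar>x\<bar> < real N" using reals_Archimedean2 by blast
    then show ?case using elim[rule_format, of N] by (auto simp: indicator_def)
  qed
  then have "AE x in lborel. g x = 0" using gh by eventually_elim auto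
  then show ?thesis by (rule AE_completion)
qed

lemma has_weak_deriv_unique:
  assumes "has_weak_deriv f g" "has_weak_deriv f g'" "square_integrable g" "square_integrable g'"
  shows "AE x in lebesgue. g x = g' x"
proof -
  have s: "square_integrable (\<lambda>x. g x + (-1) * g' x)"
    using assms by (intro square_integrable_add square_integrable_scale)
  have "AE x in lebesgue. g x + (-1) * g' x = 0"
  proof (rule AE_zero_of_test_fun[OF s])
    fix \<eta> assume t: "test_fun \<eta>"
    then have "(LINT x|lebesgue. g x * \<eta> x) = (LINT x|lebesgue. g' x * \<eta> x)"
      using assms(1,2) by (auto simp: has_weak_deriv_def)
    then show "(LINT x|lebesgue. (g x + (-1) * g' x) * \<eta> x) = 0"
      using assms t square_integrable_mult square_integrable_test_fun
      by (simp add: left_diff_distrib)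
  qed
  then show ?thesis by simp
qed

lemma in_H1_weak_deriv:
  assumes "in_H1 f"
  shows "square_integrable (weak_deriv f)" "has_weak_deriv f (weak_deriv f)"
  using someI_ex[OF conjunct2[OF assms[unfolded in_H1_def]]] by (auto simp: weak_deriv_def)

lemma weak_deriv_eqI:
  assumes "in_H1 f" "square_integrable g" "has_weak_deriv f g"
  shows "AE x in lebesgue. weak_deriv f x = g x"
  using has_weak_deriv_unique in_H1_weak_deriv assms by blast

lemma has_weak_deriv_add:
  assumes "square_integrable f" "square_integrable f'" "square_integrable g" "square_integrable g'"
    and "has_weak_deriv f g" "has_weak_deriv f' g'"
  shows "has_weak_deriv (\<lambda>x. f x + f' x) (\<lambda>x. g x + g' x)"
  using assms
  by (auto simp: has_weak_deriv_def distrib_right square_integrable_mult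
      square_integrable_test_fun test_fun_deriv)

lemma has_weak_deriv_scale: "has_weak_deriv f g \<Longrightarrow> has_weak_deriv (\<lambda>x. c * f x) (\<lambda>x. c * g x)"
  by (auto simp: has_weak_deriv_def mult.assoc)

lemma has_weak_deriv_cong_AE:
  assumes "has_weak_deriv f g" "AE x in lebesgue. f x = f' x"
    "square_integrable f" "square_integrable f'"
  shows "has_weak_deriv f' g"
proof -
  have "(LINT x|lebesgue. f x * deriv \<eta> x) = (LINT x|lebesgue. f' x * deriv \<eta> x)" if "test_fun \<eta>" for \<eta>
    using assms(2) square_integrable_mult square_integrable_test_fun[OF test_fun_deriv[OF that]] assms(3,4)
    by (intro integral_cong_AE borel_measurable_integrable) auto
  then show ?thesis using assms(1) by (auto simp: has_weak_deriv_def)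
qed

lemma in_H1I: "square_integrable f \<Longrightarrow> square_integrable g \<Longrightarrow> has_weak_deriv f g \<Longrightarrow> in_H1 f"
  by (auto simp: in_H1_def)

lemma in_H1_square_integrable: "in_H1 f \<Longrightarrow> square_integrable f"
  by (simp add: in_H1_def)

lemma in_H1_add:
  assumes "in_H1 f" "in_H1 g" shows "in_H1 (\<lambda>x. f x + g x)"
  by (rule in_H1I[OF square_integrable_add square_integrable_add has_weak_deriv_add])
    (fact in_H1_square_integrable[OF assms(1)] in_H1_square_integrable[OF assms(2)]
      in_H1_weak_deriv[OF assms(1)] in_H1_weak_deriv[OF assms(2)])+

lemma in_H1_scale:
  assumes "in_H1 f" shows "in_H1 (\<lambda>x. c * f x)"
  by (rule in_H1I[OF square_integrable_scale square_integrable_scale has_weak_deriv_scale])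
    (fact in_H1_square_integrable[OF assms] in_H1_weak_deriv[OF assms])+

lemma in_H1_zero: "in_H1 (\<lambda>x. 0)"
  unfolding in_H1_def using square_integrable_zero by (auto simp: has_weak_deriv_def)

lemma weak_deriv_add:
  assumes "in_H1 f" "in_H1 g"
  shows "AE x in lebesgue. weak_deriv (\<lambda>x. f x + g x) x = weak_deriv f x + weak_deriv g x"
  using assms in_H1_weak_deriv
  by (intro weak_deriv_eqI in_H1_add square_integrable_add has_weak_deriv_add) (auto simp: in_H1_def)

lemma weak_deriv_scale:
  assumes "in_H1 f"
  shows "AE x in lebesgue. weak_deriv (\<lambda>x. c * f x) x = c * weak_deriv f x"
  using assms in_H1_weak_deriv
  by (intro weak_deriv_eqI in_H1_scale square_integrable_scale has_weak_deriv_scale)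

lemma weak_deriv_cong_AE:
  assumes "in_H1 f" "in_H1 g" "AE x in lebesgue. f x = g x"
  shows "AE x in lebesgue. weak_deriv f x = weak_deriv g x"
proof (rule weak_deriv_eqI)
  have "AE x in lebesgue. g x = f x" using assms(3) by eventually_elim auto
  then show "has_weak_deriv f (weak_deriv g)"
    using assms in_H1_weak_deriv has_weak_deriv_cong_AE in_H1_def by blast
qed (use assms in_H1_weak_deriv in auto)

section \<open>The Hilbert space of \<open>H\<^sup>1\<close> functions modulo equality almost everywhere\<close>

definition H1_rel :: "(real \<Rightarrow> real) \<Rightarrow> (real \<Rightarrow> real) \<Rightarrow> bool" where
  "H1_rel f g \<longleftrightarrow> in_H1 f \<and> in_H1 g \<and> (AE x in lebesgue. f x = g x)"

text \<open>The class of \<open>f\<close> is \<open>abs_H1 f\<close>; it is meaningful only when \<open>in_H1 f\<close> holds.\<close>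

quotient_type H1 = "real \<Rightarrow> real" / partial: H1_rel morphisms rep_H1 abs_H1
proof (rule part_equivpI)
  show "\<exists>x. H1_rel x x" using in_H1_zero by (auto simp: H1_rel_def)
  show "symp H1_rel"
    by (rule sympI) (auto simp: H1_rel_def)
  show "transp H1_rel"
    by (rule transpI) (auto simp: H1_rel_def)
qed

instantiation H1 :: real_inner
begin

lift_definition zero_H1 :: H1 is "\<lambda>x. 0"
  using in_H1_zero by (simp add: H1_rel_def)

lift_definition plus_H1 :: "H1 \<Rightarrow> H1 \<Rightarrow> H1" is "\<lambda>f g x. f x + g x"
  unfolding H1_rel_def using in_H1_add by auto

lift_definition scaleR_H1 :: "real \<Rightarrow> H1 \<Rightarrow> H1" is "\<lambda>c f x. c * f x"
  unfolding H1_rel_def using in_H1_scale by auto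

lift_definition inner_H1 :: "H1 \<Rightarrow> H1 \<Rightarrow> real" is
  "\<lambda>f g. (LINT x|lebesgue. f x * g x) + (LINT x|lebesgue. weak_deriv f x * weak_deriv g x)"
proof -
  fix f f' g g' assume "H1_rel f f'" "H1_rel g g'"
  then have a: "in_H1 f" "in_H1 f'" "in_H1 g" "in_H1 g'"
    "AE x in lebesgue. f x = f' x" "AE x in lebesgue. g x = g' x" by (auto simp: H1_rel_def)
  note b = weak_deriv_cong_AE[OF a(1,2,5)] weak_deriv_cong_AE[OF a(3,4,6)]
  have m[measurable]: "h \<in> borel_measurable lebesgue" "weak_deriv h \<in> borel_measurable lebesgue" if "in_H1 h" for h
    using that in_H1_weak_deriv by (auto simp: in_H1_def square_integrable_def)
  have "(LINT x|lebesgue. f x * g x) = (LINT x|lebesgue. f' x * g' x)"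
    by (rule integral_cong_AE) (use a m in auto)
  moreover have "(LINT x|lebesgue. weak_deriv f x * weak_deriv g x)
      = (LINT x|lebesgue. weak_deriv f' x * weak_deriv g' x)"
    by (rule integral_cong_AE) (use a b m in auto)
  ultimately show "(LINT x|lebesgue. f x * g x) + (LINT x|lebesgue. weak_deriv f x * weak_deriv g x)
    = (LINT x|lebesgue. f' x * g' x) + (LINT x|lebesgue. weak_deriv f' x * weak_deriv g' x)" by simp
qed

definition uminus_H1 :: "H1 \<Rightarrow> H1" where "uminus_H1 u = (-1) *\<^sub>R u"
definition minus_H1 :: "H1 \<Rightarrow> H1 \<Rightarrow> H1" where "minus_H1 u v = u + (-1) *\<^sub>R v"
definition norm_H1 :: "H1 \<Rightarrow> real" where "norm_H1 u = sqrt (inner u u)"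
definition dist_H1 :: "H1 \<Rightarrow> H1 \<Rightarrow> real" where "dist_H1 u v = norm (u - v)"
definition sgn_H1 :: "H1 \<Rightarrow> H1" where "sgn_H1 u = inverse (norm u) *\<^sub>R u"
definition uniformity_H1 :: "(H1 \<times> H1) filter" where
  "uniformity_H1 = (INF e\<in>{0<..}. principal {(x, y). dist x y < e})"
definition open_H1 :: "H1 set \<Rightarrow> bool" where
  "open_H1 S \<longleftrightarrow> (\<forall>x\<in>S. \<forall>\<^sub>F (x', y) in uniformity. x' = x \<longrightarrow> y \<in> S)"

instance
proof
  have z: "\<And>f. H1_rel f f \<Longrightarrow> in_H1 f" by (simp add: H1_rel_def)
  have sq: "square_integrable f" "square_integrable (weak_deriv f)" if "H1_rel f f" for f
    using that in_H1_weak_deriv by (auto simp: H1_rel_def in_H1_def)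
  fix u v w :: H1 and a b :: real
  show "u + v + w = u + (v + w)"
    by transfer (auto simp: H1_rel_def add.assoc intro!: in_H1_add)
  show "u + v = v + u"
    by transfer (auto simp: H1_rel_def add.commute intro!: in_H1_add)
  show "0 + u = u"
    by transfer (auto simp: H1_rel_def)
  show "- u + u = 0"
    unfolding uminus_H1_def
    by transfer (auto simp: H1_rel_def in_H1_zero)
  show "u - v = u + - v" by (simp add: minus_H1_def uminus_H1_def)
  show "a *\<^sub>R (u + v) = a *\<^sub>R u + a *\<^sub>R v"
    by transfer (auto simp: H1_rel_def distrib_left intro!: in_H1_add in_H1_scale)
  show "(a + b) *\<^sub>R u = a *\<^sub>R u + b *\<^sub>R u"
    by transfer (auto simp: H1_rel_def distrib_right intro!: in_H1_add in_H1_scale)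
  show "a *\<^sub>R b *\<^sub>R u = (a * b) *\<^sub>R u"
    by transfer (auto simp: H1_rel_def mult.assoc intro!: in_H1_scale)
  show "1 *\<^sub>R u = u"
    by transfer (auto simp: H1_rel_def)
  show "sgn u = inverse (norm u) *\<^sub>R u" by (rule sgn_H1_def)
  show "dist u v = norm (u - v)" by (rule dist_H1_def)
  show "(uniformity :: (H1 \<times> H1) filter) = (INF e\<in>{0<..}. principal {(x, y). dist x y < e})"
    by (rule uniformity_H1_def)
  show "open S \<longleftrightarrow> (\<forall>x\<in>S. \<forall>\<^sub>F (x', y) in uniformity. x' = x \<longrightarrow> y \<in> S)" for S :: "H1 set"
    by (rule open_H1_def)
  show "inner u v = inner v u"
    by transfer (simp add: mult.commute)
  show "inner (u + v) w = inner u w + inner v w"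
  proof transfer
    fix f g h assume H: "H1_rel f f" "H1_rel g g" "H1_rel h h"
    have "(LINT x|lebesgue. weak_deriv (\<lambda>x. f x + g x) x * weak_deriv h x)
      = (LINT x|lebesgue. weak_deriv f x * weak_deriv h x + weak_deriv g x * weak_deriv h x)"
      using weak_deriv_add[OF z[OF H(1)] z[OF H(2)]]
        sq[OF H(1)] sq[OF H(2)] sq[OF H(3)] in_H1_weak_deriv(1)[OF in_H1_add[OF z[OF H(1)] z[OF H(2)]]]
      by (intro integral_cong_AE) (auto simp: square_integrable_def distrib_right)
    then show "(LINT x|lebesgue. (f x + g x) * h x) +
        (LINT x|lebesgue. weak_deriv (\<lambda>x. f x + g x) x * weak_deriv h x)
      = (LINT x|lebesgue. f x * h x) + (LINT x|lebesgue. weak_deriv f x * weak_deriv h x) +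
        ((LINT x|lebesgue. g x * h x) + (LINT x|lebesgue. weak_deriv g x * weak_deriv h x))"
      using H sq by (simp add: distrib_right square_integrable_mult)
  qed
  show "inner (a *\<^sub>R u) v = a * inner u v"
  proof transfer
    fix a :: real and f h assume H: "H1_rel f f" "H1_rel h h"
    have "(LINT x|lebesgue. weak_deriv (\<lambda>x. a * f x) x * weak_deriv h x)
      = (LINT x|lebesgue. a * (weak_deriv f x * weak_deriv h x))"
      using weak_deriv_scale[OF z[OF H(1)], of a]
        sq[OF H(1)] sq[OF H(2)] in_H1_weak_deriv(1)[OF in_H1_scale[OF z[OF H(1)], of a]]
      by (intro integral_cong_AE) (auto simp: square_integrable_def)
    then show "(LINT x|lebesgue. (a * f x) * h x) +
        (LINT x|lebesgue. weak_deriv (\<lambda>x. a * f x) x * weak_deriv h x)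
      = a * ((LINT x|lebesgue. f x * h x) + (LINT x|lebesgue. weak_deriv f x * weak_deriv h x))"
      by (simp add: mult.assoc distrib_left)
  qed
  show "0 \<le> inner u u"
    by transfer simp
  show "inner u u = 0 \<longleftrightarrow> u = 0"
  proof transfer
    fix f assume H: "H1_rel f f"
    show "(LINT x|lebesgue. f x * f x) + (LINT x|lebesgue. weak_deriv f x * weak_deriv f x) = 0
        \<longleftrightarrow> H1_rel f (\<lambda>x. 0)"
    proof
      assume "(LINT x|lebesgue. f x * f x) + (LINT x|lebesgue. weak_deriv f x * weak_deriv f x) = 0"
      moreover have "(LINT x|lebesgue. f x * f x) \<ge> 0"
        "(LINT x|lebesgue. weak_deriv f x * weak_deriv f x) \<ge> 0" by simp_all
      ultimately have "(LINT x|lebesgue. f x * f x) = 0" by linarith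
      then have "AE x in lebesgue. f x * f x = 0"
        using integral_nonneg_eq_0_iff_AE[OF square_integrable_mult[OF sq(1)[OF H] sq(1)[OF H]]] by simp
      then show "H1_rel f (\<lambda>x. 0)" using z[OF H] in_H1_zero by (auto simp: H1_rel_def)
    next
      assume "H1_rel f (\<lambda>x. 0)"
      then have f0: "AE x in lebesgue. f x = 0" by (simp add: H1_rel_def)
      have "has_weak_deriv (\<lambda>x. 0) (\<lambda>x. 0)" by (simp add: has_weak_deriv_def)
      moreover have "AE x in lebesgue. 0 = f x" using f0 by eventually_elim simp
      ultimately have "has_weak_deriv f (\<lambda>x. 0)"
        by (rule has_weak_deriv_cong_AE[OF _ _ square_integrable_zero sq(1)[OF H]])
      then have "AE x in lebesgue. weak_deriv f x = 0"
        by (rule weak_deriv_eqI[OF z[OF H] square_integrable_zero])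
      then have "(LINT x|lebesgue. weak_deriv f x * weak_deriv f x) = 0"
        by (intro integral_eq_zero_AE) auto
      moreover have "(LINT x|lebesgue. f x * f x) = 0"
        using f0 by (intro integral_eq_zero_AE) auto
      ultimately show "(LINT x|lebesgue. f x * f x) + (LINT x|lebesgue. weak_deriv f x * weak_deriv f x) = 0"
        by simp
    qed
  qed
  show "norm u = sqrt (inner u u)" by (rule norm_H1_def)
qed

end

section \<open>The magma equation\<close>

definition C1_on_nonneg :: "(real \<Rightarrow> 'a::real_normed_vector) \<Rightarrow> bool" where
  "C1_on_nonneg F \<longleftrightarrow>
     (\<exists>F'. continuous_on {0..} F' \<and> (\<forall>t\<ge>0. (F has_vector_derivative F' t) (at t within {0..})))"

text \<open>
  \<open>u\<close> is a weak solution of \<open>- (p\<^sup>n u\<^sub>z)\<^sub>z + p\<^sup>m u = - (p\<^sup>n)\<^sub>z\<close>. The integrability conditions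
  rule out the default value \<open>0\<close> of a divergent integral; they are automatic when \<open>p - 1 \<in> H\<^sup>1\<close>
  is such that \<open>p\<close> is bounded away from \<open>0\<close>.
\<close>

definition weak_solution :: "real \<Rightarrow> real \<Rightarrow> (real \<Rightarrow> real) \<Rightarrow> (real \<Rightarrow> real) \<Rightarrow> bool" where
  "weak_solution n m p u \<longleftrightarrow> in_H1 u \<and>
     (\<forall>\<eta>. test_fun \<eta> \<longrightarrow>
        integrable lebesgue (\<lambda>z. p z powr n * weak_deriv u z * deriv \<eta> z) \<and>
        integrable lebesgue (\<lambda>z. p z powr m * u z * \<eta> z) \<and>
        integrable lebesgue (\<lambda>z. p z powr n * deriv \<eta> z) \<and>
        (LINT z|lebesgue. p z powr n * weak_deriv u z * deriv \<eta> z)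
          + (LINT z|lebesgue. p z powr m * u z * \<eta> z)
        = (LINT z|lebesgue. p z powr n * deriv \<eta> z))"

text \<open>
  A solution is represented by \<open>\<phi> t z\<close> with time as the first argument; spatial profiles matter
  only up to null sets, and only times \<open>t \<ge> 0\<close> matter. The time integral is that of a curve
  in \<^typ>\<open>H1\<close>.
\<close>

definition magma_solution ::
    "real \<Rightarrow> real \<Rightarrow> (real \<Rightarrow> real) \<Rightarrow> (real \<Rightarrow> real \<Rightarrow> real) \<Rightarrow> bool" where
  "magma_solution n m \<phi>0 \<phi> \<longleftrightarrow>
     (\<forall>t\<ge>0. AE z in lebesgue. \<phi> t z > 0) \<and>
     (\<forall>t\<ge>0. in_H1 (\<lambda>z. \<phi> t z - 1)) \<and>
     C1_on_nonneg (\<lambda>t. abs_H1 (\<lambda>z. \<phi> t z - 1)) \<and>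
     (\<exists>u.
        (\<forall>s\<ge>0. weak_solution n m (\<phi> s) (u s) \<and>
                (\<forall>v. weak_solution n m (\<phi> s) v \<longrightarrow> (AE z in lebesgue. v z = u s z)) \<and>
                in_H1 (\<lambda>z. \<phi> s z powr m * u s z)) \<and>
        (\<forall>t\<ge>0. (\<lambda>s. abs_H1 (\<lambda>z. \<phi> s z powr m * u s z)) integrable_on {0..t} \<and>
                abs_H1 (\<lambda>z. \<phi> t z - 1) = abs_H1 (\<lambda>z. \<phi>0 z - 1)
                  + integral {0..t} (\<lambda>s. abs_H1 (\<lambda>z. \<phi> s z powr m * u s z))))"

text \<open>\<open>\<parallel>1/f\<parallel>\<^sub>\<infinity> < \<infinity>\<close>; the reciprocal is taken in \<^typ>\<open>ennreal\<close>, where it is infinite at zeros of \<open>f\<close>.\<close>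

definition reciprocal_ess_bounded :: "(real \<Rightarrow> real) \<Rightarrow> bool" where
  "reciprocal_ess_bounded f \<longleftrightarrow> esssup lebesgue (\<lambda>z. inverse (ennreal \<bar>f z\<bar>)) < \<infinity>"

end

theory Submission
  imports Defs
begin

text \<open>
  In the variable \<open>\<gamma> = G(\<phi>)\<close>, where \<open>G' = x\<^sup>-\<^sup>m\<close> and \<open>G(1) = 0\<close>, the equation reads \<open>\<gamma>\<^sub>t = u\<close>, and
  \<open>u\<close> solves an elliptic problem whose coefficients \<open>\<phi>\<^sup>n\<close>, \<open>\<phi>\<^sup>m\<close> are functions of \<open>\<gamma>\<close>. Once these are
  truncated to bounded Lipschitz functions, the Lax-Milgram theorem makes \<open>\<gamma> \<mapsto> u\<close> a locally Lipschitz
  vector field on \<open>H\<^sup>1\<close>. Let \<open>H'' = x\<^sup>-\<^sup>n\<^sup>-\<^sup>m\<close> with \<open>H(1) = H'(1) = 0\<close>. Testing the elliptic problem with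
  \<open>H'(\<phi>)\<close> shows that the flow conserves the energy \<open>E = 1/2 \<integral> \<gamma>\<^sub>z\<^sup>2 + \<integral> H(\<phi>)\<close>, which bounds the \<open>H\<^sup>1\<close> norm of
  \<open>\<gamma>\<close>, so the flow is global. If \<open>Q\<close> is the antiderivative of \<open>x\<^sup>-\<^sup>m \<surd>H\<close> that vanishes at \<open>1\<close>, then
  \<open>\<bar>Q(\<phi>)\<bar> \<le> \<integral> \<surd>H(\<phi>) \<bar>\<gamma>\<^sub>z\<bar> \<le> E\<close>; as \<open>Q\<close> diverges at \<open>0\<close> and at \<open>\<infinity>\<close>, \<open>\<phi>\<close> stays between two positive
  constants determined by the data, and the truncation levels can be chosen beyond them. Another solution
  that agrees with \<open>\<phi>\<close> at some time stays inside the truncation levels for a short time, during which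
  Gronwall's inequality in the variable \<open>\<gamma>\<close> shows that it agrees with \<open>\<phi>\<close>.
\<close>

section \<open>Locally absolutely continuous functions\<close>

text \<open>The truncation must be fixed before the flow exists, although its justification comes
  from the flow. This is not circular: as long as the data lie between the levels, their energy is
  given by the untruncated potential with exponent N = n + m and does not depend on the levels. The
  hypotheses on the exponents enter through the divergence of Q. Near 0 the potential is of order
  x^(2 - N), so x^(-m) sqrt H dominates a multiple of 1/x when n + 3m >= 4. Near infinity H grows
  linearly and the same holds when m <= 3/2, which follows by subtracting n + m >= 3 from n + 3m <
  6. In both cases Q diverges at least like a logarithm. For uniqueness the obstacle is that a
  competing solution brings no a priori bounds and only an integral equation in H^1. Both are
  handled with continuous representatives: evaluation at a point is a bounded functional, so the
  change of variables is carried out pointwise, and the truncation levels leave a margin around the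
  range of the flow.\<close>

definition primitive :: "(real \<Rightarrow> real) \<Rightarrow> (real \<Rightarrow> real) \<Rightarrow> bool" where
  "primitive f g \<longleftrightarrow>
     (\<forall>a b. a \<le> b \<longrightarrow> g absolutely_integrable_on {a..b} \<and> integral {a..b} g = f b - f a)"

lemma primitiveD:
  assumes "primitive f g"
  shows "g absolutely_integrable_on {a..b}" "a \<le> b \<Longrightarrow> (g has_integral (f b - f a)) {a..b}"
proof -
  show "g absolutely_integrable_on {a..b}"
    using assms by (cases "a \<le> b") (auto simp: primitive_def)
  then have "g integrable_on {a..b}"
    by (simp add: absolutely_integrable_on_def)
  then show "a \<le> b \<Longrightarrow> (g has_integral (f b - f a)) {a..b}"
    using assms by (simp add: primitive_def has_integral_iff)
qed

lemma primitiveI: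
  assumes "\<And>a b. a \<le> b \<Longrightarrow> g absolutely_integrable_on {a..b}"
    "\<And>a b. a \<le> b \<Longrightarrow> (g has_integral (f b - f a)) {a..b}"
  shows "primitive f g"
  using assms by (auto simp: primitive_def has_integral_iff)

lemma primitive_isCont:
  assumes "primitive f g" shows "isCont f x"
proof -
  have "continuous_on {x-1..x+1} (\<lambda>y. f (x-1) + integral {x-1..y} g)"
    using primitiveD(1)[OF assms] 
    by (intro continuous_intros indefinite_integral_continuous_1) (simp add: absolutely_integrable_on_def)
  moreover have "f (x-1) + integral {x-1..y} g = f y" if "y \<in> {x-1..x+1}" for y
    using primitiveD(2)[OF assms, of "x-1" y] that by (auto simp: has_integral_iff)
  ultimately have "continuous_on {x-1..x+1} f"
    by (rule continuous_on_eq)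
  then have "continuous_on {x-1<..<x+1} f"
    by (rule continuous_on_subset) auto
  then show ?thesis
    by (simp add: continuous_on_eq_continuous_at)
qed

lemma primitive_continuous_on: "primitive f g \<Longrightarrow> continuous_on A f"
  by (simp add: primitive_isCont continuous_at_imp_continuous_on)

lemma primitive_diff_bound:
  assumes "primitive f g" "a \<le> b" shows "\<bar>f b - f a\<bar> \<le> integral {a..b} (\<lambda>x. \<bar>g x\<bar>)"
proof -
  have "norm (integral {a..b} g) \<le> integral {a..b} (\<lambda>x. \<bar>g x\<bar>)"
    using primitiveD(1)[OF assms(1), of a b]
    by (intro integral_norm_bound_integral) (auto simp: absolutely_integrable_on_def)
  then show ?thesis using primitiveD(2)[OF assms] by (simp add: has_integral_iff)
qed

lemma absolutely_integrable_continuous_mult: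
  fixes f g :: "real \<Rightarrow> real"
  assumes "continuous_on {a..b} f" "g absolutely_integrable_on {a..b}"
  shows "(\<lambda>x. f x * g x) absolutely_integrable_on {a..b}"
  using assms
  by (intro absolutely_integrable_bounded_measurable_product_real compact_imp_bounded
     compact_continuous_image continuous_imp_measurable_on_sets_lebesgue) auto

lemma absolutely_integrable_onD:
  fixes g :: "real \<Rightarrow> real"
  assumes "g absolutely_integrable_on S"
  shows "g integrable_on S" "(\<lambda>x. \<bar>g x\<bar>) integrable_on S"
  using assms by (auto simp: absolutely_integrable_on_def)

text \<open>\<open>primitive\<close> is local absolute continuity in integrated form, so no almost
  everywhere derivative is needed: the defect of the claimed identity is bounded by e times the
  integral of \<open>\<bar>g\<bar>\<close>, and such a bound is additive over adjacent intervals,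
  hence follows from its local version by bisection. The set \<open>I\<close> admits a
  \<open>P\<close> that is differentiable only on the range of \<open>f\<close>.\<close>

lemma primitive_chain:
  fixes P P' :: "real \<Rightarrow> real"
  assumes f: "primitive f g" and I: "convex I" "\<And>x. f x \<in> I"
    and P: "\<And>x. x \<in> I \<Longrightarrow> (P has_real_derivative P' x) (at x within I)"
    and P': "continuous_on I P'"
  shows "primitive (\<lambda>x. P (f x)) (\<lambda>x. P' (f x) * g x)"
proof (rule primitiveI)
  have cont: "continuous_on A (\<lambda>x. P' (f x))" for A
    by (rule continuous_on_compose2[OF P' primitive_continuous_on[OF f]]) (use I in auto)
  show ai: "(\<lambda>x. P' (f x) * g x) absolutely_integrable_on {a..b}" for a b
    by (rule absolutely_integrable_continuous_mult[OF cont primitiveD(1)[OF f]])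
  note int = absolutely_integrable_onD[OF ai]
  note gint = absolutely_integrable_onD[OF primitiveD(1)[OF f]]
  fix a b :: real assume ab: "a \<le> b"
  have bound: "\<bar>P (f b) - P (f a) - integral {a..b} (\<lambda>x. P' (f x) * g x)\<bar>
      \<le> e * integral {a..b} (\<lambda>x. \<bar>g x\<bar>)" if "e > 0" for e
    using ab
  proof (induction rule: Bolzano)
    case (trans a b c)
    have "integral {a..c} (\<lambda>x. P' (f x) * g x)
        = integral {a..b} (\<lambda>x. P' (f x) * g x) + integral {b..c} (\<lambda>x. P' (f x) * g x)"
      using trans int by (intro Henstock_Kurzweil_Integration.integral_combine[symmetric]) auto
    moreover have "integral {a..c} (\<lambda>x. \<bar>g x\<bar>) = integral {a..b} (\<lambda>x. \<bar>g x\<bar>) + integral {b..c} (\<lambda>x. \<bar>g x\<bar>)"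
      using trans gint by (intro Henstock_Kurzweil_Integration.integral_combine[symmetric]) auto
    moreover have "e * (integral {a..b} (\<lambda>x. \<bar>g x\<bar>) + integral {b..c} (\<lambda>x. \<bar>g x\<bar>))
        = e * integral {a..b} (\<lambda>x. \<bar>g x\<bar>) + e * integral {b..c} (\<lambda>x. \<bar>g x\<bar>)"
      by (rule distrib_left)
    ultimately show ?case using trans(1,2) by (simp only:)
  next
    case (local x)
    obtain r where r: "r > 0" "\<And>y. y \<in> I \<Longrightarrow> \<bar>y - f x\<bar> < r \<Longrightarrow> \<bar>P' y - P' (f x)\<bar> < e / 2"
      using P' I(2)[of x] \<open>e > 0\<close> unfolding continuous_on_iff dist_real_def
      by (meson half_gt_zero)
    obtain d where d: "d > 0" "\<And>y. \<bar>y - x\<bar> < d \<Longrightarrow> \<bar>f y - f x\<bar> < r"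
      using primitive_isCont[OF f, of x] r(1) unfolding continuous_at_eps_delta dist_real_def by metis
    show ?case
    proof (intro exI[of _ d] conjI allI impI d(1))
      fix a b assume ab: "a \<le> x \<and> x \<le> b \<and> b - a < d"
      then have near: "\<bar>f y - f x\<bar> < r" if "y \<in> {a..b}" for y
        using d(2)[of y] that by auto
      let ?J = "I \<inter> ball (f x) r"
      have J: "f y \<in> ?J" if "y \<in> {a..b}" for y
        using near[OF that] I(2) by (auto simp: dist_real_def)
      \<comment> \<open>On \<open>?J\<close> the derivative of \<open>P\<close> is within e/2 of its
        value at \<open>f x\<close>; the mean value inequality is applied after removing that linear
        part.\<close>
      have "norm ((P (f b) - P' (f x) * f b) - (P (f a) - P' (f x) * f a)) \<le> e / 2 * norm (f b - f a)"
      proof (rule field_differentiable_bound[where S = ?J and f' = "\<lambda>y. P' y - P' (f x)"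
            and f = "\<lambda>y. P y - P' (f x) * y"])
        show "convex ?J" using I(1) by (intro convex_Int) auto
        show "((\<lambda>y. P y - P' (f x) * y) has_real_derivative P' z - P' (f x)) (at z within ?J)" if "z \<in> ?J" for z
          using that by (auto intro!: derivative_eq_intros DERIV_subset[OF P])
        show "norm (P' z - P' (f x)) \<le> e / 2" if "z \<in> ?J" for z
          using that r(2)[of z] by (auto simp: dist_real_def abs_minus_commute)
      qed (use J[of a] J[of b] ab in auto)
      then have "\<bar>P (f b) - P (f a) - P' (f x) * (f b - f a)\<bar> \<le> e / 2 * \<bar>f b - f a\<bar>"
        by (simp add: algebra_simps)
      also have "\<dots> \<le> e / 2 * integral {a..b} (\<lambda>x. \<bar>g x\<bar>)"
        using primitive_diff_bound[OF f] ab \<open>e > 0\<close> by (intro mult_left_mono) auto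
      finally have 1: "\<bar>P (f b) - P (f a) - P' (f x) * (f b - f a)\<bar> \<le> e / 2 * integral {a..b} (\<lambda>x. \<bar>g x\<bar>)" .
      have "norm (integral {a..b} (\<lambda>y. P' (f y) * g y - P' (f x) * g y)) \<le> integral {a..b} (\<lambda>y. e / 2 * \<bar>g y\<bar>)"
      proof (rule integral_norm_bound_integral)
        show "(\<lambda>y. P' (f y) * g y - P' (f x) * g y) integrable_on {a..b}"
          using int gint by (intro integrable_diff integrable_on_mult_right) auto
        show "(\<lambda>y. e / 2 * \<bar>g y\<bar>) integrable_on {a..b}"
          using gint by (intro integrable_on_mult_right) auto
        show "norm (P' (f y) * g y - P' (f x) * g y) \<le> e / 2 * \<bar>g y\<bar>" if "y \<in> {a..b}" for y
          using mult_right_mono[OF less_imp_le[OF r(2)[OF I(2) near[OF that]]], of "\<bar>g y\<bar>"]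
          by (simp add: left_diff_distrib[symmetric] abs_mult)
      qed
      moreover have "integral {a..b} (\<lambda>y. P' (f y) * g y - P' (f x) * g y)
          = integral {a..b} (\<lambda>y. P' (f y) * g y) - P' (f x) * (f b - f a)"
        using int gint primitiveD(2)[OF f, of a b] ab
        by (subst integral_diff) (auto simp: has_integral_iff intro!: integrable_on_mult_right)
      ultimately have 2: "\<bar>integral {a..b} (\<lambda>y. P' (f y) * g y) - P' (f x) * (f b - f a)\<bar> \<le> e / 2 * integral {a..b} (\<lambda>x. \<bar>g x\<bar>)"
        by simp
      show "\<bar>P (f b) - P (f a) - integral {a..b} (\<lambda>x. P' (f x) * g x)\<bar> \<le> e * integral {a..b} (\<lambda>x. \<bar>g x\<bar>)"
        using 1 2 by linarith
    qed
  qed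
  have "P (f b) - P (f a) - integral {a..b} (\<lambda>x. P' (f x) * g x) = 0"
  proof (rule ccontr)
    define G where "G = integral {a..b} (\<lambda>x. \<bar>g x\<bar>)"
    define D where "D = \<bar>P (f b) - P (f a) - integral {a..b} (\<lambda>x. P' (f x) * g x)\<bar>"
    assume "\<not> ?thesis"
    then have "D > 0" by (simp add: D_def)
    have "G \<ge> 0" unfolding G_def using gint by (intro integral_nonneg) auto
    \<comment> \<open>This e makes the right-hand side smaller than D / 2; the added 1 covers G =
      0.\<close>
    have "D \<le> D / (2 * (G + 1)) * G"
      using bound[of "D / (2 * (G + 1))"] \<open>D > 0\<close> \<open>G \<ge> 0\<close> by (simp only: D_def G_def) simp
    moreover have "D * G + D * 2 > 0"
      using \<open>D > 0\<close> \<open>G \<ge> 0\<close> by (intro add_nonneg_pos mult_nonneg_nonneg mult_pos_pos) auto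
    ultimately show False using \<open>G \<ge> 0\<close> by (simp add: field_simps)
  qed
  then show "((\<lambda>x. P' (f x) * g x) has_integral P (f b) - P (f a)) {a..b}"
    using int by (simp add: has_integral_iff)
qed

lemma primitive_add:
  assumes "primitive f g" "primitive f' g'"
  shows "primitive (\<lambda>x. f x + f' x) (\<lambda>x. g x + g' x)"
proof (rule primitiveI)
  show "(\<lambda>x. g x + g' x) absolutely_integrable_on {a..b}" for a b
    using primitiveD(1)[OF assms(1)] primitiveD(1)[OF assms(2)] by (rule set_integral_add(1))
  fix a b :: real assume "a \<le> b"
  from has_integral_add[OF primitiveD(2)[OF assms(1) this] primitiveD(2)[OF assms(2) this]]
  show "((\<lambda>x. g x + g' x) has_integral f b + f' b - (f a + f' a)) {a..b}"
    by (simp add: algebra_simps)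
qed

lemma primitive_cmult:
  assumes "primitive f g" shows "primitive (\<lambda>x. c * f x) (\<lambda>x. c * g x)"
proof (rule primitive_chain[OF assms convex_UNIV, where P = "\<lambda>x. c * x" and P' = "\<lambda>x. c"])
  show "((\<lambda>x. c * x) has_real_derivative c) (at x)" for x
    by (auto intro!: derivative_eq_intros)
qed auto

lemma primitive_const: "primitive (\<lambda>x. c) (\<lambda>x. 0)"
  by (auto simp: primitive_def)

text \<open>Polarisation: a product is a quarter of the difference of the squares of the sum and the
  difference, and squares are covered by the chain rule.\<close>

lemma primitive_mult:
  assumes "primitive f g" "primitive f' g'"
  shows "primitive (\<lambda>x. f x * f' x) (\<lambda>x. f x * g' x + g x * f' x)"
proof -
  have sq: "primitive (\<lambda>x. (h x)\<^sup>2) (\<lambda>x. 2 * h x * k x)" if "primitive h k" for h k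
  proof (rule primitive_chain[OF that convex_UNIV, where P = "\<lambda>x. x\<^sup>2" and P' = "\<lambda>x. 2 * x"])
    show "((\<lambda>x. x\<^sup>2) has_real_derivative 2 * x) (at x)" for x :: real
      by (auto intro!: derivative_eq_intros)
  qed (auto intro: continuous_on_mult_left)
  have "primitive (\<lambda>x. 1/4 * ((f x + f' x)\<^sup>2 + (-1) * (f x + (-1) * f' x)\<^sup>2))
     (\<lambda>x. 1/4 * (2 * (f x + f' x) * (g x + g' x) + (-1) * (2 * (f x + (-1) * f' x) * (g x + (-1) * g' x))))"
    (is "primitive ?F ?G")
    using primitive_cmult[OF primitive_add[OF sq[OF primitive_add[OF assms]] primitive_cmult[OF sq[OF
        primitive_add[OF assms(1) primitive_cmult[OF assms(2), of "-1"]]], of "-1"]], of "1/4"] .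
  moreover have "?F x = f x * f' x" for x
    by (simp add: power2_eq_square algebra_simps)
  moreover have "?G x = f x * g' x + g x * f' x" for x
    by (simp add: algebra_simps)
  ultimately show ?thesis by (simp only:)
qed

lemma primitive_DERIV:
  assumes "\<And>x. (f has_real_derivative g x) (at x)" "continuous_on UNIV g"
  shows "primitive f g"
proof (rule primitiveI)
  show "g absolutely_integrable_on {a..b}" for a b
    by (rule absolutely_integrable_continuous_real[OF continuous_on_subset[OF assms(2)]]) simp
  show "(g has_integral f b - f a) {a..b}" if "a \<le> b" for a b
    using that assms(1)
    by (intro fundamental_theorem_of_calculus)
      (auto simp: has_real_derivative_iff_has_vector_derivative intro: has_vector_derivative_at_within)
qed

lemma ex_primitive:
  assumes "\<And>a b. g absolutely_integrable_on {a..b}"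
  shows "\<exists>f. primitive f g"
proof
  let ?f = "\<lambda>x. if x \<ge> 0 then integral {0..x} g else - integral {x..0} g"
  note int = absolutely_integrable_onD(1)[OF assms]
  show "primitive ?f g"
  proof (rule primitiveI)
    fix a b :: real assume ab: "a \<le> b"
    consider "0 \<le> a" | "a < 0" "b \<ge> 0" | "b < 0" by linarith
    then have "integral {a..b} g = ?f b - ?f a"
    proof cases
      case 1 then show ?thesis using ab Henstock_Kurzweil_Integration.integral_combine[OF _ _ int, of 0 a b] by auto
    next
      case 2 then show ?thesis using ab Henstock_Kurzweil_Integration.integral_combine[OF _ _ int, of a 0 b] by auto
    next
      case 3 then show ?thesis using ab Henstock_Kurzweil_Integration.integral_combine[OF _ _ int, of a b 0] by auto
    qed
    then show "(g has_integral ?f b - ?f a) {a..b}" using int by (simp add: has_integral_iff)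
  qed (rule assms)
qed

lemma ex_antiderivative:
  fixes g :: "real \<Rightarrow> real"
  assumes "continuous_on UNIV g"
  shows "\<exists>f. f 0 = 0 \<and> (\<forall>x. (f has_real_derivative g x) (at x))"
proof -
  have "\<exists>F. \<forall>x :: real. -\<infinity> < ereal x \<longrightarrow> ereal x < \<infinity> \<longrightarrow> (F has_vector_derivative g x) (at x)"
    using assms by (intro einterval_antiderivative) (auto simp: continuous_on_eq_continuous_at)
  then obtain F where F: "\<And>x. (F has_real_derivative g x) (at x)"
    by (auto simp: has_real_derivative_iff_has_vector_derivative)
  show ?thesis
    by (rule exI[of _ "\<lambda>x. F x - F 0"]) (auto intro!: derivative_eq_intros F)
qed

text \<open>Compare \<open>f x\<close> with \<open>f y\<close> for y in the unit interval to the
  right of \<open>x\<close> and average over y. This turns integrability into pointwise bounds and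
  decay.\<close>

lemma primitive_local_bound:
  assumes f: "primitive f g"
  shows "\<bar>f x\<bar> \<le> integral {x..x+1} (\<lambda>y. \<bar>f y\<bar> + \<bar>g y\<bar>)"
proof -
  note gint = absolutely_integrable_onD[OF primitiveD(1)[OF f]]
  have cf: "continuous_on A (\<lambda>y. \<bar>f y\<bar>)" for A
    by (intro continuous_intros primitive_continuous_on[OF f])
  have fint: "(\<lambda>y. \<bar>f y\<bar>) integrable_on {a..b}" for a b
    by (rule integrable_continuous_interval[OF cf])
  have "\<bar>f x\<bar> - integral {x..x+1} (\<lambda>y. \<bar>g y\<bar>) \<le> \<bar>f y\<bar>" if "y \<in> {x..x+1}" for y
  proof -
    have "\<bar>f y - f x\<bar> \<le> integral {x..y} (\<lambda>y. \<bar>g y\<bar>)"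
      using primitive_diff_bound[OF f] that by auto
    also have "\<dots> \<le> integral {x..x+1} (\<lambda>y. \<bar>g y\<bar>)"
      using that gint by (intro integral_subset_le) auto
    finally show ?thesis by linarith
  qed
  then have "integral {x..x+1} (\<lambda>y. \<bar>f x\<bar> - integral {x..x+1} (\<lambda>y. \<bar>g y\<bar>)) \<le> integral {x..x+1} (\<lambda>y. \<bar>f y\<bar>)"
    using fint by (intro integral_le) auto
  moreover have "integral {x..x+1} (\<lambda>y. \<bar>f y\<bar> + \<bar>g y\<bar>) = integral {x..x+1} (\<lambda>y. \<bar>f y\<bar>) + integral {x..x+1} (\<lambda>y. \<bar>g y\<bar>)"
    using fint gint by (intro integral_add) auto
  ultimately show ?thesis by simp
qed

section \<open>The \<open>L\<^sup>2\<close> seminorm\<close>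

definition l2 :: "(real \<Rightarrow> real) \<Rightarrow> real" where
  "l2 f = sqrt (LINT x|lebesgue. (f x)\<^sup>2)"

lemma continuous_measurable_lebesgue:
  fixes f :: "real \<Rightarrow> real"
  assumes "continuous_on UNIV f" shows "f \<in> borel_measurable lebesgue"
  using borel_measurable_continuous_onI[OF assms] by (intro measurable_completion) simp

lemma integral_interval_LINT:
  fixes f :: "real \<Rightarrow> real"
  assumes "integrable lebesgue f"
  shows "integral {a..b} f = (LINT x|lebesgue. indicator {a..b} x * f x)"
    "f absolutely_integrable_on {a..b}"
proof -
  show "f absolutely_integrable_on {a..b}"
    using integrable_mult_indicator[OF _ assms, of "{a..b}"] by (simp add: set_integrable_def)
  from set_lebesgue_integral_eq_integral(2)[OF this]
  show "integral {a..b} f = (LINT x|lebesgue. indicator {a..b} x * f x)"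
    by (simp add: set_lebesgue_integral_def)
qed

lemma l2_nonneg [simp]: "l2 f \<ge> 0"
  by (simp add: l2_def)

lemma l2_square: "(l2 f)\<^sup>2 = (LINT x|lebesgue. (f x)\<^sup>2)"
  by (simp add: l2_def)

lemma square_integrableD:
  assumes "square_integrable f"
  shows "f \<in> borel_measurable lebesgue" "integrable lebesgue (\<lambda>x. (f x)\<^sup>2)"
  using assms by (auto simp: square_integrable_def)

lemma square_integrable_mono:
  assumes "square_integrable g" "f \<in> borel_measurable lebesgue" "AE x in lebesgue. \<bar>f x\<bar> \<le> \<bar>g x\<bar>"
  shows "square_integrable f" "l2 f \<le> l2 g"
proof -
  note [measurable] = assms(2)
  have "AE x in lebesgue. (f x)\<^sup>2 \<le> (g x)\<^sup>2"
    using assms(3) by eventually_elim (metis abs_le_square_iff)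
  moreover have "integrable lebesgue (\<lambda>x. (f x)\<^sup>2)"
    by (rule Bochner_Integration.integrable_bound[OF square_integrableD(2)[OF assms(1)]])
      (use calculation in auto)
  ultimately show "square_integrable f" "l2 f \<le> l2 g"
    using assms square_integrableD(2) by (auto simp: square_integrable_def l2_def intro!: integral_mono_AE)
qed

lemma square_integrable_cong_AE:
  assumes "square_integrable g" "AE x in lebesgue. f x = g x"
  shows "square_integrable f" "l2 f = l2 g"
proof -
  have "AE x in lebesgue. g x = f x" using assms(2) by eventually_elim simp
  then have m: "f \<in> borel_measurable lebesgue"
    by (rule borel_measurable_AE[OF square_integrableD(1)[OF assms(1)]])
  show f: "square_integrable f"
    by (rule square_integrable_mono(1)[OF assms(1) m]) (use assms(2) in \<open>auto elim: eventually_mono\<close>)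
  have "AE x in lebesgue. \<bar>f x\<bar> \<le> \<bar>g x\<bar>" "AE x in lebesgue. \<bar>g x\<bar> \<le> \<bar>f x\<bar>"
    using assms(2) by (eventually_elim; simp)+
  then show "l2 f = l2 g"
    using square_integrable_mono(2)[OF assms(1) m] square_integrable_mono(2)[OF f square_integrableD(1)[OF assms(1)]]
    by (intro antisym) auto
qed

lemma square_integrable_diff:
  "square_integrable f \<Longrightarrow> square_integrable g \<Longrightarrow> square_integrable (\<lambda>x. f x - g x)"
  using square_integrable_add[OF _ square_integrable_scale[of g "-1"], of f] by simp

lemma square_integrable_bounded_mult:
  assumes "square_integrable g" "f \<in> borel_measurable lebesgue" "\<And>x. \<bar>f x\<bar> \<le> M"
  shows "square_integrable (\<lambda>x. f x * g x)" "l2 (\<lambda>x. f x * g x) \<le> M * l2 g"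
proof -
  note [measurable] = assms(2) square_integrableD(1)[OF assms(1)]
  have M: "M \<ge> 0" using assms(3)[of 0] by linarith
  have "l2 (\<lambda>x. M * g x) = M * l2 g"
    using M by (simp add: l2_def power_mult_distrib real_sqrt_mult)
  moreover have "AE x in lebesgue. \<bar>f x * g x\<bar> \<le> \<bar>M * g x\<bar>"
    using assms(3) M by (intro AE_I2) (auto simp: abs_mult intro!: mult_right_mono)
  ultimately show "square_integrable (\<lambda>x. f x * g x)" "l2 (\<lambda>x. f x * g x) \<le> M * l2 g"
    using square_integrable_mono[OF square_integrable_scale[OF assms(1), of M], of "\<lambda>x. f x * g x"]
    by simp_all
qed

lemma l2_Cauchy_Schwarz:
  assumes f: "square_integrable f" and g: "square_integrable g"
  shows "\<bar>LINT x|lebesgue. f x * g x\<bar> \<le> l2 f * l2 g"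
proof -
  define A B C where "A = (LINT x|lebesgue. (f x)\<^sup>2)" and "B = (LINT x|lebesgue. f x * g x)"
    and "C = (LINT x|lebesgue. (g x)\<^sup>2)"
  have pos: "A + 2 * t * B + t\<^sup>2 * C \<ge> 0" for t
  proof -
    have "0 \<le> (LINT x|lebesgue. (f x + t * g x)\<^sup>2)" by simp
    also have "\<dots> = (LINT x|lebesgue. (f x)\<^sup>2 + (2 * t) * (f x * g x) + t\<^sup>2 * (g x)\<^sup>2)"
      by (intro Bochner_Integration.integral_cong) (auto simp: power2_eq_square algebra_simps)
    also have "\<dots> = A + 2 * t * B + t\<^sup>2 * C"
      using square_integrableD(2)[OF f] square_integrableD(2)[OF g] square_integrable_mult[OF f g]
      by (simp add: A_def B_def C_def)
    finally show ?thesis .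
  qed
  have AC: "A \<ge> 0" "C \<ge> 0" by (auto simp: A_def C_def)
  have "B\<^sup>2 \<le> A * C"
  proof (cases "C = 0")
    case True
    have "B = 0"
    proof (rule ccontr)
      assume "B \<noteq> 0"
      \<comment> \<open>For C = 0 the quadratic is affine in t, and this t gives it the value
        -1.\<close>
      then show False using pos[of "- (A + 1) / (2 * B)"] True by (simp add: field_simps)
    qed
    then show ?thesis using True by simp
  next
    case False
    then have "C > 0" using AC by simp
    have "A + 2 * (- B / C) * B + (- B / C)\<^sup>2 * C = A - B\<^sup>2 / C"
      using False by (simp add: field_simps power2_eq_square)
    with pos[of "- B / C"] have "A - B\<^sup>2 / C \<ge> 0" by simp
    then show ?thesis using \<open>C > 0\<close> by (simp add: field_simps)
  qed
  then have "\<bar>B\<bar> \<le> sqrt (A * C)" by (rule real_le_rsqrt[of "\<bar>B\<bar>", simplified])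
  then show ?thesis by (simp add: l2_def A_def B_def C_def real_sqrt_mult)
qed

lemma l2_triangle:
  assumes f: "square_integrable f" and g: "square_integrable g"
  shows "l2 (\<lambda>x. f x + g x) \<le> l2 f + l2 g"
proof (rule power2_le_imp_le)
  have "(l2 (\<lambda>x. f x + g x))\<^sup>2 = (LINT x|lebesgue. (f x)\<^sup>2 + 2 * (f x * g x) + (g x)\<^sup>2)"
    unfolding l2_square
    by (intro Bochner_Integration.integral_cong) (auto simp: power2_eq_square algebra_simps)
  also have "\<dots> = (l2 f)\<^sup>2 + 2 * (LINT x|lebesgue. f x * g x) + (l2 g)\<^sup>2"
    using square_integrableD(2)[OF f] square_integrableD(2)[OF g] square_integrable_mult[OF f g]
    by (simp add: l2_square)
  also have "\<dots> \<le> (l2 f + l2 g)\<^sup>2"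
    using l2_Cauchy_Schwarz[OF f g] by (simp add: power2_sum)
  finally show "(l2 (\<lambda>x. f x + g x))\<^sup>2 \<le> (l2 f + l2 g)\<^sup>2" .
qed simp

lemma l2_scale: "l2 (\<lambda>x. c * f x) = \<bar>c\<bar> * l2 f"
  by (simp add: l2_def power_mult_distrib real_sqrt_mult)

section \<open>Continuous representatives of \<open>H\<^sup>1\<close> functions\<close>

text \<open>Dominated convergence: every fixed point eventually leaves the moving window.\<close>

lemma unit_interval_integral_tendsto_0:
  fixes h :: "real \<Rightarrow> real"
  assumes h: "integrable lebesgue h"
  shows "((\<lambda>t. integral {t..t+1} h) \<longlongrightarrow> 0) at_top" "((\<lambda>t. integral {t..t+1} h) \<longlongrightarrow> 0) at_bot"
proof -
  note [measurable] = borel_measurable_integrable[OF h]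
  have im[measurable]: "(indicator {a..b} :: real \<Rightarrow> real) \<in> borel_measurable lebesgue" for a b :: real
    by (intro measurable_completion) simp
  note eq = integral_interval_LINT(1)[OF h]
  have "((\<lambda>t. LINT x|lebesgue. indicator {t..t+1} x * h x) \<longlongrightarrow> (LINT x|(lebesgue :: real measure). (0::real))) at_top"
  proof (rule integral_dominated_convergence_at_top[where w = "\<lambda>x. \<bar>h x\<bar>" and f = "\<lambda>x. 0"
        and s = "\<lambda>t x. indicator {t..t+1} x * h x"])
    show "(\<lambda>x. indicator {t..t+1} x * h x) \<in> borel_measurable lebesgue" for t by measurable
    show "AE x in lebesgue. ((\<lambda>t. indicator {t..t+1} x * h x) \<longlongrightarrow> 0) at_top"
    proof (rule AE_I2)
      fix x :: real
      show "((\<lambda>t. indicator {t..t+1} x * h x) \<longlongrightarrow> 0) at_top"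
        by (rule tendsto_eventually) (auto intro!: eventually_mono[OF eventually_gt_at_top[of x]] simp: indicator_def)
    qed
  qed (use h in \<open>auto simp: indicator_def\<close>)
  then show "((\<lambda>t. integral {t..t+1} h) \<longlongrightarrow> 0) at_top"
    by (simp add: eq)
  have "((\<lambda>t. LINT x|lebesgue. indicator {-t..-t+1} x * h x) \<longlongrightarrow> (LINT x|(lebesgue :: real measure). (0::real))) at_top"
  proof (rule integral_dominated_convergence_at_top[where w = "\<lambda>x. \<bar>h x\<bar>" and f = "\<lambda>x. 0"
        and s = "\<lambda>t x. indicator {-t..-t+1} x * h x"])
    show "(\<lambda>x. indicator {-t..-t+1} x * h x) \<in> borel_measurable lebesgue" for t by measurable
    show "AE x in lebesgue. ((\<lambda>t. indicator {-t..-t+1} x * h x) \<longlongrightarrow> 0) at_top"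
    proof (rule AE_I2)
      fix x :: real
      show "((\<lambda>t. indicator {-t..-t+1} x * h x) \<longlongrightarrow> 0) at_top"
        by (rule tendsto_eventually) (auto intro!: eventually_mono[OF eventually_gt_at_top[of "1 - x"]] simp: indicator_def)
    qed
  qed (use h in \<open>auto simp: indicator_def\<close>)
  then show "((\<lambda>t. integral {t..t+1} h) \<longlongrightarrow> 0) at_bot"
    unfolding filterlim_at_bot_mirror by (simp only: eq integral_zero)
qed

text \<open>Decay of \<open>f\<close> at both ends replaces its integrability; energy conservation
  applies this to a function that is only known to be square integrable.\<close>

lemma primitive_integral_zero:
  assumes f: "primitive f g" and top: "(f \<longlongrightarrow> 0) at_top" and bot: "(f \<longlongrightarrow> 0) at_bot"
    and int: "integrable lebesgue g"
  shows "(LINT x|lebesgue. g x) = 0"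
proof -
  note [measurable] = borel_measurable_integrable[OF int]
  have im[measurable]: "(indicator {a..b} :: real \<Rightarrow> real) \<in> borel_measurable lebesgue" for a b :: real
    by (intro measurable_completion) simp
  have eq: "(LINT x|lebesgue. indicator {-t..t} x * g x) = f t - f (-t)" if "t \<ge> 0" for t
    using integral_interval_LINT(1)[OF int, of "-t" t] primitiveD(2)[OF f, of "-t" t] that
    by (simp add: has_integral_iff)
  have "((\<lambda>t. LINT x|lebesgue. indicator {-t..t} x * g x) \<longlongrightarrow> (LINT x|lebesgue. g x)) at_top"
  proof (rule integral_dominated_convergence_at_top[where w = "\<lambda>x. \<bar>g x\<bar>"])
    show "(\<lambda>x. indicator {-t..t} x * g x) \<in> borel_measurable lebesgue" for t by measurable
    show "AE x in lebesgue. ((\<lambda>t. indicator {-t..t} x * g x) \<longlongrightarrow> g x) at_top"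
    proof (rule AE_I2)
      fix x :: real
      show "((\<lambda>t. indicator {-t..t} x * g x) \<longlongrightarrow> g x) at_top"
        by (rule tendsto_eventually)
          (auto intro!: eventually_mono[OF eventually_gt_at_top[of "\<bar>x\<bar>"]] simp: indicator_def)
    qed
  qed (use int in \<open>auto simp: indicator_def\<close>)
  moreover have "\<forall>\<^sub>F t in at_top. (LINT x|lebesgue. indicator {-t..t} x * g x) = f t - f (-t)"
    using eventually_ge_at_top[of 0] by eventually_elim (rule eq)
  ultimately have "((\<lambda>t. f t - f (-t)) \<longlongrightarrow> (LINT x|lebesgue. g x)) at_top"
    using tendsto_cong by fast
  moreover have "((\<lambda>t. f t - f (-t)) \<longlongrightarrow> 0 - 0) at_top"
    by (intro tendsto_diff top) (use bot in \<open>simp add: filterlim_at_bot_mirror\<close>)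
  ultimately show "(LINT x|lebesgue. g x) = 0"
    using tendsto_unique[OF trivial_limit_at_top_linorder] by fastforce
qed

lemma primitive_decay:
  assumes f: "primitive f g" and int: "integrable lebesgue f" "integrable lebesgue g"
  shows "(f \<longlongrightarrow> 0) at_top" "(f \<longlongrightarrow> 0) at_bot" "(LINT x|lebesgue. g x) = 0"
proof -
  have i: "integrable lebesgue (\<lambda>y. \<bar>f y\<bar> + \<bar>g y\<bar>)" using int by simp
  have b: "\<forall>\<^sub>F x in F. norm (f x) \<le> integral {x..x+1} (\<lambda>y. \<bar>f y\<bar> + \<bar>g y\<bar>)" for F
    using primitive_local_bound[OF f] by simp
  show top: "(f \<longlongrightarrow> 0) at_top"
    by (rule Lim_null_comparison[OF b unit_interval_integral_tendsto_0(1)[OF i]])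
  show bot: "(f \<longlongrightarrow> 0) at_bot"
    by (rule Lim_null_comparison[OF b unit_interval_integral_tendsto_0(2)[OF i]])
  show "(LINT x|lebesgue. g x) = 0"
    by (rule primitive_integral_zero[OF f top bot int(2)])
qed

text \<open>An absolutely continuous representative of an H^1 function together with an L^2 version
  of its derivative: values of \<open>f\<close> are meaningful at every point, those of
  \<open>g\<close> almost everywhere.\<close>

definition H1_pair :: "(real \<Rightarrow> real) \<Rightarrow> (real \<Rightarrow> real) \<Rightarrow> bool" where
  "H1_pair f g \<longleftrightarrow> square_integrable f \<and> square_integrable g \<and> primitive f g"

lemma H1_pairD:
  assumes "H1_pair f g"
  shows "square_integrable f" "square_integrable g" "primitive f g"
  using assms by (auto simp: H1_pair_def)

text \<open>The embedding of H^1 into the bounded functions: \<open>primitive_local_bound\<close> is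
  applied to f^2, whose derivative 2 f g is dominated by f^2 + g^2.\<close>

lemma H1_pair_bound:
  assumes fg: "H1_pair f g"
  shows "(f x)\<^sup>2 \<le> 2 * ((l2 f)\<^sup>2 + (l2 g)\<^sup>2)"
proof -
  note d = H1_pairD[OF fg]
  have i: "integrable lebesgue (\<lambda>y. 2 * ((f y)\<^sup>2 + (g y)\<^sup>2))"
    using square_integrableD(2)[OF d(1)] square_integrableD(2)[OF d(2)] by simp
  have pr: "primitive (\<lambda>x. f x * f x) (\<lambda>x. f x * g x + g x * f x)"
    by (rule primitive_mult[OF d(3,3)])
  have ai: "(\<lambda>y. \<bar>f y * f y\<bar> + \<bar>f y * g y + g y * f y\<bar>) integrable_on {x..x+1}"
    by (rule integrable_add[OF integrable_continuous_interval absolutely_integrable_onD(2)[OF primitiveD(1)[OF pr]]])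
      (intro continuous_intros primitive_continuous_on[OF d(3)])
  have "(f x)\<^sup>2 = \<bar>f x * f x\<bar>" by (simp add: power2_eq_square)
  also have "\<dots> \<le> integral {x..x+1} (\<lambda>y. \<bar>f y * f y\<bar> + \<bar>f y * g y + g y * f y\<bar>)"
    by (rule primitive_local_bound[OF pr])
  also have "\<dots> \<le> integral {x..x+1} (\<lambda>y. 2 * ((f y)\<^sup>2 + (g y)\<^sup>2))"
  proof (rule integral_le[OF ai])
    show "(\<lambda>y. 2 * ((f y)\<^sup>2 + (g y)\<^sup>2)) integrable_on {x..x+1}"
      by (rule absolutely_integrable_onD(1)[OF integral_interval_LINT(2)[OF i]])
    fix y
    have "\<bar>f y * g y + g y * f y\<bar> \<le> (f y)\<^sup>2 + (g y)\<^sup>2"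
      using zero_le_power2[of "f y - g y"] zero_le_power2[of "f y + g y"]
      unfolding power2_diff power2_sum by (simp add: abs_le_iff algebra_simps)
    moreover have "\<bar>f y * f y\<bar> = (f y)\<^sup>2" by (simp add: power2_eq_square)
    ultimately have "\<bar>f y * f y\<bar> + \<bar>f y * g y + g y * f y\<bar> \<le> (f y)\<^sup>2 + ((f y)\<^sup>2 + (g y)\<^sup>2)"
      by (simp only: add_left_mono)
    also have "\<dots> \<le> 2 * ((f y)\<^sup>2 + (g y)\<^sup>2)" by simp
    finally show "\<bar>f y * f y\<bar> + \<bar>f y * g y + g y * f y\<bar> \<le> 2 * ((f y)\<^sup>2 + (g y)\<^sup>2)" .
  qed
  also have "\<dots> = (LINT y|lebesgue. indicator {x..x+1} y * (2 * ((f y)\<^sup>2 + (g y)\<^sup>2)))"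
    by (rule integral_interval_LINT(1)[OF i])
  also have "\<dots> \<le> (LINT y|lebesgue. 2 * ((f y)\<^sup>2 + (g y)\<^sup>2))"
    using integrable_mult_indicator[OF _ i, of "{x..x+1}"] i
    by (intro integral_mono) (auto simp: indicator_def)
  also have "\<dots> = 2 * ((l2 f)\<^sup>2 + (l2 g)\<^sup>2)"
    using square_integrableD(2)[OF d(1)] square_integrableD(2)[OF d(2)] by (simp add: l2_square)
  finally show ?thesis .
qed

lemma H1_pair_by_parts:
  assumes "H1_pair f g" "H1_pair f' g'"
  shows "(LINT x|lebesgue. f x * g' x) = - (LINT x|lebesgue. g x * f' x)"
proof -
  note d = H1_pairD[OF assms(1)] and d' = H1_pairD[OF assms(2)]
  note i = square_integrable_mult[OF d(1) d'(2)] square_integrable_mult[OF d(2) d'(1)]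
  have "(LINT x|lebesgue. f x * g' x + g x * f' x) = 0"
    using i by (intro primitive_decay(3)[OF primitive_mult[OF d(3) d'(3)]] square_integrable_mult d(1) d'(1))
     auto
  then show ?thesis using i by simp
qed

text \<open>\<open>primitive_decay\<close> asks for integrability, which \<open>f\<close> may lack
  but its square has.\<close>

lemma H1_pair_decay:
  assumes "H1_pair f g"
  shows "(f \<longlongrightarrow> 0) at_top" "(f \<longlongrightarrow> 0) at_bot"
proof -
  note d = H1_pairD[OF assms]
  note i = square_integrable_mult[OF d(1) d(1)] square_integrable_mult[OF d(1) d(2)] square_integrable_mult[OF d(2) d(1)]
  have "((\<lambda>x. f x * f x) \<longlongrightarrow> 0) at_top" "((\<lambda>x. f x * f x) \<longlongrightarrow> 0) at_bot"
    using i by (auto intro!: primitive_decay(1,2)[OF primitive_mult[OF d(3) d(3)]])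
  then have "((\<lambda>x. sqrt (f x * f x)) \<longlongrightarrow> sqrt 0) at_top" "((\<lambda>x. sqrt (f x * f x)) \<longlongrightarrow> sqrt 0) at_bot"
    using tendsto_real_sqrt by blast+
  then show "(f \<longlongrightarrow> 0) at_top" "(f \<longlongrightarrow> 0) at_bot"
    by (auto simp: tendsto_rabs_zero_iff)
qed

lemma H1_pair_test_fun:
  assumes "test_fun \<eta>" shows "H1_pair \<eta> (deriv \<eta>)"
  using assms test_fun_deriv[OF assms] unfolding H1_pair_def
  by (intro conjI square_integrable_test_fun primitive_DERIV)
    (auto simp: test_fun_def intro: smooth_DERIV smooth_continuous_on)

lemma H1_pair_weak_deriv:
  assumes "H1_pair f g" shows "has_weak_deriv f g" "in_H1 f"
proof -
  show *: "has_weak_deriv f g"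
    unfolding has_weak_deriv_def using H1_pair_by_parts[OF assms H1_pair_test_fun] by auto
  show "in_H1 f"
    using H1_pairD[OF assms] * by (intro in_H1I)
qed

lemma test_fun_outside:
  assumes "test_fun \<eta>"
  obtains N where "N > 0" "\<And>x. \<bar>x\<bar> \<ge> N \<Longrightarrow> \<eta> x = 0"
proof -
  have "bounded {x. \<eta> x \<noteq> 0}"
    by (rule bounded_subset[OF compact_imp_bounded closure_subset]) (use assms in \<open>simp add: test_fun_def\<close>)
  then obtain B where "\<And>x. \<eta> x \<noteq> 0 \<Longrightarrow> \<bar>x\<bar> \<le> B"
    unfolding bounded_iff by auto
  then have "\<eta> x = 0" if "\<bar>x\<bar> \<ge> \<bar>B\<bar> + 1" for x
    using that by force
  then show ?thesis using that[of "\<bar>B\<bar> + 1"] by auto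
qed

lemma continuous_mult_test_fun:
  assumes f: "continuous_on UNIV f" and "test_fun \<eta>"
  shows "square_integrable (\<lambda>x. f x * \<eta> x)" "integrable lebesgue (\<lambda>x. f x * \<eta> x)"
proof -
  obtain N where N: "N > 0" "\<And>x. \<bar>x\<bar> \<ge> N \<Longrightarrow> \<eta> x = 0" using test_fun_outside[OF assms(2)] by metis
  have c: "continuous_on A (\<lambda>x. f x * \<eta> x)" for A
    using assms smooth_continuous_on
    by (intro continuous_intros continuous_on_subset[OF f]) (auto simp: test_fun_def)
  have I: "integrable lebesgue h" if "continuous_on UNIV h" "\<And>x. \<bar>x\<bar> \<ge> N \<Longrightarrow> h x = 0" for h :: "real \<Rightarrow> real"
  proof -
    have "h absolutely_integrable_on {-N..N}"
      by (rule absolutely_integrable_continuous_real[OF continuous_on_subset[OF that(1)]]) simp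
    moreover have "(\<lambda>x. indicator {-N..N} x *\<^sub>R h x) = h"
      using that(2) by (force simp: indicator_def fun_eq_iff)
    ultimately show ?thesis by (simp add: set_integrable_def)
  qed
  show i: "integrable lebesgue (\<lambda>x. f x * \<eta> x)"
    by (rule I[OF c]) (simp add: N)
  have "integrable lebesgue (\<lambda>x. (f x * \<eta> x)\<^sup>2)"
    by (rule I) (auto simp: N intro!: continuous_on_power c)
  then show "square_integrable (\<lambda>x. f x * \<eta> x)"
    using borel_measurable_integrable[OF i] by (simp add: square_integrable_def)
qed

text \<open>The zero mean makes the antiderivative that vanishes to the left of the support vanish
  to its right as well.\<close>

lemma test_fun_antiderivative:
  assumes \<psi>: "test_fun \<psi>" and 0: "(LINT x|lebesgue. \<psi> x) = 0"
  obtains \<eta> where "test_fun \<eta>" "deriv \<eta> = \<psi>"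
proof -
  obtain N where N: "N > 0" "\<And>x. \<bar>x\<bar> \<ge> N \<Longrightarrow> \<psi> x = 0" using test_fun_outside[OF \<psi>] by metis
  have sm: "smooth \<psi>" using \<psi> by (simp add: test_fun_def)
  obtain A where A: "\<And>x. (A has_real_derivative \<psi> x) (at x)"
    using ex_antiderivative[OF smooth_continuous_on[OF sm]] by blast
  have pA: "primitive A \<psi>"
    by (rule primitive_DERIV[OF A smooth_continuous_on[OF sm]])
  define \<eta> where "\<eta> = (\<lambda>x. A x - A (- N))"
  have D: "(\<eta> has_real_derivative \<psi> x) (at x)" for x
    unfolding \<eta>_def by (auto intro!: derivative_eq_intros A)
  then have d: "deriv \<eta> = \<psi>" by (intro ext DERIV_imp_deriv)
  have s: "smooth \<eta>"
  proof (unfold smooth_def, intro allI)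
    fix k x show "(deriv ^^ k) \<eta> field_differentiable at x"
    proof (cases k)
      case 0 then show ?thesis using D by (auto simp: field_differentiable_def)
    next
      case (Suc j)
      then have "(deriv ^^ k) \<eta> = (deriv ^^ j) \<psi>" by (simp add: funpow_Suc_right d del: funpow.simps)
      then show ?thesis using sm by (simp add: smooth_def)
    qed
  qed
  have "integral {-N..N} \<psi> = (LINT x|lebesgue. \<psi> x)"
  proof -
    have i: "integrable lebesgue \<psi>"
      using continuous_mult_test_fun(2)[OF continuous_on_const[of _ 1] \<psi>] by simp
    have "(\<lambda>x. indicator {-N..N} x *\<^sub>R \<psi> x) = \<psi>"
      using N(2) by (force simp: indicator_def fun_eq_iff)
    then show ?thesis
      using integral_interval_LINT(1)[OF i, of "-N" N] by simp
  qed
  then have AN: "A N = A (-N)"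
    using primitiveD(2)[OF pA, of "-N" N] N 0 by (simp add: has_integral_iff)
  have flat: "A b = A a" if "a \<le> b" "\<And>x. x \<in> {a..b} \<Longrightarrow> \<bar>x\<bar> \<ge> N" for a b
  proof -
    have "integral {a..b} \<psi> = 0"
      using N(2) that(2) by (intro integral_eq_0_iff[THEN iffD2] integral_unique[OF has_integral_is_0]) auto
    then show ?thesis using primitiveD(2)[OF pA that(1)] by (simp add: has_integral_iff)
  qed
  have "\<eta> x = 0" if "\<bar>x\<bar> > N" for x
  proof (cases "x > 0")
    case True then show ?thesis using flat[of N x] that N(1) AN by (auto simp: \<eta>_def)
  next
    case False then show ?thesis using flat[of x "-N"] that N(1) by (auto simp: \<eta>_def)
  qed
  then have "{x. \<eta> x \<noteq> 0} \<subseteq> {-N..N}" by force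
  then have "bounded {x. \<eta> x \<noteq> 0}"
    using bounded_closed_interval bounded_subset by blast
  then have "test_fun \<eta>" using s by (simp add: test_fun_def)
  then show ?thesis using d that by blast
qed

text \<open>The lemma of du Bois-Reymond is applied to the difference of \<open>f\<close> and a primitive of its weak derivative.\<close>

lemma in_H1_pair:
  assumes f: "in_H1 f"
  obtains c where "H1_pair c (weak_deriv f)" "AE x in lebesgue. f x = c x"
proof -
  define g where "g = weak_deriv f"
  note sf = in_H1_square_integrable[OF f]
  have sg: "square_integrable g" and wd: "has_weak_deriv f g"
    using in_H1_weak_deriv[OF f] by (auto simp: g_def)
  have "g absolutely_integrable_on {a..b}" for a b
  proof -
    have "square_integrable (indicator {a..b})"
    proof -
      have "integrable lborel (indicator {a..b} :: real \<Rightarrow> real)"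
        by (intro integrable_real_indicator emeasure_bounded_finite) auto
      then have "integrable lebesgue (indicator {a..b} :: real \<Rightarrow> real)"
        by (simp add: integrable_completion)
      moreover have "(\<lambda>x. (indicator {a..b} x :: real)\<^sup>2) = indicator {a..b}"
        by (auto simp: indicator_def)
      ultimately show ?thesis by (simp add: square_integrable_def borel_measurable_integrable)
    qed
    from square_integrable_mult[OF this sg] show ?thesis
      by (simp add: set_integrable_def)
  qed
  then obtain F where F: "primitive F g" using ex_primitive by blast
  note cF = primitive_continuous_on[OF F]
  define h where "h = (\<lambda>x. f x - F x)"
  have hi: "integrable lebesgue (\<lambda>x. h x * \<psi> x)" if "test_fun \<psi>" for \<psi>
    using square_integrable_mult[OF sf square_integrable_test_fun[OF that]] continuous_mult_test_fun(2)[OF cF that]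
    by (simp add: h_def left_diff_distrib)
  have h0: "(LINT x|lebesgue. h x * deriv \<eta> x) = 0" if "test_fun \<eta>" for \<eta>
  proof -
    note t = that test_fun_deriv[OF that]
    note i = square_integrable_mult[OF sf square_integrable_test_fun[OF t(2)]] continuous_mult_test_fun(2)[OF cF t(2)]
      square_integrable_mult[OF sg square_integrable_test_fun[OF t(1)]]
    have "(LINT x|lebesgue. F x * deriv \<eta> x + g x * \<eta> x) = 0"
      using i continuous_mult_test_fun(2)[OF cF t(1)]
      by (intro primitive_decay(3)[OF primitive_mult[OF F H1_pairD(3)[OF H1_pair_test_fun[OF that]]]]) auto
    moreover have "(LINT x|lebesgue. f x * deriv \<eta> x) = - (LINT x|lebesgue. g x * \<eta> x)"
      using wd that by (simp add: has_weak_deriv_def)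
    ultimately show ?thesis
      using i by (simp add: h_def left_diff_distrib)
  qed
  define \<rho> where "\<rho> = interval_bump (-1) 1 0"
  have \<rho>: "test_fun \<rho>" unfolding \<rho>_def by (rule test_fun_interval_bump)
  have ti: "integrable lebesgue \<psi>" if "test_fun \<psi>" for \<psi>
    using continuous_mult_test_fun(2)[OF continuous_on_const[of _ 1] that] by simp
  have \<rho>pos: "(LINT x|lebesgue. \<rho> x) \<noteq> 0"
  proof
    assume "(LINT x|lebesgue. \<rho> x) = 0"
    then have "AE x in lebesgue. \<rho> x = 0"
      by (subst (asm) integral_nonneg_eq_0_iff_AE[OF ti[OF \<rho>]]) (auto simp: \<rho>_def interval_bump_altdef)
    then have "AE x in lebesgue. x \<notin> {-1<..<1::real}"
      by eventually_elim (auto simp: \<rho>_def interval_bump_altdef)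
    then have "{-1<..<1::real} \<in> null_sets lebesgue"
      by (subst (asm) AE_iff_null_sets[symmetric]) auto
    then have "negligible {-1<..<1::real}" by (simp add: negligible_iff_null_sets)
    then show False using open_not_negligible[of "{-1<..<1::real}"] by auto
  qed
  \<comment> \<open>With this constant \<open>h - \<kappa>\<close> annihilates
    \<open>\<rho>\<close>. Every test function becomes a derivative of a test function after adding
    a multiple of \<open>\<rho>\<close>, and \<open>h\<close> annihilates such derivatives.\<close>
  define \<kappa> where "\<kappa> = (LINT x|lebesgue. h x * \<rho> x) / (LINT x|lebesgue. \<rho> x)"
  have H: "(LINT x|lebesgue. (h x - \<kappa>) * \<psi> x) = 0" if \<psi>: "test_fun \<psi>" for \<psi>
  proof -
    define c where "c = - (LINT x|lebesgue. \<psi> x) / (LINT x|lebesgue. \<rho> x)"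
    have "test_fun (\<lambda>x. \<psi> x + c * \<rho> x)"
    proof -
      have "smooth (\<lambda>x. \<psi> x + c * \<rho> x)"
      proof (rule smooth_coinduct[where S = smooth_products])
        have "smooth (\<lambda>x. c)" for c :: real
          by (rule smooth_coinduct[where S = "range (\<lambda>c x. c)"]) auto
        then have "(\<lambda>x. 1 * \<psi> x + c * \<rho> x) \<in> smooth_products"
          using \<psi> \<rho> by (intro smooth_products.intros) (auto simp: test_fun_def)
        then show "(\<lambda>x. \<psi> x + c * \<rho> x) \<in> smooth_products" by simp
      qed (use smooth_products_deriv in auto)
      moreover have "bounded {x. \<psi> x + c * \<rho> x \<noteq> 0}"
      proof (rule bounded_subset)
        show "bounded ({x. \<psi> x \<noteq> 0} \<union> {x. \<rho> x \<noteq> 0})"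
          using \<psi> \<rho> closure_subset unfolding bounded_Un test_fun_def
          by (meson bounded_subset compact_imp_bounded)
      qed auto
      ultimately show ?thesis by (simp add: test_fun_def)
    qed
    moreover have "(LINT x|lebesgue. \<psi> x + c * \<rho> x) = 0"
      using ti[OF \<psi>] ti[OF \<rho>] \<rho>pos by (simp add: c_def)
    ultimately obtain \<eta> where "test_fun \<eta>" "deriv \<eta> = (\<lambda>x. \<psi> x + c * \<rho> x)"
      by (rule test_fun_antiderivative)
    then have "(LINT x|lebesgue. h x * (\<psi> x + c * \<rho> x)) = 0"
      using h0[of \<eta>] by simp
    moreover have "(LINT x|lebesgue. h x * (\<psi> x + c * \<rho> x)) = (LINT x|lebesgue. h x * \<psi> x + c * (h x * \<rho> x))"
      by (intro Bochner_Integration.integral_cong) (auto simp: algebra_simps)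
    ultimately have "(LINT x|lebesgue. h x * \<psi> x) + c * (LINT x|lebesgue. h x * \<rho> x) = 0"
      using hi[OF \<psi>] hi[OF \<rho>] by simp
    then show ?thesis
      using hi[OF \<psi>] ti[OF \<psi>] \<rho>pos by (simp add: left_diff_distrib c_def \<kappa>_def)
  qed
  \<comment> \<open>\<open>h\<close> need not be square integrable on the whole line, since the
    primitive \<open>F\<close> is only continuous; a bump that is positive on (-N, N) localises
    it.\<close>
  have "AE x in lebesgue. (h x - \<kappa>) * interval_bump (- real N) (real N) 0 x = 0" for N
  proof (rule AE_zero_of_test_fun)
    let ?b = "interval_bump (- real N) (real N) 0"
    note tb = test_fun_interval_bump[of "- real N" "real N" 0]
    have mb: "?b \<in> borel_measurable lebesgue"
      using square_integrableD(1)[OF square_integrable_test_fun[OF tb]] .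
    have "\<bar>?b x\<bar> \<le> 1" for x
      by (rule order_trans[OF interval_bump_bounded indicator_le_1])
    then have "square_integrable (\<lambda>x. ?b x * f x)"
      by (rule square_integrable_bounded_mult(1)[OF sf mb])
    moreover have "square_integrable (\<lambda>x. (F x + \<kappa>) * ?b x)"
      by (intro continuous_mult_test_fun(1) tb continuous_intros cF)
    ultimately have "square_integrable (\<lambda>x. ?b x * f x - (F x + \<kappa>) * ?b x)"
      by (rule square_integrable_diff)
    then show "square_integrable (\<lambda>x. (h x - \<kappa>) * ?b x)"
      by (simp add: h_def algebra_simps)
    fix \<eta> assume \<eta>: "test_fun \<eta>"
    have "test_fun (\<lambda>x. ?b x * \<eta> x)"
    proof -
      have "smooth (\<lambda>x. ?b x * \<eta> x)"
        using tb \<eta> by (intro smooth_mult) (auto simp: test_fun_def)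
      moreover have "bounded {x. ?b x * \<eta> x \<noteq> 0}"
      proof (rule bounded_subset)
        show "bounded {x. \<eta> x \<noteq> 0}"
          using \<eta> closure_subset unfolding test_fun_def by (meson bounded_subset compact_imp_bounded)
      qed auto
      ultimately show ?thesis by (simp add: test_fun_def)
    qed
    from H[OF this] show "(LINT x|lebesgue. (h x - \<kappa>) * ?b x * \<eta> x) = 0"
      by (simp add: mult.assoc)
  qed
  then have "AE x in lebesgue. \<forall>N. (h x - \<kappa>) * interval_bump (- real N) (real N) 0 x = 0"
    unfolding AE_all_countable by blast
  then have fF: "AE x in lebesgue. f x = F x + \<kappa>"
  proof eventually_elim
    case (elim x)
    obtain N where N: "\<bar>x\<bar> < real N" using reals_Archimedean2 by blast
    then have "interval_bump (- real N) (real N) 0 x \<noteq> 0" by (auto simp: interval_bump_altdef)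
    then show ?case using elim[rule_format, of N] by (auto simp: h_def)
  qed
  have "AE x in lebesgue. F x + \<kappa> = f x" using fF by eventually_elim simp
  from square_integrable_cong_AE(1)[OF sf this] have "square_integrable (\<lambda>x. F x + \<kappa>)" .
  moreover have "primitive (\<lambda>x. F x + \<kappa>) g"
    using primitive_add[OF F primitive_const[of \<kappa>]] by simp
  ultimately have "H1_pair (\<lambda>x. F x + \<kappa>) g" using sg by (simp add: H1_pair_def)
  then show ?thesis using that[of "\<lambda>x. F x + \<kappa>"] fF by (simp add: g_def)
qed

section \<open>Completeness of \<open>H\<^sup>1\<close>\<close>

lemma term_le_suminf:
  fixes f :: "nat \<Rightarrow> ennreal"
  shows "f k \<le> suminf f"
  using sum_le_suminf[of f "{k}"] by simp

text \<open>The subsequence \<open>f (r k)\<close> converges fast enough that the weighted squares \<open>2\<^sup>k (f (r (k+1)) - f (r k))\<^sup>2\<close> are summable a.e.\<close>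

lemma L2_complete:
  assumes f: "\<And>k. square_integrable (f k)"
    and Cauchy: "\<And>e. e > 0 \<Longrightarrow> \<exists>N. \<forall>i\<ge>N. \<forall>j\<ge>N. l2 (\<lambda>x. f i x - f j x) < e"
  obtains g where "square_integrable g" "(\<lambda>k. l2 (\<lambda>x. f k x - g x)) \<longlonglongrightarrow> 0"
proof -
  note [measurable] = square_integrableD(1)[OF f]
  have "\<forall>k. \<exists>N. \<forall>i\<ge>N. \<forall>j\<ge>N. l2 (\<lambda>x. f i x - f j x) < (1/2)^k"
    using Cauchy by simp
  then obtain N where N: "\<And>k i j. i \<ge> N k \<Longrightarrow> j \<ge> N k \<Longrightarrow> l2 (\<lambda>x. f i x - f j x) < (1/2)^k"
    by metis
  \<comment> \<open>Summing makes \<open>r i\<close> exceed \<open>N k\<close> for all i >= k,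
    without assuming that \<open>N\<close> is monotone.\<close>
  define r where "r k = (\<Sum>i\<le>k. N i)" for k
  have r: "r i \<ge> N k" if "i \<ge> k" for i k
    unfolding r_def using that by (intro member_le_sum) auto
  define d where "d k x = f (r (Suc k)) x - f (r k) x" for k x
  have dm[measurable]: "d k \<in> borel_measurable lebesgue" for k
    unfolding d_def by measurable
  have di: "square_integrable (d k)" for k
    unfolding d_def by (intro square_integrable_diff f)
  have "(\<integral>\<^sup>+x. (\<Sum>k. ennreal (2^k * (d k x)\<^sup>2)) \<partial>lebesgue) = (\<Sum>k. \<integral>\<^sup>+x. ennreal (2^k * (d k x)\<^sup>2) \<partial>lebesgue)"
    by (intro nn_integral_suminf) measurable
  also have "\<dots> \<le> (\<Sum>k. ennreal ((1/2)^k))"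
  proof (intro suminf_le)
    fix k
    have "(\<integral>\<^sup>+x. ennreal (2^k * (d k x)\<^sup>2) \<partial>lebesgue) = ennreal (2^k * (l2 (d k))\<^sup>2)"
      using square_integrableD(2)[OF di[of k]] by (subst nn_integral_eq_integral) (auto simp: l2_square)
    also have "\<dots> \<le> ennreal (2^k * ((1/2)^k)\<^sup>2)"
      using N[OF r r, of k "Suc k" k]
      by (intro ennreal_leI mult_left_mono power_mono) (auto simp: d_def[abs_def])
    also have "(2::real)^k * ((1/2)^k)\<^sup>2 = (1/2)^k"
      by (simp add: power2_eq_square power_divide)
    finally show "(\<integral>\<^sup>+x. ennreal (2^k * (d k x)\<^sup>2) \<partial>lebesgue) \<le> ennreal ((1/2)^k)" .
  qed auto
  also have "\<dots> = ennreal (\<Sum>k. (1/2)^k)"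
    by (intro suminf_ennreal_eq summable_sums summable_geometric) auto
  finally have "(\<integral>\<^sup>+x. (\<Sum>k. ennreal (2^k * (d k x)\<^sup>2)) \<partial>lebesgue) \<noteq> \<infinity>"
    by (auto simp: top_unique)
  moreover have "(\<lambda>x. \<Sum>k. ennreal (2^k * (d k x)\<^sup>2)) \<in> borel_measurable lebesgue"
    by measurable
  ultimately have "AE x in lebesgue. (\<Sum>k. ennreal (2^k * (d k x)\<^sup>2)) \<noteq> \<infinity>"
    by (intro nn_integral_PInf_AE)
  then have conv: "AE x in lebesgue. convergent (\<lambda>k. f (r k) x)"
  proof eventually_elim
    case (elim x)
    define C where "C = enn2real (\<Sum>k. ennreal (2^k * (d k x)\<^sup>2))"
    have C: "(\<Sum>k. ennreal (2^k * (d k x)\<^sup>2)) = ennreal C" "C \<ge> 0"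
      using elim unfolding C_def by (simp_all only: ennreal_enn2real less_top infinity_ennreal_def enn2real_nonneg)
    \<comment> \<open>Finiteness of the weighted sum bounds the increments by a geometric sequence,
      so the telescoping series converges absolutely.\<close>
    have b: "\<bar>d k x\<bar> \<le> sqrt C * (1 / sqrt 2)^k" for k
    proof -
      have "ennreal (2^k * (d k x)\<^sup>2) \<le> (\<Sum>k. ennreal (2^k * (d k x)\<^sup>2))"
        by (rule term_le_suminf)
      then have "2^k * (d k x)\<^sup>2 \<le> C"
        unfolding C(1) using C(2) by (simp only: ennreal_le_iff)
      then have "(d k x)\<^sup>2 \<le> C / 2^k" by (simp add: field_simps)
      then have "sqrt ((d k x)\<^sup>2) \<le> sqrt (C / 2^k)" by (rule real_sqrt_le_mono)
      then show ?thesis by (simp add: real_sqrt_divide real_sqrt_power[of 2 k] power_divide)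
    qed
    have "summable (\<lambda>k. sqrt C * (1 / sqrt 2)^k)"
      by (intro summable_mult summable_geometric) auto
    then have "summable (\<lambda>k. d k x)"
      by (rule summable_comparison_test'[where N = 0]) (simp only: real_norm_def b)
    then have "convergent (\<lambda>k. \<Sum>i<k. d i x)"
      by (simp add: summable_iff_convergent)
    moreover have "(\<Sum>i<k. d i x) = f (r k) x - f (r 0) x" for k
      unfolding d_def by (rule sum_lessThan_telescope)
    ultimately show ?case
      using convergent_add_const_iff[of "f (r 0) x" "\<lambda>k. f (r k) x - f (r 0) x"] by simp
  qed
  define g where "g x = lim (\<lambda>k. f (r k) x)" for x
  have gm[measurable]: "g \<in> borel_measurable lebesgue"
    unfolding g_def by measurable
  have g: "AE x in lebesgue. (\<lambda>k. f (r k) x) \<longlonglongrightarrow> g x"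
    using conv by eventually_elim (simp add: g_def convergent_LIMSEQ_iff)
  \<comment> \<open>Fatou's lemma along \<open>r\<close> carries the Cauchy estimate to the limit
    for every large \<open>j\<close>, not only along the subsequence.\<close>
  have bound: "integrable lebesgue (\<lambda>x. (f j x - g x)\<^sup>2) \<and> (LINT x|lebesgue. (f j x - g x)\<^sup>2) \<le> ((1/2)^k)\<^sup>2"
    if j: "j \<ge> N k" for j k
  proof -
    have "(\<integral>\<^sup>+x. ennreal ((f j x - g x)\<^sup>2) \<partial>lebesgue)
        = (\<integral>\<^sup>+x. liminf (\<lambda>i. ennreal ((f j x - f (r i) x)\<^sup>2)) \<partial>lebesgue)"
    proof (intro nn_integral_cong_AE)
      show "AE x in lebesgue. ennreal ((f j x - g x)\<^sup>2) = liminf (\<lambda>i. ennreal ((f j x - f (r i) x)\<^sup>2))"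
        using g
      proof eventually_elim
        case (elim x)
        then have "(\<lambda>i. ennreal ((f j x - f (r i) x)\<^sup>2)) \<longlonglongrightarrow> ennreal ((f j x - g x)\<^sup>2)"
          by (intro tendsto_ennrealI tendsto_intros)
        then show ?case by (rule lim_imp_Liminf[OF sequentially_bot, symmetric])
      qed
    qed
    also have "\<dots> \<le> liminf (\<lambda>i. \<integral>\<^sup>+x. ennreal ((f j x - f (r i) x)\<^sup>2) \<partial>lebesgue)"
      by (intro nn_integral_liminf) measurable
    also have "\<dots> \<le> liminf (\<lambda>i::nat. ennreal (((1/2)^k)\<^sup>2))"
    proof (intro Liminf_mono eventually_sequentiallyI[of k])
      fix i assume "k \<le> i"
      have "(\<integral>\<^sup>+x. ennreal ((f j x - f (r i) x)\<^sup>2) \<partial>lebesgue) = ennreal ((l2 (\<lambda>x. f j x - f (r i) x))\<^sup>2)"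
        using square_integrableD(2)[OF square_integrable_diff[OF f f]]
        by (subst nn_integral_eq_integral) (auto simp: l2_square)
      also have "\<dots> \<le> ennreal (((1/2)^k)\<^sup>2)"
        using N[OF j r[OF \<open>k \<le> i\<close>]] by (intro ennreal_leI power_mono) auto
      finally show "(\<integral>\<^sup>+x. ennreal ((f j x - f (r i) x)\<^sup>2) \<partial>lebesgue) \<le> ennreal (((1/2)^k)\<^sup>2)" .
    qed
    also have "\<dots> = ennreal (((1/2)^k)\<^sup>2)" by (simp add: Liminf_const)
    finally have le: "(\<integral>\<^sup>+x. ennreal ((f j x - g x)\<^sup>2) \<partial>lebesgue) \<le> ennreal (((1/2)^k)\<^sup>2)" .
    then have i: "integrable lebesgue (\<lambda>x. (f j x - g x)\<^sup>2)"
      by (intro integrableI_nonneg) (auto intro: le_less_trans)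
    then have "ennreal (LINT x|lebesgue. (f j x - g x)\<^sup>2) \<le> ennreal (((1/2)^k)\<^sup>2)"
      using le by (subst (asm) nn_integral_eq_integral) auto
    then show ?thesis using i by (simp add: ennreal_le_iff)
  qed
  have "square_integrable (\<lambda>x. f (N 0) x - g x)"
    using bound[of 0 "N 0"] by (simp add: square_integrable_def)
  from square_integrable_diff[OF f[of "N 0"] this] have g': "square_integrable g" by simp
  moreover have "(\<lambda>k. l2 (\<lambda>x. f k x - g x)) \<longlonglongrightarrow> 0"
  proof (rule LIMSEQ_I)
    fix e :: real assume "e > 0"
    then obtain k where k: "(1/2)^k < e"
      using real_arch_pow_inv[of e "1/2"] by auto
    have "l2 (\<lambda>x. f j x - g x) \<le> (1/2)^k" if "j \<ge> N k" for j
      using conjunct2[OF bound[OF that], folded l2_square] by (rule power2_le_imp_le) simp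
    then show "\<exists>no. \<forall>n\<ge>no. norm (l2 (\<lambda>x. f n x - g x) - 0) < e"
      using k by (intro exI[of _ "N k"]) (auto intro: le_less_trans)
  qed
  ultimately show ?thesis by (rule that)
qed

text \<open>A version of the derivative obtained from an arbitrary representative, so identities
  between such derivatives hold only almost everywhere.\<close>

definition wder :: "H1 \<Rightarrow> real \<Rightarrow> real" where
  "wder w = weak_deriv (rep_H1 w)"

text \<open>The choice is in fact unique, because continuous functions that agree almost everywhere
  are equal; elements of \<open>H1\<close> thereby acquire pointwise values.\<close>

definition crep :: "H1 \<Rightarrow> real \<Rightarrow> real" where
  "crep w = (SOME c. H1_pair c (wder w) \<and> (AE x in lebesgue. rep_H1 w x = c x))"

lemma in_H1_rep: "in_H1 (rep_H1 w)"
  using Quotient_rep_reflp[OF Quotient_H1, of w] by (simp add: H1_rel_def)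

lemma crep_pair: "H1_pair (crep w) (wder w)" "AE x in lebesgue. rep_H1 w x = crep w x"
proof -
  have "\<exists>c. H1_pair c (wder w) \<and> (AE x in lebesgue. rep_H1 w x = c x)"
    using in_H1_pair[OF in_H1_rep[of w]] unfolding wder_def by metis
  from someI_ex[OF this]
  show "H1_pair (crep w) (wder w)" "AE x in lebesgue. rep_H1 w x = crep w x"
    by (auto simp: crep_def)
qed

lemmas crep_square_integrable = H1_pairD(1)[OF crep_pair(1)]
  and wder_square_integrable = H1_pairD(2)[OF crep_pair(1)]
  and crep_primitive = H1_pairD(3)[OF crep_pair(1)]

lemma crep_in_H1: "in_H1 (crep w)"
  by (rule H1_pair_weak_deriv(2)[OF crep_pair(1)])

lemma crep_continuous_on: "continuous_on A (crep w)"
  by (rule primitive_continuous_on[OF crep_primitive])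

lemma crep_measurable: "crep w \<in> borel_measurable lebesgue" "wder w \<in> borel_measurable lebesgue"
  by (rule square_integrableD(1)[OF crep_square_integrable] square_integrableD(1)[OF wder_square_integrable])+

lemma abs_H1_eq_iff:
  assumes "in_H1 f" "in_H1 g"
  shows "abs_H1 f = abs_H1 g \<longleftrightarrow> (AE x in lebesgue. f x = g x)"
  using assms Quotient_rel[OF Quotient_H1, of f g] by (auto simp: H1_rel_def)

lemma rep_abs_AE:
  assumes "in_H1 f" shows "AE x in lebesgue. rep_H1 (abs_H1 f) x = f x"
  using rep_abs_rsp[OF Quotient3_H1, of f f] Quotient_rep_abs[OF Quotient_H1, of f] assms
  by (auto simp: H1_rel_def)

lemma abs_crep: "abs_H1 (crep w) = w"
proof -
  have "AE x in lebesgue. crep w x = rep_H1 w x"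
    using crep_pair(2)[of w] by eventually_elim simp
  then have "abs_H1 (crep w) = abs_H1 (rep_H1 w)"
    by (subst abs_H1_eq_iff[OF crep_in_H1 in_H1_rep])
  then show ?thesis by (simp add: Quotient_abs_rep[OF Quotient_H1])
qed

lemma crep_abs_AE:
  assumes "in_H1 f" shows "AE x in lebesgue. crep (abs_H1 f) x = f x"
  using rep_abs_AE[OF assms] crep_pair(2)[of "abs_H1 f"] by eventually_elim simp

lemma wder_abs_AE:
  assumes "in_H1 f" shows "AE x in lebesgue. wder (abs_H1 f) x = weak_deriv f x"
  unfolding wder_def by (rule weak_deriv_cong_AE[OF in_H1_rep assms rep_abs_AE[OF assms]])

lemma continuous_AE_eq:
  fixes f g :: "real \<Rightarrow> real"
  assumes "continuous_on UNIV f" "continuous_on UNIV g" "AE x in lebesgue. f x = g x"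
  shows "f = g"
proof -
  have "open {x. f x \<noteq> g x}"
    using assms(1,2) by (rule open_Collect_neq)
  moreover have "negligible {x. f x \<noteq> g x}"
    using assms(3) by (simp add: negligible_iff_null_sets AE_iff_null_sets
        \<open>open {x. f x \<noteq> g x}\<close> borel_open)
  ultimately show ?thesis
    using open_not_negligible by blast
qed

lemma continuous_AE_all:
  fixes f :: "real \<Rightarrow> real"
  assumes "continuous_on UNIV f" "closed S" "AE x in lebesgue. f x \<in> S"
  shows "f x \<in> S"
proof -
  have "open {x. f x \<notin> S}"
    using open_vimage[OF open_Compl[OF assms(2)] assms(1)] by (simp add: vimage_def)
  moreover have "negligible {x. f x \<notin> S}"
    using assms(3) by (simp add: negligible_iff_null_sets AE_iff_null_sets calculation borel_open)
  ultimately show ?thesis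
    using open_not_negligible by blast
qed

lemma crep_abs:
  assumes "H1_pair f g"
  shows "crep (abs_H1 f) = f" "AE x in lebesgue. wder (abs_H1 f) x = g x"
proof -
  note wd = H1_pair_weak_deriv[OF assms]
  show "crep (abs_H1 f) = f"
    by (rule continuous_AE_eq[OF crep_continuous_on primitive_continuous_on[OF H1_pairD(3)[OF assms]]
          crep_abs_AE[OF wd(2)]])
  have "AE x in lebesgue. weak_deriv f x = g x"
    by (rule weak_deriv_eqI[OF wd(2) H1_pairD(2)[OF assms] wd(1)])
  then show "AE x in lebesgue. wder (abs_H1 f) x = g x"
    using wder_abs_AE[OF wd(2)] by eventually_elim simp
qed

lemma crep_eqI: "(\<And>x. crep u x = crep v x) \<Longrightarrow> u = v"
  by (metis abs_crep ext)

lemma H1_rel_crep: "H1_rel (crep u) (crep u)"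
  by (simp add: H1_rel_def crep_in_H1)

lemma crep_add_wder_add:
  "crep (u + v) x = crep u x + crep v x" "AE x in lebesgue. wder (u + v) x = wder u x + wder v x"
proof -
  have p: "H1_pair (\<lambda>x. crep u x + crep v x) (\<lambda>x. wder u x + wder v x)"
    using crep_pair(1)[of u] crep_pair(1)[of v] unfolding H1_pair_def
    by (auto intro: square_integrable_add primitive_add)
  have "abs_H1 (\<lambda>x. crep u x + crep v x) = u + v"
    using plus_H1.abs_eq[OF H1_rel_crep[of u] H1_rel_crep[of v]] by (simp add: abs_crep)
  then show "crep (u + v) x = crep u x + crep v x" "AE x in lebesgue. wder (u + v) x = wder u x + wder v x"
    using crep_abs[OF p] by simp_all
qed

lemma crep_scaleR_wder_scaleR:
  "crep (c *\<^sub>R u) x = c * crep u x" "AE x in lebesgue. wder (c *\<^sub>R u) x = c * wder u x"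
proof -
  have p: "H1_pair (\<lambda>x. c * crep u x) (\<lambda>x. c * wder u x)"
    using crep_pair(1)[of u] unfolding H1_pair_def
    by (auto intro: square_integrable_scale primitive_cmult)
  have "abs_H1 (\<lambda>x. c * crep u x) = c *\<^sub>R u"
    using scaleR_H1.abs_eq[OF H1_rel_crep[of u]] by (simp add: abs_crep)
  then show "crep (c *\<^sub>R u) x = c * crep u x" "AE x in lebesgue. wder (c *\<^sub>R u) x = c * wder u x"
    using crep_abs[OF p] by simp_all
qed

lemmas crep_add = crep_add_wder_add(1) and wder_add = crep_add_wder_add(2)
  and crep_scaleR = crep_scaleR_wder_scaleR(1) and wder_scaleR = crep_scaleR_wder_scaleR(2)

lemma crep_diff: "crep (u - v) x = crep u x - crep v x"
  using crep_add[of u "(-1) *\<^sub>R v" x] crep_scaleR[of "-1" v x] by simp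

lemma wder_diff: "AE x in lebesgue. wder (u - v) x = wder u x - wder v x"
  using wder_add[of u "(-1) *\<^sub>R v"] wder_scaleR[of "-1" v] by eventually_elim simp

lemma inner_H1_crep:
  "inner u v = (LINT x|lebesgue. crep u x * crep v x) + (LINT x|lebesgue. wder u x * wder v x)"
proof -
  have wd: "AE x in lebesgue. weak_deriv (crep u) x = wder u x" for u
    by (rule weak_deriv_eqI[OF crep_in_H1 wder_square_integrable H1_pair_weak_deriv(1)[OF crep_pair(1)]])
  have [measurable]: "weak_deriv (crep u) \<in> borel_measurable lebesgue" "wder u \<in> borel_measurable lebesgue" for u
    using in_H1_weak_deriv(1)[OF crep_in_H1] wder_square_integrable by (auto simp: square_integrable_def)
  have "(LINT x|lebesgue. weak_deriv (crep u) x * weak_deriv (crep v) x) = (LINT x|lebesgue. wder u x * wder v x)"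
    by (rule integral_cong_AE) (use wd[of u] wd[of v] in auto)
  then show ?thesis
    using inner_H1.abs_eq[OF H1_rel_crep[of u] H1_rel_crep[of v]] by (simp add: abs_crep)
qed

lemma norm_H1_l2: "(norm u)\<^sup>2 = (l2 (crep u))\<^sup>2 + (l2 (wder u))\<^sup>2"
  unfolding power2_norm_eq_inner inner_H1_crep l2_square by (simp add: power2_eq_square)

lemma l2_crep_le: "l2 (crep u) \<le> norm u" and l2_wder_le: "l2 (wder u) \<le> norm u"
  by (rule power2_le_imp_le; simp add: norm_H1_l2)+

lemma norm_H1_le: "norm u \<le> l2 (crep u) + l2 (wder u)"
  by (rule power2_le_imp_le) (auto simp: norm_H1_l2 power2_sum)

text \<open>The constant sqrt 2 that \<open>H1_pair_bound\<close> gives is rounded up to 2.\<close>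

lemma crep_bound: "\<bar>crep u x\<bar> \<le> 2 * norm u"
proof (rule power2_le_imp_le)
  have "(crep u x)\<^sup>2 \<le> 2 * (norm u)\<^sup>2"
    using H1_pair_bound[OF crep_pair(1)] by (simp add: norm_H1_l2)
  also have "\<dots> \<le> (2 * norm u)\<^sup>2" by (simp add: power_mult_distrib)
  finally show "\<bar>crep u x\<bar>\<^sup>2 \<le> (2 * norm u)\<^sup>2" by simp
qed simp

text \<open>Continuity of evaluation lets it pass through integrals of curves in \<open>H1\<close>,
  which reduces equations there to scalar ones at each point.\<close>

lemma bounded_linear_crep: "bounded_linear (\<lambda>u. crep u x)"
  by (rule bounded_linear_intro[where K = 2])
    (use crep_bound[of _ x] in \<open>auto simp: crep_add crep_scaleR mult.commute\<close>)

lemma l2_crep_diff: "l2 (\<lambda>x. crep u x - crep v x) = l2 (crep (u - v))"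
  by (rule arg_cong[where f = l2]) (simp add: fun_eq_iff crep_diff)

lemma l2_wder_diff: "l2 (\<lambda>x. wder u x - wder v x) = l2 (wder (u - v))"
proof -
  have "AE x in lebesgue. wder u x - wder v x = wder (u - v) x"
    using wder_diff[of u v] by eventually_elim simp
  then show ?thesis by (rule square_integrable_cong_AE(2)[OF wder_square_integrable])
qed

text \<open>A limit in \<open>L\<^sup>2\<close> of weak derivatives is the weak derivative of the limit.\<close>

instance H1 :: banach
proof
  fix X :: "nat \<Rightarrow> H1" assume X: "Cauchy X"
  have C: "\<exists>N. \<forall>i\<ge>N. \<forall>j\<ge>N. l2 (\<lambda>x. crep (X i) x - crep (X j) x) < e"
    "\<exists>N. \<forall>i\<ge>N. \<forall>j\<ge>N. l2 (\<lambda>x. wder (X i) x - wder (X j) x) < e" if e: "e > 0" for e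
  proof -
    obtain N where "\<And>i j. i \<ge> N \<Longrightarrow> j \<ge> N \<Longrightarrow> norm (X i - X j) < e"
      using CauchyD[OF X e] by blast
    then show "\<exists>N. \<forall>i\<ge>N. \<forall>j\<ge>N. l2 (\<lambda>x. crep (X i) x - crep (X j) x) < e"
      "\<exists>N. \<forall>i\<ge>N. \<forall>j\<ge>N. l2 (\<lambda>x. wder (X i) x - wder (X j) x) < e"
      unfolding l2_crep_diff l2_wder_diff using l2_crep_le l2_wder_le le_less_trans by blast+
  qed
  obtain f where f: "square_integrable f" "(\<lambda>k. l2 (\<lambda>x. crep (X k) x - f x)) \<longlonglongrightarrow> 0"
    by (rule L2_complete[OF crep_square_integrable C(1)]) blast
  obtain g where g: "square_integrable g" "(\<lambda>k. l2 (\<lambda>x. wder (X k) x - g x)) \<longlonglongrightarrow> 0"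
    by (rule L2_complete[OF wder_square_integrable C(2)]) blast
  have lim: "(\<lambda>k. LINT x|lebesgue. F k x * \<eta> x) \<longlonglongrightarrow> (LINT x|lebesgue. h x * \<eta> x)"
    if F: "\<And>k. square_integrable (F k)" and h: "square_integrable h"
      and l: "(\<lambda>k. l2 (\<lambda>x. F k x - h x)) \<longlonglongrightarrow> 0" and \<eta>: "square_integrable \<eta>" for F h \<eta>
  proof (rule LIM_zero_cancel, rule Lim_null_comparison)
    have "\<bar>(LINT x|lebesgue. F k x * \<eta> x) - (LINT x|lebesgue. h x * \<eta> x)\<bar> \<le> l2 (\<lambda>x. F k x - h x) * l2 \<eta>" for k
      using l2_Cauchy_Schwarz[OF square_integrable_diff[OF F[of k] h] \<eta>]
        square_integrable_mult[OF F[of k] \<eta>] square_integrable_mult[OF h \<eta>]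
      by (simp add: left_diff_distrib)
    then show "\<forall>\<^sub>F k in sequentially. norm ((LINT x|lebesgue. F k x * \<eta> x) - (LINT x|lebesgue. h x * \<eta> x))
        \<le> l2 (\<lambda>x. F k x - h x) * l2 \<eta>" by simp
    show "(\<lambda>k. l2 (\<lambda>x. F k x - h x) * l2 \<eta>) \<longlonglongrightarrow> 0"
      using tendsto_mult_right[OF l, of "l2 \<eta>"] by simp
  qed
  have wd: "has_weak_deriv f g"
    unfolding has_weak_deriv_def
  proof (intro allI impI)
    fix \<eta> assume \<eta>: "test_fun \<eta>"
    note s = square_integrable_test_fun[OF \<eta>] square_integrable_test_fun[OF test_fun_deriv[OF \<eta>]]
    have "(LINT x|lebesgue. crep (X k) x * deriv \<eta> x) = - (LINT x|lebesgue. wder (X k) x * \<eta> x)" for k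
      using H1_pair_weak_deriv(1)[OF crep_pair(1)] \<eta> by (auto simp: has_weak_deriv_def)
    then have "(\<lambda>k. LINT x|lebesgue. crep (X k) x * deriv \<eta> x) \<longlonglongrightarrow> - (LINT x|lebesgue. g x * \<eta> x)"
      using tendsto_minus[OF lim[OF wder_square_integrable g s(1)]] by simp
    then show "(LINT x|lebesgue. f x * deriv \<eta> x) = - (LINT x|lebesgue. g x * \<eta> x)"
      using lim[OF crep_square_integrable f s(2)] LIMSEQ_unique by blast
  qed
  have fH: "in_H1 f" by (rule in_H1I[OF f(1) g(1) wd])
  have bd: "norm (X k - abs_H1 f) \<le> l2 (\<lambda>x. crep (X k) x - f x) + l2 (\<lambda>x. wder (X k) x - g x)" for k
  proof -
    have "AE x in lebesgue. weak_deriv f x = g x"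
      by (rule weak_deriv_eqI[OF fH g(1) wd])
    then have "AE x in lebesgue. wder (X k - abs_H1 f) x = wder (X k) x - g x"
      using wder_abs_AE[OF fH] wder_diff[of "X k" "abs_H1 f"] by eventually_elim simp
    then have "l2 (wder (X k - abs_H1 f)) = l2 (\<lambda>x. wder (X k) x - g x)"
      by (rule square_integrable_cong_AE(2)[OF square_integrable_diff[OF wder_square_integrable g(1)]])
    moreover have "AE x in lebesgue. crep (X k - abs_H1 f) x = crep (X k) x - f x"
      using crep_abs_AE[OF fH] by eventually_elim (simp add: crep_diff)
    then have "l2 (crep (X k - abs_H1 f)) = l2 (\<lambda>x. crep (X k) x - f x)"
      by (rule square_integrable_cong_AE(2)[OF square_integrable_diff[OF crep_square_integrable f(1)]])
    ultimately show ?thesis using norm_H1_le[of "X k - abs_H1 f"] by simp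
  qed
  have "(\<lambda>k. X k - abs_H1 f) \<longlonglongrightarrow> 0"
  proof (rule Lim_null_comparison)
    show "(\<lambda>k. l2 (\<lambda>x. crep (X k) x - f x) + l2 (\<lambda>x. wder (X k) x - g x)) \<longlonglongrightarrow> 0"
      using tendsto_add[OF f(2) g(2)] by (simp only: add_0)
  qed (simp only: bd eventually_True)
  then have "X \<longlonglongrightarrow> abs_H1 f" by (rule LIM_zero_cancel)
  then show "convergent X" by (rule convergentI)
qed

section \<open>The Lax-Milgram theorem and ordinary differential equations in Banach spaces\<close>

text \<open>The solution minimises \<open>J u = B u u - 2 l u\<close>; minimising sequences are Cauchy by the parallelogram law.\<close>

lemma symmetric_Lax_Milgram:
  fixes B :: "'a::banach \<Rightarrow> 'a \<Rightarrow> real"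
  assumes B: "bounded_bilinear B" and sym: "\<And>u v. B u v = B v u"
    and c: "c > 0" "\<And>u. c * (norm u)\<^sup>2 \<le> B u u" and l: "bounded_linear l"
  shows "\<exists>u. \<forall>v. B u v = l v"
proof -
  interpret B: bounded_bilinear B by fact
  interpret l: bounded_linear l by fact
  define J where "J u = B u u - 2 * l u" for u
  obtain K where K: "K > 0" "\<And>u. norm (l u) \<le> norm u * K" using l.pos_bounded by blast
  have "J u \<ge> - K\<^sup>2 / c" for u
  proof -
    have "0 \<le> (c * norm u - K)\<^sup>2 / c" using c(1) by simp
    also have "\<dots> = c * (norm u)\<^sup>2 - 2 * (norm u * K) + K\<^sup>2 / c"
      using c(1) by (simp add: power2_diff field_simps power2_eq_square)
    finally show ?thesis using c(2)[of u] K(2)[of u] by (simp add: J_def)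
  qed
  then have bb: "bdd_below (range J)" by (auto simp: bdd_below_def)
  define m where "m = Inf (range J)"
  have mle: "m \<le> J u" for u unfolding m_def by (rule cInf_lower[OF _ bb]) simp
  have "\<exists>u. J u < m + inverse (real (Suc k))" for k
    using cInf_lessD[of "range J" "m + inverse (real (Suc k))"] unfolding m_def by auto
  then obtain u where u: "\<And>k. J (u k) < m + inverse (real (Suc k))" by metis
  \<comment> \<open>Parallelogram law for \<open>J\<close>: the linear terms cancel. The midpoint
    has \<open>J\<close>-value at least \<open>m\<close>, so two almost minimal points are
    close.\<close>
  have par: "B (x - y) (x - y) = 2 * J x + 2 * J y - 4 * J ((1/2) *\<^sub>R (x + y))" for x y
    by (simp add: J_def B.diff_left B.diff_right B.add_left B.add_right B.scaleR_left B.scaleR_right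
        l.add l.scaleR sym[of y x] algebra_simps)
  have close: "c * (norm (u i - u j))\<^sup>2 \<le> 2 * inverse (real (Suc i)) + 2 * inverse (real (Suc j))" for i j
    using c(2)[of "u i - u j"] par[of "u i" "u j"] mle[of "(1/2) *\<^sub>R (u i + u j)"] u[of i] u[of j] by linarith
  have "Cauchy u"
  proof (rule CauchyI)
    fix e :: real assume e: "e > 0"
    obtain N where N: "inverse (real (Suc N)) < c * e\<^sup>2 / 4"
      using reals_Archimedean[of "c * e\<^sup>2 / 4"] e c(1) by auto
    have "norm (u i - u j) < e" if "i \<ge> N" "j \<ge> N" for i j
    proof -
      have "inverse (real (Suc i)) \<le> inverse (real (Suc N))" "inverse (real (Suc j)) \<le> inverse (real (Suc N))"
        using that by (auto intro!: le_imp_inverse_le)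
      then have "c * (norm (u i - u j))\<^sup>2 < c * e\<^sup>2" using close[of i j] N by linarith
      then have "(norm (u i - u j))\<^sup>2 < e\<^sup>2" using c(1) by simp
      then show ?thesis using e by (simp add: power2_less_imp_less)
    qed
    then show "\<exists>M. \<forall>i\<ge>M. \<forall>j\<ge>M. norm (u i - u j) < e" by blast
  qed
  then obtain w where w: "u \<longlonglongrightarrow> w" using Cauchy_convergent_iff convergent_def by blast
  have "(\<lambda>k. J (u k)) \<longlonglongrightarrow> J w"
    unfolding J_def by (intro tendsto_intros B.tendsto l.tendsto w)
  moreover have "(\<lambda>k. m + inverse (real (Suc k))) \<longlonglongrightarrow> m + 0"
    by (intro tendsto_intros LIMSEQ_inverse_real_of_nat)
  ultimately have "J w \<le> m + 0"
    by (rule LIMSEQ_le) (use u in \<open>auto intro: less_imp_le\<close>)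
  then have min: "J w \<le> J v" for v using mle[of v] by linarith
  have "B w v = l v" for v
  proof -
    define d b where "d = B w v - l v" and "b = B v v"
    have b: "b \<ge> 0" using c(2)[of v] c(1) unfolding b_def by (smt (verit) mult_nonneg_nonneg zero_le_power2)
    have J: "J (w + t *\<^sub>R v) = J w + 2 * t * d + t\<^sup>2 * b" for t
      by (simp add: J_def d_def b_def B.add_left B.add_right B.scaleR_left B.scaleR_right
          l.add l.scaleR sym[of v w] algebra_simps power2_eq_square)
    \<comment> \<open>Moving by -s along \<open>v\<close> changes \<open>J\<close> by - s^2 (b + 2);
      the added 1 keeps the denominator positive when b = 0.\<close>
    define s where "s = d / (b + 1)"
    have ds: "d = s * (b + 1)" using b by (simp add: s_def)
    have "0 \<le> 2 * (- s) * d + (- s)\<^sup>2 * b"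
      using min[of "w + (- s) *\<^sub>R v"] J[of "- s"] by linarith
    also have "\<dots> = - (s\<^sup>2 * (b + 2))"
      unfolding ds by (simp add: algebra_simps power2_eq_square)
    finally have "s\<^sup>2 * (b + 2) \<le> 0" by simp
    then have "s = 0" using b by (simp add: mult_le_0_iff)
    then have "d = 0" using ds by simp
    then show ?thesis by (simp add: d_def)
  qed
  then show ?thesis by blast
qed

lemma at_within_atLeast:
  fixes t :: real
  assumes "t < b" shows "at t within {a..} = at t within {a..b}"
  by (rule at_within_nhd[of _ "{..<b}"]) (use assms in auto)

lemma integral_has_vector_derivative_atLeast:
  fixes f :: "real \<Rightarrow> 'a::banach"
  assumes "continuous_on {a..} f" "t \<ge> a"
  shows "((\<lambda>u. integral {a..u} f) has_vector_derivative f t) (at t within {a..})"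
proof -
  have "((\<lambda>u. integral {a..u} f) has_vector_derivative f t) (at t within {a..t+1})"
    using assms by (intro integral_has_vector_derivative continuous_on_subset[OF assms(1)]) auto
  then show ?thesis by (simp add: at_within_atLeast[of t "t+1"])
qed

lemma norm_integral_exp_bound:
  fixes g :: "real \<Rightarrow> 'a::banach"
  assumes g: "continuous_on {0..t} g" and t: "t \<ge> 0" and k: "k > 0" and M: "M \<ge> 0"
    and bound: "\<And>s. 0 \<le> s \<Longrightarrow> s \<le> t \<Longrightarrow> norm (g s) \<le> M * exp (k * s)"
  shows "norm (integral {0..t} g) \<le> M * exp (k * t) / k"
proof -
  have i: "((\<lambda>s. M * exp (k * s)) has_integral (M * exp (k * t) / k - M * exp (k * 0) / k)) {0..t}"
    using k t by (intro fundamental_theorem_of_calculus)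
     (auto intro!: derivative_eq_intros simp: has_real_derivative_iff_has_vector_derivative[symmetric])
  have "norm (integral {0..t} g) \<le> integral {0..t} (\<lambda>s. M * exp (k * s))"
    using bound
    by (intro integral_norm_bound_integral[OF integrable_continuous_interval[OF g] has_integral_integrable[OF i]]) auto
  also have "\<dots> = M * exp (k * t) / k - M * exp (k * 0) / k"
    using i by (rule integral_unique)
  also have "\<dots> \<le> M * exp (k * t) / k" using M k by simp
  finally show ?thesis .
qed

text \<open>The weight \<open>exp (- 2 L t)\<close> turns the Picard operator into a contraction on the whole half-line.\<close>

lemma global_Picard:
  fixes F :: "'a::banach \<Rightarrow> 'a"
  assumes L: "L > 0" and F: "\<And>x y. norm (F x - F y) \<le> L * norm (x - y)"
  shows "\<exists>x. x 0 = x0 \<and> (\<forall>t\<ge>0. (x has_vector_derivative F (x t)) (at t within {0..}))"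
proof -
  define k where "k = 2 * L"
  have k: "k > 0" using L by (simp add: k_def)
  have cF: "continuous_on A F" for A
    by (rule lipschitz_on_continuous_on[of L]) (use F L in \<open>auto intro!: lipschitz_onI simp: dist_norm\<close>)
  \<comment> \<open>\<open>v\<close> stands for the solution divided by exp (k t), so it can be
    sought among bounded continuous functions.\<close>
  define G where "G v s = F (exp (k * s) *\<^sub>R apply_bcontfun v s)" for v :: "real \<Rightarrow>\<^sub>C 'a" and s
  have cv: "continuous_on A (apply_bcontfun v)" for A and v :: "real \<Rightarrow>\<^sub>C 'a"
    by (rule continuous_on_subset[of UNIV]) (auto intro: continuous_on_apply_bcontfun)
  have cG: "continuous_on A (G v)" for A v
    unfolding G_def by (intro continuous_on_compose2[OF cF[of UNIV]] continuous_intros cv) auto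
  have Gdiff: "norm (G v s - G w s) \<le> (L * norm (v - w)) * exp (k * s)" for v w s
  proof -
    have "norm (G v s - G w s) \<le> L * norm (exp (k * s) *\<^sub>R (apply_bcontfun v s - apply_bcontfun w s))"
      unfolding G_def scaleR_diff_right by (rule F)
    also have "\<dots> \<le> L * (exp (k * s) * norm (v - w))"
      using L norm_bounded[of "v - w" s]
      by (intro mult_left_mono) (auto simp: minus_bcontfun.rep_eq intro!: mult_left_mono)
    finally show ?thesis by (simp add: mult_ac)
  qed
  have Gbound: "norm (G v s) \<le> (norm (F 0) + L * norm v) * exp (k * s)" if "s \<ge> 0" for v s
  proof -
    have "G 0 s = F 0" by (simp add: G_def zero_bcontfun.rep_eq)
    then have "norm (G v s) \<le> norm (F 0) + (L * norm v) * exp (k * s)"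
      using Gdiff[of v s 0] norm_triangle_ineq2[of "G v s" "F 0"] by simp
    moreover have "norm (F 0) * 1 \<le> norm (F 0) * exp (k * s)"
      using k that by (intro mult_left_mono) auto
    ultimately show ?thesis by (simp add: distrib_right)
  qed
  \<comment> \<open>Bounded continuous functions live on the whole line here, so the operator is
    extended to negative times by its value at 0.\<close>
  define \<Phi> where "\<Phi> v t = exp (- k * max 0 t) *\<^sub>R (x0 + integral {0..max 0 t} (G v))" for v t
  have scale: "exp (- k * max 0 t) * (M * exp (k * max 0 t) / k) = M / k" for M t
    by (simp add: exp_minus field_simps)
  have \<Phi>: "\<Phi> v \<in> bcontfun" for v
  proof (rule bcontfun_normI)
    have "continuous_on {0..} (\<lambda>t. integral {0..t} (G v))"
      using integral_has_vector_derivative_atLeast[OF cG]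
      by (intro continuous_on_vector_derivative) auto
    then have "continuous_on UNIV (\<lambda>t. integral {0..max 0 t} (G v))"
      by (rule continuous_on_compose2) (auto intro!: continuous_intros)
    then show "continuous_on UNIV (\<Phi> v)"
      unfolding \<Phi>_def by (intro continuous_intros)
    fix t
    define M where "M = norm (F 0) + L * norm v"
    have "norm (\<Phi> v t) \<le> exp (- k * max 0 t) * (norm x0 + norm (integral {0..max 0 t} (G v)))"
      by (simp add: \<Phi>_def norm_triangle_ineq)
    also have "\<dots> \<le> exp (- k * max 0 t) * (norm x0 + M * exp (k * max 0 t) / k)"
      using Gbound[of _ v] L unfolding M_def
      by (intro mult_left_mono add_left_mono norm_integral_exp_bound cG k) auto
    also have "\<dots> = exp (- k * max 0 t) * norm x0 + M / k"
      unfolding distrib_left scale ..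
    also have "\<dots> \<le> 1 * norm x0 + M / k"
      using k by (intro add_right_mono mult_right_mono) auto
    finally show "norm (\<Phi> v t) \<le> norm x0 + (norm (F 0) + L * norm v) / k" by (simp add: M_def)
  qed
  have rep: "apply_bcontfun (Bcontfun (\<Phi> v)) = \<Phi> v" for v
    by (rule Bcontfun_inverse[OF \<Phi>])
  have "\<exists>!v. Bcontfun (\<Phi> v) = v"
  proof (rule banach_fix_type[of "1/2"], safe)
    fix v w :: "real \<Rightarrow>\<^sub>C 'a"
    have "dist (Bcontfun (\<Phi> v)) (Bcontfun (\<Phi> w)) \<le> 1/2 * norm (v - w)"
    proof (rule dist_bound)
      fix t
      have int: "G v integrable_on {0..max 0 t}" for v
        by (rule integrable_continuous_interval[OF cG])
      have "\<Phi> v t - \<Phi> w t = exp (- k * max 0 t) *\<^sub>R integral {0..max 0 t} (\<lambda>s. G v s - G w s)"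
        by (simp add: \<Phi>_def integral_diff[OF int int] scaleR_diff_right scaleR_add_right)
      then have "norm (\<Phi> v t - \<Phi> w t) = exp (- k * max 0 t) * norm (integral {0..max 0 t} (\<lambda>s. G v s - G w s))"
        by simp
      also have "\<dots> \<le> exp (- k * max 0 t) * (L * norm (v - w) * exp (k * max 0 t) / k)"
        using L by (intro mult_left_mono norm_integral_exp_bound continuous_intros cG k Gdiff) auto
      also have "\<dots> = 1/2 * norm (v - w)"
        unfolding scale using L by (simp add: k_def)
      finally show "dist (apply_bcontfun (Bcontfun (\<Phi> v)) t) (apply_bcontfun (Bcontfun (\<Phi> w)) t) \<le> 1/2 * norm (v - w)"
        by (simp add: rep dist_norm)
    qed
    then show "dist (Bcontfun (\<Phi> v)) (Bcontfun (\<Phi> w)) \<le> 1/2 * dist v w"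
      by (simp add: dist_norm)
  qed auto
  then obtain v where v: "Bcontfun (\<Phi> v) = v" by blast
  define x where "x t = x0 + integral {0..t} (G v)" for t
  have x: "exp (k * t) *\<^sub>R apply_bcontfun v t = x t" if "t \<ge> 0" for t
  proof -
    have "apply_bcontfun v t = \<Phi> v t" using rep[of v] v by simp
    then show ?thesis using that by (simp add: \<Phi>_def x_def max_def exp_minus)
  qed
  have "(x has_vector_derivative F (x t)) (at t within {0..})" if "t \<ge> 0" for t
  proof -
    have "(x has_vector_derivative 0 + G v t) (at t within {0..})"
      unfolding x_def[abs_def]
      by (intro has_vector_derivative_add has_vector_derivative_const integral_has_vector_derivative_atLeast cG that)
    then show ?thesis using x[OF that] by (simp add: G_def)
  qed
  moreover have "x 0 = x0" by (simp add: x_def)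
  ultimately show ?thesis by blast
qed

text \<open>The squared norm of \<open>D\<close>, weighted by exp (- 2 C t), has nonpositive
  derivative by Cauchy-Schwarz, and it starts at 0.\<close>

lemma Gronwall_zero:
  fixes D :: "real \<Rightarrow> 'a::real_inner"
  assumes D: "\<And>t. a \<le> t \<Longrightarrow> t \<le> b \<Longrightarrow> (D has_vector_derivative D' t) (at t within {a..b})"
    and bound: "\<And>t. a \<le> t \<Longrightarrow> t \<le> b \<Longrightarrow> norm (D' t) \<le> C * norm (D t)"
    and "D a = 0" "a \<le> b"
  shows "D b = 0"
proof (cases "a = b")
  case False
  then have ab: "a < b" using assms by simp
  define f where "f t = exp (- 2 * C * t) * (D t \<bullet> D t)" for t
  define f' where "f' t = exp (- 2 * C * t) * (2 * (D t \<bullet> D' t) - 2 * C * (D t \<bullet> D t))" for t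
  have f: "(f has_real_derivative f' t) (at t within {a..b})" if "a \<le> t" "t \<le> b" for t
  proof -
    have "((\<lambda>t. D t \<bullet> D t) has_vector_derivative D t \<bullet> D' t + D' t \<bullet> D t) (at t within {a..b})"
      by (rule bounded_bilinear.has_vector_derivative[OF bounded_bilinear_inner D[OF that] D[OF that]])
    then have "((\<lambda>t. D t \<bullet> D t) has_real_derivative D t \<bullet> D' t + D' t \<bullet> D t) (at t within {a..b})"
      by (simp add: has_real_derivative_iff_has_vector_derivative)
    moreover have "((\<lambda>t. exp (- 2 * C * t)) has_real_derivative exp (- 2 * C * t) * (- 2 * C)) (at t within {a..b})"
      by (auto intro!: derivative_eq_intros)
    ultimately show ?thesis
      using DERIV_mult' by (fastforce simp: f_def[abs_def] f'_def inner_commute algebra_simps)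
  qed
  obtain t where t: "a < t" "t < b" "f b - f a = f' t * (b - a)"
    using mvt_simple[of a b f "\<lambda>t. (*) (f' t)"] ab f by (auto simp: has_field_derivative_def)
  have "D t \<bullet> D' t \<le> norm (D t) * norm (D' t)" by (rule norm_cauchy_schwarz)
  also have "\<dots> \<le> norm (D t) * (C * norm (D t))"
    using bound[of t] t by (intro mult_left_mono) auto
  also have "\<dots> = C * (D t \<bullet> D t)" by (simp add: power2_norm_eq_inner[symmetric] power2_eq_square)
  finally have "f' t \<le> 0" by (simp add: f'_def mult_le_0_iff)
  then have "f b \<le> f a" using t ab by (smt (verit) mult_nonpos_nonneg)
  then have "f b \<le> 0" using \<open>D a = 0\<close> by (simp add: f_def)
  then have "D b \<bullet> D b \<le> 0" by (simp add: f_def mult_le_0_iff)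
  then show ?thesis by (metis inner_eq_zero_iff inner_ge_zero order_antisym)
qed (use assms in simp)

section \<open>The flow with bounded coefficients\<close>

text \<open>Square integrability of the composition comes from
  \<open>\<bar>P (f x)\<bar> \<le> M * \<bar>f x\<bar>\<close>, for which \<open>P 0 = 0\<close> and
  the bound on the derivative between 0 and \<open>f x\<close> are used.\<close>

lemma H1_pair_chain:
  assumes fg: "H1_pair f g" and I: "convex I" "\<And>x. f x \<in> I" "0 \<in> I"
    and P: "\<And>x. x \<in> I \<Longrightarrow> (P has_real_derivative P' x) (at x within I)" "P 0 = 0"
    and P': "continuous_on I P'" "\<And>x. x \<in> I \<Longrightarrow> \<bar>P' x\<bar> \<le> M"
  shows "H1_pair (\<lambda>x. P (f x)) (\<lambda>x. P' (f x) * g x)"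
proof -
  note d = H1_pairD[OF fg]
  have pr: "primitive (\<lambda>x. P (f x)) (\<lambda>x. P' (f x) * g x)"
    by (rule primitive_chain[OF d(3) I(1,2) P(1) P'(1)])
  have m: "(\<lambda>x. P (f x)) \<in> borel_measurable lebesgue"
    by (rule continuous_measurable_lebesgue[OF primitive_continuous_on[OF pr]])
  have "continuous_on UNIV (\<lambda>x. P' (f x))"
    by (rule continuous_on_compose2[OF P'(1) primitive_continuous_on[OF d(3)]]) (use I in auto)
  then have m': "(\<lambda>x. P' (f x)) \<in> borel_measurable lebesgue"
    by (rule continuous_measurable_lebesgue)
  have "\<bar>P (f x)\<bar> \<le> \<bar>M * f x\<bar>" for x
  proof -
    have "norm (P (f x) - P 0) \<le> M * norm (f x - 0)"
      by (rule field_differentiable_bound[OF I(1) P(1)]) (use I P' in auto)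
    then show ?thesis using P(2) P'(2)[OF I(3)] by (simp add: abs_mult)
  qed
  then have "square_integrable (\<lambda>x. P (f x))"
    by (intro square_integrable_mono(1)[OF square_integrable_scale[OF d(1), of M] m] AE_I2)
  moreover have "square_integrable (\<lambda>x. P' (f x) * g x)"
    by (rule square_integrable_bounded_mult(1)[OF d(2) m', of M]) (use I P' in auto)
  ultimately show ?thesis using pr by (simp add: H1_pair_def)
qed

lemma bounded_linear_LINT_wder:
  assumes f: "square_integrable f"
  shows "bounded_linear (\<lambda>v. LINT x|lebesgue. f x * wder v x)"
proof (rule bounded_linear_intro[where K = "l2 f"])
  note [measurable] = square_integrableD(1)[OF f] crep_measurable
  note i = square_integrable_mult[OF f wder_square_integrable]
  show "(LINT x|lebesgue. f x * wder (u + v) x) = (LINT x|lebesgue. f x * wder u x) + (LINT x|lebesgue. f x * wder v x)" for u v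
  proof -
    have "(LINT x|lebesgue. f x * wder (u + v) x) = (LINT x|lebesgue. f x * wder u x + f x * wder v x)"
    proof (rule integral_cong_AE)
      show "AE x in lebesgue. f x * wder (u + v) x = f x * wder u x + f x * wder v x"
        using wder_add[of u v] by eventually_elim (simp add: distrib_left)
    qed measurable
    then show ?thesis using i by simp
  qed
  show "(LINT x|lebesgue. f x * wder (c *\<^sub>R u) x) = c *\<^sub>R (LINT x|lebesgue. f x * wder u x)" for c u
  proof -
    have "(LINT x|lebesgue. f x * wder (c *\<^sub>R u) x) = (LINT x|lebesgue. c * (f x * wder u x))"
    proof (rule integral_cong_AE)
      show "AE x in lebesgue. f x * wder (c *\<^sub>R u) x = c * (f x * wder u x)"
        using wder_scaleR[of c u] by eventually_elim simp
    qed measurable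
    then show ?thesis by simp
  qed
  show "norm (LINT x|lebesgue. f x * wder u x) \<le> norm u * l2 f" for u
  proof -
    have "\<bar>LINT x|lebesgue. f x * wder u x\<bar> \<le> l2 f * norm u"
      by (rule order_trans[OF l2_Cauchy_Schwarz[OF f wder_square_integrable] mult_left_mono[OF l2_wder_le l2_nonneg]])
    then show ?thesis by (simp only: real_norm_def mult.commute)
  qed
qed

lemma bounded_linear_LINT_crep:
  assumes f: "square_integrable f"
  shows "bounded_linear (\<lambda>v. LINT x|lebesgue. f x * crep v x)"
proof (rule bounded_linear_intro[where K = "l2 f"])
  note i = square_integrable_mult[OF f crep_square_integrable]
  show "(LINT x|lebesgue. f x * crep (u + v) x) = (LINT x|lebesgue. f x * crep u x) + (LINT x|lebesgue. f x * crep v x)" for u v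
    using i by (simp add: crep_add distrib_left)
  show "(LINT x|lebesgue. f x * crep (c *\<^sub>R u) x) = c *\<^sub>R (LINT x|lebesgue. f x * crep u x)" for c u
    by (simp add: crep_scaleR mult.left_commute)
  show "norm (LINT x|lebesgue. f x * crep u x) \<le> norm u * l2 f" for u
  proof -
    have "\<bar>LINT x|lebesgue. f x * crep u x\<bar> \<le> l2 f * norm u"
      by (rule order_trans[OF l2_Cauchy_Schwarz[OF f crep_square_integrable] mult_left_mono[OF l2_crep_le l2_nonneg]])
    then show ?thesis by (simp only: real_norm_def mult.commute)
  qed
qed

lemma bounded_bilinear_weighted:
  assumes f: "f \<in> borel_measurable lebesgue" "\<And>x. \<bar>f x\<bar> \<le> M"
    and g: "g \<in> borel_measurable lebesgue" "\<And>x. \<bar>g x\<bar> \<le> M"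
  shows "bounded_bilinear (\<lambda>u v. (LINT x|lebesgue. f x * wder u x * wder v x)
           + (LINT x|lebesgue. g x * crep u x * crep v x))" (is "bounded_bilinear ?B")
proof -
  note sf = square_integrable_bounded_mult[OF wder_square_integrable f]
  note sg = square_integrable_bounded_mult[OF crep_square_integrable g]
  have M: "M \<ge> 0" using f(2)[of 0] by linarith
  have lin: "bounded_linear (?B u)" for u
    by (intro bounded_linear_add bounded_linear_LINT_wder bounded_linear_LINT_crep sf sg)
  have sym: "?B u v = ?B v u" for u v
    by (simp add: mult_ac)
  show ?thesis
  proof (rule bounded_bilinear.intro)
    show "?B u (v + w) = ?B u v + ?B u w" for u v w
      by (rule linear_add[OF bounded_linear.linear[OF lin]])
    then show "?B (v + w) u = ?B v u + ?B w u" for u v w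
      using sym by metis
    show "?B u (c *\<^sub>R v) = c *\<^sub>R ?B u v" for u v c
      by (rule linear_cmul[OF bounded_linear.linear[OF lin]])
    then show "?B (c *\<^sub>R v) u = c *\<^sub>R ?B v u" for u v c
      using sym by metis
    show "\<exists>K. \<forall>u v. norm (?B u v) \<le> norm u * norm v * K"
    proof (intro exI[of _ "2 * M"] allI)
      fix u v
      have "\<bar>LINT x|lebesgue. f x * wder u x * wder v x\<bar> \<le> (M * l2 (wder u)) * l2 (wder v)"
        by (rule order_trans[OF l2_Cauchy_Schwarz[OF sf(1) wder_square_integrable] mult_right_mono[OF sf(2)]]) simp
      also have "\<dots> \<le> (M * norm u) * norm v"
        using M by (intro mult_mono mult_left_mono l2_wder_le) auto
      finally have 1: "\<bar>LINT x|lebesgue. f x * wder u x * wder v x\<bar> \<le> M * norm u * norm v" .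
      have "\<bar>LINT x|lebesgue. g x * crep u x * crep v x\<bar> \<le> (M * l2 (crep u)) * l2 (crep v)"
        by (rule order_trans[OF l2_Cauchy_Schwarz[OF sg(1) crep_square_integrable] mult_right_mono[OF sg(2)]]) simp
      also have "\<dots> \<le> (M * norm u) * norm v"
        using M by (intro mult_mono mult_left_mono l2_crep_le) auto
      finally have 2: "\<bar>LINT x|lebesgue. g x * crep u x * crep v x\<bar> \<le> M * norm u * norm v" .
      have "norm (?B u v) \<le> M * norm u * norm v + M * norm u * norm v"
        unfolding real_norm_def by (rule order_trans[OF abs_triangle_ineq add_mono[OF 1 2]])
      then show "norm (?B u v) \<le> norm u * norm v * (2 * M)" by (simp add: mult_ac)
    qed
  qed
qed

definition antideriv :: "(real \<Rightarrow> real) \<Rightarrow> real \<Rightarrow> real" where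
  "antideriv g = (SOME f. f 0 = 0 \<and> (\<forall>x. (f has_real_derivative g x) (at x)))"

lemma antideriv:
  assumes "continuous_on UNIV g"
  shows "antideriv g 0 = 0" "(antideriv g has_real_derivative g x) (at x)"
  using someI_ex[OF ex_antiderivative[OF assms]] by (auto simp: antideriv_def)

text \<open>\<open>p\<close> and \<open>q\<close> play the roles of \<phi>^n and \<phi>^m as
  functions of \<gamma>. The background state \<phi> = 1 is \<gamma> = 0, hence
  \<open>p 0 = 1\<close>; this makes p(\<gamma>) - 1 square integrable.\<close>

locale bounded_coefficients =
  fixes p q :: "real \<Rightarrow> real" and \<Lambda> c M :: real
  assumes p0: "p 0 = 1" and c: "c > 0" and Lambda: "\<Lambda> > 0"
    and p_Lip: "\<And>x y. \<bar>p x - p y\<bar> \<le> \<Lambda> * \<bar>x - y\<bar>" and q_Lip: "\<And>x y. \<bar>q x - q y\<bar> \<le> \<Lambda> * \<bar>x - y\<bar>"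
    and p_bounds: "\<And>x. c \<le> p x" "\<And>x. p x \<le> M"
    and q_bounds: "\<And>x. c \<le> q x" "\<And>x. q x \<le> M"
begin

lemma M: "M > 0" using p_bounds[of 0] c by linarith

lemma p_cont: "continuous_on A p"
  by (rule lipschitz_on_continuous_on[of \<Lambda>]) (use p_Lip Lambda in \<open>auto intro!: lipschitz_onI simp: dist_real_def\<close>)

lemma q_cont: "continuous_on A q"
  by (rule lipschitz_on_continuous_on[of \<Lambda>]) (use q_Lip Lambda in \<open>auto intro!: lipschitz_onI simp: dist_real_def\<close>)

lemma coeff_measurable:
  "(\<lambda>x. p (crep \<gamma> x)) \<in> borel_measurable lebesgue" "(\<lambda>x. q (crep \<gamma> x)) \<in> borel_measurable lebesgue"
proof -
  show "(\<lambda>x. p (crep \<gamma> x)) \<in> borel_measurable lebesgue" "(\<lambda>x. q (crep \<gamma> x)) \<in> borel_measurable lebesgue"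
    by (intro continuous_measurable_lebesgue continuous_on_compose2[OF p_cont[of UNIV] crep_continuous_on]
        continuous_on_compose2[OF q_cont[of UNIV] crep_continuous_on]; simp)+
qed

lemma coeff_abs: "\<bar>p x\<bar> \<le> M" "\<bar>q x\<bar> \<le> M"
  using p_bounds[of x] q_bounds[of x] c by linarith+

section \<open>The elliptic solution operator\<close>

definition B :: "H1 \<Rightarrow> H1 \<Rightarrow> H1 \<Rightarrow> real" where
  "B \<gamma> u v = (LINT x|lebesgue. p (crep \<gamma> x) * wder u x * wder v x)
    + (LINT x|lebesgue. q (crep \<gamma> x) * crep u x * crep v x)"

text \<open>Subtracting 1 leaves the weak right-hand side unchanged, because derivatives of test
  functions have integral 0, and makes the coefficient square integrable.\<close>

definition rhs :: "H1 \<Rightarrow> H1 \<Rightarrow> real" where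
  "rhs \<gamma> v = (LINT x|lebesgue. (p (crep \<gamma> x) - 1) * wder v x)"

definition S :: "H1 \<Rightarrow> H1" where
  "S \<gamma> = (SOME u. \<forall>v. B \<gamma> u v = rhs \<gamma> v)"

lemma B_bilinear: "bounded_bilinear (B \<gamma>)"
  unfolding B_def[abs_def] by (intro bounded_bilinear_weighted[where M = M] coeff_measurable coeff_abs)

lemma B_integrable:
  "integrable lebesgue (\<lambda>x. p (crep \<gamma> x) * wder u x * wder v x)"
  "integrable lebesgue (\<lambda>x. q (crep \<gamma> x) * crep u x * crep v x)"
  by (intro square_integrable_mult square_integrable_bounded_mult(1)[OF _ coeff_measurable(1) coeff_abs(1)]
      square_integrable_bounded_mult(1)[OF _ coeff_measurable(2) coeff_abs(2)]
      wder_square_integrable crep_square_integrable)+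

lemma p_minus_1_square_integrable:
  "square_integrable (\<lambda>x. p (crep \<gamma> x) - 1)" "l2 (\<lambda>x. p (crep \<gamma> x) - 1) \<le> \<Lambda> * norm \<gamma>"
proof -
  note [measurable] = coeff_measurable
  have "AE x in lebesgue. \<bar>p (crep \<gamma> x) - 1\<bar> \<le> \<bar>\<Lambda> * crep \<gamma> x\<bar>"
    using p_Lip[of _ 0] Lambda by (auto simp: p0 abs_mult)
  moreover have "(\<lambda>x. p (crep \<gamma> x) - 1) \<in> borel_measurable lebesgue" by measurable
  ultimately have "square_integrable (\<lambda>x. p (crep \<gamma> x) - 1)" "l2 (\<lambda>x. p (crep \<gamma> x) - 1) \<le> \<Lambda> * l2 (crep \<gamma>)"
    using square_integrable_mono[OF square_integrable_scale[OF crep_square_integrable[of \<gamma>], of \<Lambda>]] Lambda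
    by (auto simp: l2_scale)
  moreover have "\<Lambda> * l2 (crep \<gamma>) \<le> \<Lambda> * norm \<gamma>"
    using l2_crep_le[of \<gamma>] Lambda by simp
  ultimately show "square_integrable (\<lambda>x. p (crep \<gamma> x) - 1)" "l2 (\<lambda>x. p (crep \<gamma> x) - 1) \<le> \<Lambda> * norm \<gamma>"
    by linarith+
qed

lemma rhs_linear: "bounded_linear (rhs \<gamma>)"
  unfolding rhs_def[abs_def] by (intro bounded_linear_LINT_wder p_minus_1_square_integrable)

lemma B_coercive: "c * (norm u)\<^sup>2 \<le> B \<gamma> u u"
proof -
  have "c * (norm u)\<^sup>2 = (LINT x|lebesgue. c * (wder u x)\<^sup>2) + (LINT x|lebesgue. c * (crep u x)\<^sup>2)"
    by (simp add: norm_H1_l2 l2_square distrib_left)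
  also have "\<dots> \<le> B \<gamma> u u"
    unfolding B_def
  proof (intro add_mono integral_mono B_integrable)
    show "integrable lebesgue (\<lambda>x. c * (wder u x)\<^sup>2)" "integrable lebesgue (\<lambda>x. c * (crep u x)\<^sup>2)"
      using square_integrableD(2)[OF wder_square_integrable] square_integrableD(2)[OF crep_square_integrable] by auto
    show "c * (wder u x)\<^sup>2 \<le> p (crep \<gamma> x) * wder u x * wder u x" for x
      using p_bounds(1) by (simp add: power2_eq_square mult.assoc mult_right_mono)
    show "c * (crep u x)\<^sup>2 \<le> q (crep \<gamma> x) * crep u x * crep u x" for x
      using q_bounds(1) by (simp add: power2_eq_square mult.assoc mult_right_mono)
  qed
  finally show ?thesis .
qed

lemma S_weak: "B \<gamma> (S \<gamma>) v = rhs \<gamma> v"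
proof -
  have "\<exists>u. \<forall>v. B \<gamma> u v = rhs \<gamma> v"
    by (rule symmetric_Lax_Milgram[OF B_bilinear _ c B_coercive rhs_linear]) (simp add: B_def mult_ac)
  from someI_ex[OF this] show ?thesis by (simp add: S_def)
qed

lemma S_unique:
  assumes "\<And>v. B \<gamma> u v = rhs \<gamma> v" shows "u = S \<gamma>"
proof -
  interpret B: bounded_bilinear "B \<gamma>" by (rule B_bilinear)
  have "B \<gamma> (u - S \<gamma>) (u - S \<gamma>) = 0"
    using assms S_weak by (simp add: B.diff_left)
  then have "norm (u - S \<gamma>) = 0" using B_coercive[of "u - S \<gamma>" \<gamma>] c
    by (simp add: mult_le_0_iff)
  then show ?thesis by simp
qed

text \<open>Test the equation with \<open>S \<gamma>\<close> itself, use coercivity and divide by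
  the norm.\<close>

lemma S_bound: "norm (S \<gamma>) \<le> \<Lambda> / c * norm \<gamma>"
proof (cases "S \<gamma> = 0")
  case False
  have "c * (norm (S \<gamma>))\<^sup>2 \<le> \<bar>rhs \<gamma> (S \<gamma>)\<bar>"
    using B_coercive[of "S \<gamma>" \<gamma>] by (simp add: S_weak)
  also have "\<dots> \<le> l2 (\<lambda>x. p (crep \<gamma> x) - 1) * l2 (wder (S \<gamma>))"
    unfolding rhs_def by (intro l2_Cauchy_Schwarz p_minus_1_square_integrable wder_square_integrable)
  also have "\<dots> \<le> (\<Lambda> * norm \<gamma>) * norm (S \<gamma>)"
    using Lambda by (intro mult_mono p_minus_1_square_integrable l2_wder_le) auto
  finally have "(c * norm (S \<gamma>)) * norm (S \<gamma>) \<le> (\<Lambda> * norm \<gamma>) * norm (S \<gamma>)"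
    by (simp add: power2_eq_square mult.assoc)
  then have "c * norm (S \<gamma>) \<le> \<Lambda> * norm \<gamma>"
    using False by (simp add: mult_le_cancel_right)
  then show ?thesis using c by (simp add: field_simps)
qed (use Lambda c in auto)

text \<open>The distance of \<open>\<gamma>\<close> and \<open>\<gamma>'\<close> enters only through a pointwise majorant, so that the estimate
  also applies when the difference is controlled by that of transformed functions.\<close>

lemma S_diff:
  assumes A: "A \<ge> 0" and w: "\<And>x. \<bar>crep \<gamma> x - crep \<gamma>' x\<bar> \<le> A * \<bar>crep w x\<bar>"
  shows "norm (S \<gamma> - S \<gamma>') \<le> \<Lambda> * A / c * (1 + 4 * norm (S \<gamma>')) * norm w"
proof (cases "S \<gamma> = S \<gamma>'")
  case False
  define e where "e = S \<gamma> - S \<gamma>'"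
  interpret B: bounded_bilinear "B \<gamma>" by (rule B_bilinear)
  note [measurable] = coeff_measurable crep_measurable
  define P Q where "P x = p (crep \<gamma> x) - p (crep \<gamma>' x)" and "Q x = q (crep \<gamma> x) - q (crep \<gamma>' x)" for x
  have PQm[measurable]: "P \<in> borel_measurable lebesgue" "Q \<in> borel_measurable lebesgue"
    unfolding P_def Q_def by measurable
  have PQ1: "\<bar>P x\<bar> \<le> \<Lambda> * A * \<bar>crep w x\<bar>" "\<bar>Q x\<bar> \<le> \<Lambda> * A * \<bar>crep w x\<bar>" for x
    using order_trans[OF p_Lip mult_left_mono[OF w[of x], of \<Lambda>]] order_trans[OF q_Lip mult_left_mono[OF w[of x], of \<Lambda>]]
      Lambda by (simp_all add: P_def Q_def mult.assoc)
  \<comment> \<open>The uniform bounds serve the terms containing \<open>S \<gamma>'\<close>; the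
    source term pairs \<open>P\<close> alone with \<open>wder e\<close> and needs the L^2 bound that
    follows.\<close>
  have PQ2: "\<bar>P x\<bar> \<le> 2 * \<Lambda> * A * norm w" "\<bar>Q x\<bar> \<le> 2 * \<Lambda> * A * norm w" for x
    using PQ1[of x] mult_left_mono[OF crep_bound[of w x], of "\<Lambda> * A"] Lambda A by (auto simp: mult_ac)
  have sP: "square_integrable P" "l2 P \<le> \<Lambda> * A * norm w"
  proof -
    have *: "AE x in lebesgue. \<bar>P x\<bar> \<le> \<bar>(\<Lambda> * A) * crep w x\<bar>"
      using PQ1(1) Lambda A by (simp add: abs_mult)
    show "square_integrable P" "l2 P \<le> \<Lambda> * A * norm w"
      using square_integrable_mono[OF square_integrable_scale[OF crep_square_integrable] PQm(1) *]
        mult_left_mono[OF l2_crep_le[of w], of "\<Lambda> * A"] Lambda A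
      by (auto simp: l2_scale abs_mult intro: order_trans)
  qed
  note sw = square_integrable_bounded_mult[OF wder_square_integrable PQm(1) PQ2(1), of "S \<gamma>'"]
  note sc = square_integrable_bounded_mult[OF crep_square_integrable PQm(2) PQ2(2), of "S \<gamma>'"]
  \<comment> \<open>Both equations are tested with \<open>e\<close>. Keeping the form of \<gamma> on
    the left leaves only coefficient differences, which act on the fixed function
    \<open>S \<gamma>'\<close>.\<close>
  have "B \<gamma> e e = rhs \<gamma> e - B \<gamma> (S \<gamma>') e - (rhs \<gamma>' e - B \<gamma>' (S \<gamma>') e)"
    by (simp add: e_def B.diff_left S_weak)
  also have "\<dots> = (LINT x|lebesgue. P x * wder e x) - (LINT x|lebesgue. P x * wder (S \<gamma>') x * wder e x)
      - (LINT x|lebesgue. Q x * crep (S \<gamma>') x * crep e x)"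
  proof -
    have "(LINT x|lebesgue. P x * wder e x)
        = (LINT x|lebesgue. (p (crep \<gamma> x) - 1) * wder e x - (p (crep \<gamma>' x) - 1) * wder e x)"
      by (simp add: P_def left_diff_distrib)
    also have "\<dots> = rhs \<gamma> e - rhs \<gamma>' e"
      unfolding rhs_def
      by (intro Bochner_Integration.integral_diff square_integrable_mult p_minus_1_square_integrable wder_square_integrable)
    finally have "rhs \<gamma> e - rhs \<gamma>' e = (LINT x|lebesgue. P x * wder e x)" ..
    moreover have "B \<gamma> (S \<gamma>') e - B \<gamma>' (S \<gamma>') e = (LINT x|lebesgue. P x * wder (S \<gamma>') x * wder e x)
      + (LINT x|lebesgue. Q x * crep (S \<gamma>') x * crep e x)"
      using B_integrable[of \<gamma> "S \<gamma>'" e] B_integrable[of \<gamma>' "S \<gamma>'" e]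
      by (simp add: B_def P_def Q_def left_diff_distrib)
    ultimately show ?thesis by linarith
  qed
  also have "\<dots> \<le> l2 P * l2 (wder e) + (2 * \<Lambda> * A * norm w * l2 (wder (S \<gamma>'))) * l2 (wder e)
      + (2 * \<Lambda> * A * norm w * l2 (crep (S \<gamma>'))) * l2 (crep e)"
  proof -
    have *: "a1 - a2 - a3 \<le> b1 + b2 + b3" if "\<bar>a1\<bar> \<le> b1" "\<bar>a2\<bar> \<le> b2" "\<bar>a3\<bar> \<le> b3" for a1 a2 a3 b1 b2 b3 :: real
      using that by linarith
    show ?thesis
      by (rule *[OF l2_Cauchy_Schwarz[OF sP(1) wder_square_integrable]
            order_trans[OF l2_Cauchy_Schwarz[OF sw(1) wder_square_integrable] mult_right_mono[OF sw(2)]]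
            order_trans[OF l2_Cauchy_Schwarz[OF sc(1) crep_square_integrable] mult_right_mono[OF sc(2)]]]) auto
  qed
  also have "\<dots> \<le> (\<Lambda> * A * norm w) * norm e + (2 * \<Lambda> * A * norm w * norm (S \<gamma>')) * norm e
      + (2 * \<Lambda> * A * norm w * norm (S \<gamma>')) * norm e"
    using Lambda A by (intro add_mono mult_mono sP l2_wder_le l2_crep_le mult_nonneg_nonneg) auto
  also have "\<dots> = (\<Lambda> * A * (1 + 4 * norm (S \<gamma>')) * norm w) * norm e"
    by (simp add: algebra_simps)
  finally have "(c * norm e) * norm e \<le> (\<Lambda> * A * (1 + 4 * norm (S \<gamma>')) * norm w) * norm e"
    using B_coercive[of e \<gamma>] by (simp add: power2_eq_square mult.assoc)
  then have "c * norm e \<le> \<Lambda> * A * (1 + 4 * norm (S \<gamma>')) * norm w"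
    using False by (simp add: e_def mult_le_cancel_right)
  then show ?thesis using c by (simp add: e_def field_simps)
qed (use Lambda A c in auto)

text \<open>The constant grows with the norm, so \<open>S\<close> is only locally Lipschitz here; it
  involves the norm of one argument only, on which both the cutoff and the uniqueness proof
  rely.\<close>

lemma S_diff_norm: "norm (S \<gamma> - S \<gamma>') \<le> \<Lambda> / c * (1 + 4 * (\<Lambda> / c * norm \<gamma>')) * norm (\<gamma> - \<gamma>')"
proof -
  have "norm (S \<gamma> - S \<gamma>') \<le> \<Lambda> * 1 / c * (1 + 4 * norm (S \<gamma>')) * norm (\<gamma> - \<gamma>')"
    by (rule S_diff) (auto simp: crep_diff)
  also have "\<dots> \<le> \<Lambda> * 1 / c * (1 + 4 * (\<Lambda> / c * norm \<gamma>')) * norm (\<gamma> - \<gamma>')"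
    using Lambda c S_bound[of \<gamma>'] by (intro mult_right_mono mult_left_mono) auto
  finally show ?thesis by simp
qed

lemma S_continuous:
  assumes "continuous_on T \<gamma>" shows "continuous_on T (\<lambda>t. S (\<gamma> t))"
  unfolding continuous_on_def
proof
  fix t assume t: "t \<in> T"
  let ?C = "\<Lambda> / c * (1 + 4 * (\<Lambda> / c * norm (\<gamma> t)))"
  have "((\<lambda>s. S (\<gamma> s) - S (\<gamma> t)) \<longlongrightarrow> 0) (at t within T)"
  proof (rule Lim_null_comparison)
    show "\<forall>\<^sub>F s in at t within T. norm (S (\<gamma> s) - S (\<gamma> t)) \<le> ?C * norm (\<gamma> s - \<gamma> t)"
      by (intro always_eventually allI S_diff_norm)
    have "((\<lambda>s. ?C * norm (\<gamma> s - \<gamma> t)) \<longlongrightarrow> ?C * norm (\<gamma> t - \<gamma> t)) (at t within T)"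
      using assms t by (intro tendsto_intros) (auto simp: continuous_on_def)
    then show "((\<lambda>s. ?C * norm (\<gamma> s - \<gamma> t)) \<longlongrightarrow> 0) (at t within T)" by simp
  qed
  then show "((\<lambda>t. S (\<gamma> t)) \<longlongrightarrow> S (\<gamma> t)) (at t within T)" by (rule LIM_zero_cancel)
qed

lemma S_diff_norm_bounded:
  assumes "norm \<gamma>' \<le> R"
  shows "norm (S \<gamma> - S \<gamma>') \<le> \<Lambda> / c * (1 + 4 * (\<Lambda> / c * R)) * norm (\<gamma> - \<gamma>')"
  by (rule order_trans[OF S_diff_norm])
    (use assms c Lambda in \<open>intro mult_right_mono mult_left_mono add_left_mono; simp\<close>)

text \<open>In the variable \<open>\<phi>\<close> of the magma equation, \<open>k\<close> is \<open>H'\<close> and \<open>h\<close> is \<open>H\<close>.\<close>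

definition k :: "real \<Rightarrow> real" where "k = antideriv (\<lambda>x. 1 / p x)"

definition h :: "real \<Rightarrow> real" where "h = antideriv (\<lambda>x. q x * k x)"

text \<open>As d\<gamma> = \<phi>^(-m) d\<phi>, in the variable \<phi> this is the antiderivative of
  x^(-m) sqrt H.\<close>

definition Q :: "real \<Rightarrow> real" where "Q = antideriv (\<lambda>x. sqrt (h x))"

lemma p_pos: "p x > 0" and q_pos: "q x > 0"
  using p_bounds(1)[of x] q_bounds(1)[of x] c by linarith+

lemma inverse_p_cont: "continuous_on A (\<lambda>x. 1 / p x)"
  by (intro continuous_intros p_cont ballI) (metis p_pos less_irrefl)

lemma k_0: "k 0 = 0" and k_deriv: "(k has_real_derivative 1 / p x) (at x)"
  unfolding k_def by (rule antideriv[OF inverse_p_cont])+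

lemma k_cont: "continuous_on A k"
  by (meson k_deriv DERIV_isCont continuous_at_imp_continuous_on)

lemma h_0: "h 0 = 0" and h_deriv: "(h has_real_derivative q x * k x) (at x)"
  unfolding h_def by (rule antideriv; intro continuous_intros q_cont k_cont)+

lemma h_cont: "continuous_on A h"
  by (meson h_deriv DERIV_isCont continuous_at_imp_continuous_on)

lemma Q_0: "Q 0 = 0" and Q_deriv: "(Q has_real_derivative sqrt (h x)) (at x)"
  unfolding Q_def by (rule antideriv; intro continuous_intros h_cont)+

lemma k_Lip: "\<bar>k x - k y\<bar> \<le> 1 / c * \<bar>x - y\<bar>"
proof -
  have "norm (k x - k y) \<le> 1 / c * norm (x - y)"
  proof (rule field_differentiable_bound[OF convex_UNIV])
    show "norm (1 / p z) \<le> 1 / c" for z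
      using p_pos[of z] p_bounds(1)[of z] c by (simp add: frac_le)
  qed (use k_deriv in auto)
  then show ?thesis by simp
qed

lemma k_abs: "\<bar>k x\<bar> \<le> \<bar>x\<bar> / c"
  using k_Lip[of x 0] by (simp add: k_0)

lemma k_lower: "x \<ge> 0 \<Longrightarrow> x / M \<le> k x" "x \<le> 0 \<Longrightarrow> k x \<le> x / M"
proof -
  have "k a - a / M \<le> k b - b / M" if "a \<le> b" for a b
  proof (rule DERIV_nonneg_imp_nondecreasing[OF that])
    fix x
    have "((\<lambda>x. k x - x / M) has_real_derivative 1 / p x - 1 / M) (at x)"
      by (intro DERIV_diff k_deriv DERIV_cdivide DERIV_ident)
    moreover have "1 / p x - 1 / M \<ge> 0"
      using p_pos[of x] p_bounds(2)[of x] by (simp add: frac_le)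
    ultimately show "\<exists>y. ((\<lambda>x. k x - x / M) has_real_derivative y) (at x) \<and> 0 \<le> y" by blast
  qed
  from this[of 0 x] this[of x 0]
  show "x \<ge> 0 \<Longrightarrow> x / M \<le> k x" "x \<le> 0 \<Longrightarrow> k x \<le> x / M" by (auto simp: k_0)
qed

lemma qk_lower: "x \<ge> 0 \<Longrightarrow> c * x / M \<le> q x * k x" "x \<le> 0 \<Longrightarrow> q x * k x \<le> c * x / M"
proof -
  assume x: "x \<ge> 0"
  have "c * (x / M) \<le> q x * k x"
    by (intro mult_mono k_lower q_bounds x) (use x c M q_pos[of x] in auto)
  then show "c * x / M \<le> q x * k x" by simp
next
  assume x: "x \<le> 0"
  have "c * (- x / M) \<le> q x * (- k x)"
    using k_lower(2)[OF x] x c M q_pos[of x] divide_nonpos_pos[OF x M] by (intro mult_mono q_bounds) auto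
  then show "q x * k x \<le> c * x / M" by simp
qed

lemma qk_abs: "\<bar>q x * k x\<bar> \<le> M / c * \<bar>x\<bar>"
  using mult_mono[OF coeff_abs(2)[of x] k_abs[of x]] M by (simp add: abs_mult)

text \<open>Integrate the linear bounds of \<open>qk_lower\<close> away from 0 on either side.
  Quadratic growth is what lets the energy control the L^2 norm.\<close>

lemma h_lower: "c / (2 * M) * x\<^sup>2 \<le> h x"
proof -
  let ?f = "\<lambda>x. h x - c / (2 * M) * x\<^sup>2"
  have D: "(?f has_real_derivative q x * k x - c * x / M) (at x)" for x
    using M by (auto intro!: derivative_eq_intros h_deriv simp: field_simps)
  have "?f 0 \<le> ?f x"
  proof (cases "x \<ge> 0")
    case True then show ?thesis
      by (rule DERIV_nonneg_imp_nondecreasing) (use D qk_lower(1) in \<open>metis diff_ge_0_iff_ge\<close>)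
  next
    case False
    then have "x \<le> 0" by simp
    then show ?thesis
      by (rule DERIV_nonpos_imp_nonincreasing) (use D qk_lower(2) in \<open>metis diff_le_0_iff_le\<close>)
  qed
  then show ?thesis by (simp add: h_0)
qed

lemma h_nonneg: "h x \<ge> 0"
  by (rule order_trans[OF _ h_lower]) (use c M in auto)

lemma h_upper: "h x \<le> M / c * x\<^sup>2"
proof -
  have "norm (h x - h 0) \<le> (M / c * \<bar>x\<bar>) * norm (x - 0)"
  proof (rule field_differentiable_bound[where S = "cball 0 \<bar>x\<bar>"])
    show "norm (q z * k z) \<le> M / c * \<bar>x\<bar>" if "z \<in> cball 0 \<bar>x\<bar>" for z
      using order_trans[OF qk_abs[of z] mult_left_mono[of "\<bar>z\<bar>" "\<bar>x\<bar>" "M / c"]] that M c by (auto simp: dist_real_def)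
  qed (auto intro: has_field_derivative_at_within h_deriv)
  then show ?thesis using h_nonneg[of x] by (simp add: h_0 power2_eq_square mult.assoc)
qed

text \<open>\<open>k\<close> is unbounded, so some bound on an argument is used; the splitting
  multiplies the difference of \<open>q\<close> by \<open>k x\<close> only, hence \<open>y\<close>
  is arbitrary.\<close>

lemma qk_Lip:
  assumes "\<bar>x\<bar> \<le> r"
  shows "\<bar>q x * k x - q y * k y\<bar> \<le> (\<Lambda> * r / c + M / c) * \<bar>x - y\<bar>"
proof -
  have "q x * k x - q y * k y = (q x - q y) * k x + q y * (k x - k y)" by (simp add: algebra_simps)
  then have "\<bar>q x * k x - q y * k y\<bar> \<le> \<bar>q x - q y\<bar> * \<bar>k x\<bar> + \<bar>q y\<bar> * \<bar>k x - k y\<bar>"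
    by (simp add: abs_mult[symmetric])
  also have "\<dots> \<le> (\<Lambda> * \<bar>x - y\<bar>) * (r / c) + M * (1 / c * \<bar>x - y\<bar>)"
  proof (intro add_mono mult_mono q_Lip k_Lip coeff_abs)
    show "\<bar>k x\<bar> \<le> r / c"
      using k_abs[of x] divide_right_mono[OF assms, of c] c by linarith
  qed (use Lambda c M assms in auto)
  finally show ?thesis by (simp add: algebra_simps)
qed

text \<open>Mean value inequality for \<open>h\<close> minus its linear part at \<open>x\<close>.
  The constant depends on the base point alone and the increment is arbitrary, so the bound
  integrates to a quadratic remainder in \<open>H1\<close>.\<close>

lemma h_quadratic:
  assumes "\<bar>x\<bar> \<le> r"
  shows "\<bar>h (x + d) - h x - q x * k x * d\<bar> \<le> (\<Lambda> * r / c + M / c) * d\<^sup>2"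
proof -
  let ?K = "\<Lambda> * r / c + M / c"
  have K: "?K \<ge> 0" using Lambda c M assms by (intro add_nonneg_nonneg divide_nonneg_nonneg mult_nonneg_nonneg) auto
  have "norm ((h (x + d) - q x * k x * (x + d)) - (h x - q x * k x * x)) \<le> (?K * \<bar>d\<bar>) * norm (x + d - x)"
  proof (rule field_differentiable_bound[where S = "cball x \<bar>d\<bar>" and f = "\<lambda>y. h y - q x * k x * y" and f' = "\<lambda>y. q y * k y - q x * k x"])
    show "((\<lambda>y. h y - q x * k x * y) has_real_derivative q z * k z - q x * k x) (at z within cball x \<bar>d\<bar>)" for z
      by (auto intro!: derivative_eq_intros has_field_derivative_at_within[OF h_deriv])
    show "norm (q z * k z - q x * k x) \<le> ?K * \<bar>d\<bar>" if "z \<in> cball x \<bar>d\<bar>" for z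
      using order_trans[OF qk_Lip[OF assms, of z] mult_left_mono[of "\<bar>x - z\<bar>" "\<bar>d\<bar>" ?K]] that K
      by (auto simp: dist_real_def abs_minus_commute)
  qed (auto simp: dist_real_def)
  then show ?thesis by (simp add: power2_eq_square algebra_simps)
qed

lemma h_crep_integrable: "integrable lebesgue (\<lambda>x. h (crep \<gamma> x))"
proof (rule Bochner_Integration.integrable_bound)
  show "integrable lebesgue (\<lambda>x. M / c * (crep \<gamma> x)\<^sup>2)"
    using square_integrableD(2)[OF crep_square_integrable] by simp
  have "continuous_on UNIV (\<lambda>x. h (crep \<gamma> x))"
    by (rule continuous_on_compose2[OF h_cont[of UNIV] crep_continuous_on]) simp
  then show "(\<lambda>x. h (crep \<gamma> x)) \<in> borel_measurable lebesgue"
    by (rule continuous_measurable_lebesgue)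
  show "AE x in lebesgue. norm (h (crep \<gamma> x)) \<le> norm (M / c * (crep \<gamma> x)\<^sup>2)"
    using h_upper h_nonneg M c by (auto intro!: AE_I2 simp: abs_mult)
qed

lemma qk_crep_square_integrable: "square_integrable (\<lambda>x. q (crep \<gamma> x) * k (crep \<gamma> x))"
proof (rule square_integrable_mono(1)[OF square_integrable_scale[OF crep_square_integrable, of "M / c" \<gamma>]])
  have "continuous_on UNIV (\<lambda>x. q (crep \<gamma> x) * k (crep \<gamma> x))"
    by (intro continuous_on_mult continuous_on_compose2[OF q_cont[of UNIV] crep_continuous_on]
        continuous_on_compose2[OF k_cont[of UNIV] crep_continuous_on]) auto
  then show "(\<lambda>x. q (crep \<gamma> x) * k (crep \<gamma> x)) \<in> borel_measurable lebesgue"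
    by (rule continuous_measurable_lebesgue)
  show "AE x in lebesgue. \<bar>q (crep \<gamma> x) * k (crep \<gamma> x)\<bar> \<le> \<bar>M / c * crep \<gamma> x\<bar>"
    using qk_abs M c by (auto simp: abs_mult)
qed

section \<open>The energy and its conservation\<close>

definition E :: "H1 \<Rightarrow> real" where
  "E \<gamma> = (LINT x|lebesgue. wder \<gamma> x * wder \<gamma> x) / 2 + (LINT x|lebesgue. h (crep \<gamma> x))"

definition E' :: "H1 \<Rightarrow> H1 \<Rightarrow> real" where
  "E' \<gamma> v = (LINT x|lebesgue. wder \<gamma> x * wder v x) + (LINT x|lebesgue. q (crep \<gamma> x) * k (crep \<gamma> x) * crep v x)"

lemma potential_has_derivative:
  "((\<lambda>\<gamma>. LINT x|lebesgue. h (crep \<gamma> x)) has_derivative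
     (\<lambda>v. LINT x|lebesgue. q (crep \<gamma> x) * k (crep \<gamma> x) * crep v x)) (at \<gamma>)"
proof (rule has_derivativeI_sandwich[of 1])
  \<comment> \<open>The values of \<gamma> are bounded by \<open>2 * norm \<gamma>\<close>, so one
    constant from \<open>h_quadratic\<close> serves all points.\<close>
  define K where "K = \<Lambda> * (2 * norm \<gamma>) / c + M / c"
  have K: "K \<ge> 0" using Lambda c M unfolding K_def by (intro add_nonneg_nonneg divide_nonneg_nonneg mult_nonneg_nonneg) auto
  show "((\<lambda>y. K * norm (y - \<gamma>)) \<longlongrightarrow> 0) (at \<gamma> within UNIV)"
  proof -
    have "((\<lambda>y. K * norm (y - \<gamma>)) \<longlongrightarrow> K * norm (\<gamma> - \<gamma>)) (at \<gamma>)" by (intro tendsto_intros)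
    then show ?thesis by simp
  qed
  show "bounded_linear (\<lambda>v. LINT x|lebesgue. q (crep \<gamma> x) * k (crep \<gamma> x) * crep v x)"
    by (rule bounded_linear_LINT_crep[OF qk_crep_square_integrable])
  fix y assume "y \<noteq> \<gamma>"
  define v where "v = y - \<gamma>"
  note i = h_crep_integrable[of y] h_crep_integrable[of \<gamma>]
    square_integrable_mult[OF qk_crep_square_integrable[of \<gamma>] crep_square_integrable[of v]]
  have "norm ((LINT x|lebesgue. h (crep y x)) - (LINT x|lebesgue. h (crep \<gamma> x))
      - (LINT x|lebesgue. q (crep \<gamma> x) * k (crep \<gamma> x) * crep v x))
    = norm (LINT x|lebesgue. h (crep y x) - h (crep \<gamma> x) - q (crep \<gamma> x) * k (crep \<gamma> x) * crep v x)"
    using i by simp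
  also have "\<dots> \<le> (LINT x|lebesgue. K * (crep v x)\<^sup>2)"
  proof (rule Bochner_Integration.integral_norm_bound_integral)
    show "integrable lebesgue (\<lambda>x. h (crep y x) - h (crep \<gamma> x) - q (crep \<gamma> x) * k (crep \<gamma> x) * crep v x)"
      using i by simp
    show "integrable lebesgue (\<lambda>x. K * (crep v x)\<^sup>2)"
      using square_integrableD(2)[OF crep_square_integrable] by simp
    show "norm (h (crep y x) - h (crep \<gamma> x) - q (crep \<gamma> x) * k (crep \<gamma> x) * crep v x) \<le> K * (crep v x)\<^sup>2" for x
      using h_quadratic[OF crep_bound[of \<gamma> x], of "crep v x"] by (simp add: v_def crep_diff K_def)
  qed
  also have "\<dots> = K * (l2 (crep v))\<^sup>2" by (simp add: l2_square)
  also have "\<dots> \<le> K * (norm v)\<^sup>2" by (intro mult_left_mono power_mono l2_crep_le K) simp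
  finally show "norm ((LINT x|lebesgue. h (crep y x)) - (LINT x|lebesgue. h (crep \<gamma> x))
      - (LINT x|lebesgue. q (crep \<gamma> x) * k (crep \<gamma> x) * crep (y - \<gamma>) x)) / norm (y - \<gamma>) \<le> K * norm (y - \<gamma>)"
    using \<open>y \<noteq> \<gamma>\<close> by (simp add: v_def divide_le_eq power2_eq_square)
qed auto

lemma E_deriv:
  assumes "(\<gamma> has_vector_derivative v) (at t within T)"
  shows "((\<lambda>s. E (\<gamma> s)) has_real_derivative E' (\<gamma> t) v) (at t within T)"
proof -
  \<comment> \<open>The Dirichlet form is the weighted form with coefficients 1 and 0.\<close>
  have "bounded_bilinear (\<lambda>u v. (LINT x|lebesgue. 1 * wder u x * wder v x) + (LINT x|lebesgue. 0 * crep u x * crep v x))"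
    by (rule bounded_bilinear_weighted[where M = 1]) auto
  then have W: "bounded_bilinear (\<lambda>u v. LINT x|lebesgue. wder u x * wder v x)" by simp
  have 1: "((\<lambda>s. LINT x|lebesgue. wder (\<gamma> s) x * wder (\<gamma> s) x) has_vector_derivative
      (LINT x|lebesgue. wder (\<gamma> t) x * wder v x) + (LINT x|lebesgue. wder v x * wder (\<gamma> t) x)) (at t within T)"
    by (rule bounded_bilinear.has_vector_derivative[OF W assms assms])
  interpret L: bounded_linear "\<lambda>v. LINT x|lebesgue. q (crep (\<gamma> t) x) * k (crep (\<gamma> t) x) * crep v x"
    by (rule bounded_linear_LINT_crep[OF qk_crep_square_integrable])
  have "((\<lambda>s. LINT x|lebesgue. h (crep (\<gamma> s) x)) has_derivative
      (\<lambda>s. LINT x|lebesgue. q (crep (\<gamma> t) x) * k (crep (\<gamma> t) x) * crep (s *\<^sub>R v) x)) (at t within T)"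
    by (rule has_derivative_compose[OF assms[unfolded has_vector_derivative_def] potential_has_derivative])
  then have 2: "((\<lambda>s. LINT x|lebesgue. h (crep (\<gamma> s) x)) has_real_derivative
      (LINT x|lebesgue. q (crep (\<gamma> t) x) * k (crep (\<gamma> t) x) * crep v x)) (at t within T)"
    by (simp add: has_field_derivative_def L.scaleR mult_commute_abs)
  have "((\<lambda>s. E (\<gamma> s)) has_real_derivative
     ((LINT x|lebesgue. wder (\<gamma> t) x * wder v x) + (LINT x|lebesgue. wder v x * wder (\<gamma> t) x)) / 2
      + (LINT x|lebesgue. q (crep (\<gamma> t) x) * k (crep (\<gamma> t) x) * crep v x)) (at t within T)"
    unfolding E_def using 1 2
    by (intro DERIV_add DERIV_cdivide) (simp_all add: has_real_derivative_iff_has_vector_derivative)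
  then show ?thesis by (simp add: E'_def mult.commute)
qed

text \<open>Energy conservation: test the equation for \<open>S \<gamma>\<close> with \<open>k \<circ> \<gamma>\<close>.\<close>

lemma E'_S: "E' \<gamma> (S \<gamma>) = 0"
proof -
  let ?\<gamma> = "crep \<gamma>"
  have pair: "H1_pair (\<lambda>x. k (?\<gamma> x)) (\<lambda>x. 1 / p (?\<gamma> x) * wder \<gamma> x)"
    by (rule H1_pair_chain[OF crep_pair(1) convex_UNIV, where M = "1 / c"])
      (use k_deriv k_0 inverse_p_cont p_pos p_bounds(1) c in \<open>auto simp: frac_le abs_of_pos\<close>)
  define v where "v = abs_H1 (\<lambda>x. k (?\<gamma> x))"
  have cv: "crep v x = k (?\<gamma> x)" and wv: "AE x in lebesgue. wder v x = 1 / p (?\<gamma> x) * wder \<gamma> x" for x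
    unfolding v_def using crep_abs[OF pair] by auto
  note [measurable] = coeff_measurable crep_measurable
  \<comment> \<open>Since p(\<gamma>) v_z = \<gamma>_z, the test function \<open>v\<close> turns the
    elliptic form into the derivative of the energy.\<close>
  have "E' \<gamma> (S \<gamma>) = B \<gamma> (S \<gamma>) v"
  proof -
    have "(LINT x|lebesgue. wder \<gamma> x * wder (S \<gamma>) x) = (LINT x|lebesgue. p (?\<gamma> x) * wder (S \<gamma>) x * wder v x)"
    proof (rule integral_cong_AE)
      show "AE x in lebesgue. wder \<gamma> x * wder (S \<gamma>) x = p (?\<gamma> x) * wder (S \<gamma>) x * wder v x"
        using wv by eventually_elim (use p_pos in \<open>auto simp: less_imp_neq[symmetric]\<close>)
    qed measurable
    then show ?thesis by (simp add: E'_def B_def cv mult_ac)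
  qed
  also have "\<dots> = (LINT x|lebesgue. (p (?\<gamma> x) - 1) * wder v x)"
    unfolding S_weak rhs_def ..
  \<comment> \<open>The right-hand side becomes the integral of a derivative, since (p(\<gamma>) -
    1) v_z = (\<gamma> - v)_z.\<close>
  also have "\<dots> = (LINT x|lebesgue. wder (\<gamma> - v) x)"
  proof (rule integral_cong_AE)
    show "AE x in lebesgue. (p (?\<gamma> x) - 1) * wder v x = wder (\<gamma> - v) x"
      using wv wder_diff[of \<gamma> v] by eventually_elim (use p_pos in \<open>auto simp: less_imp_neq[symmetric] field_simps\<close>)
  qed measurable
  also have "\<dots> = 0"
  proof (rule primitive_integral_zero[OF crep_primitive H1_pair_decay[OF crep_pair(1)]])
    have "integrable lebesgue (\<lambda>x. (p (?\<gamma> x) - 1) * wder v x)"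
      by (intro square_integrable_mult p_minus_1_square_integrable wder_square_integrable)
    then show "integrable lebesgue (wder (\<gamma> - v))"
    proof (rule integrable_cong_AE_imp)
      show "AE x in lebesgue. (p (?\<gamma> x) - 1) * wder v x = wder (\<gamma> - v) x"
        using wv wder_diff[of \<gamma> v] by eventually_elim (use p_pos in \<open>auto simp: less_imp_neq[symmetric] field_simps\<close>)
    qed measurable
  qed
  finally show ?thesis .
qed

lemma E'_scaleR: "E' \<gamma> (a *\<^sub>R v) = a * E' \<gamma> v"
proof -
  have "E' \<gamma> (a *\<^sub>R v) = a *\<^sub>R E' \<gamma> v"
    unfolding E'_def
    by (rule linear_cmul[OF bounded_linear.linear[OF bounded_linear_add[OF bounded_linear_LINT_wder[OF wder_square_integrable]
       bounded_linear_LINT_crep[OF qk_crep_square_integrable]]]])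
  then show ?thesis by simp
qed

lemma norm_le_E: "(norm \<gamma>)\<^sup>2 \<le> (2 * M / c + 2) * E \<gamma>"
proof -
  have "c / (2 * M) * (l2 (crep \<gamma>))\<^sup>2 = (LINT x|lebesgue. c / (2 * M) * (crep \<gamma> x)\<^sup>2)"
    by (simp add: l2_square)
  also have "\<dots> \<le> (LINT x|lebesgue. h (crep \<gamma> x))"
    by (intro integral_mono h_crep_integrable h_lower)
      (use square_integrableD(2)[OF crep_square_integrable] in simp)
  finally have 1: "c / (2 * M) * (l2 (crep \<gamma>))\<^sup>2 \<le> (LINT x|lebesgue. h (crep \<gamma> x))" .
  have hp: "(LINT x|lebesgue. h (crep \<gamma> x)) \<ge> 0" using h_nonneg by simp
  have wp: "(LINT x|lebesgue. wder \<gamma> x * wder \<gamma> x) = (l2 (wder \<gamma>))\<^sup>2"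
    unfolding l2_square by (simp add: power2_eq_square)
  have "c / (2 * M) * (l2 (crep \<gamma>))\<^sup>2 \<le> E \<gamma>" unfolding E_def using 1 wp zero_le_power2[of "l2 (wder \<gamma>)"] by linarith
  then have "(l2 (crep \<gamma>))\<^sup>2 \<le> 2 * M / c * E \<gamma>"
    using c M by (simp add: field_simps)
  moreover have "(l2 (wder \<gamma>))\<^sup>2 \<le> 2 * E \<gamma>" using hp wp by (simp add: E_def)
  ultimately show ?thesis by (simp add: norm_H1_l2 distrib_right)
qed

lemma Q_bound: "\<bar>Q (crep \<gamma> x)\<bar> \<le> E \<gamma>"
proof -
  define r where "r = (\<lambda>x. sqrt (h (crep \<gamma> x)) * wder \<gamma> x)"
  have csh: "continuous_on A (\<lambda>x. sqrt (h x))" for A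
    by (intro continuous_intros h_cont)
  have pr: "primitive (\<lambda>x. Q (crep \<gamma> x)) r"
    unfolding r_def
    by (rule primitive_chain[OF crep_primitive convex_UNIV, where P = Q and P' = "\<lambda>x. sqrt (h x)"])
      (use Q_deriv csh in auto)
  define e where "e = (\<lambda>x. wder \<gamma> x * wder \<gamma> x / 2 + h (crep \<gamma> x))"
  have ei: "integrable lebesgue e"
    unfolding e_def
    using square_integrable_mult[OF wder_square_integrable wder_square_integrable] h_crep_integrable by simp
  have eE: "(LINT x|lebesgue. e x) = E \<gamma>"
    unfolding e_def E_def
    using square_integrable_mult[OF wder_square_integrable wder_square_integrable] h_crep_integrable by simp
  have re: "\<bar>r x\<bar> \<le> e x" for x
  proof -
    \<comment> \<open>From 2xy <= x^2 + y^2 the modulus of \<open>r\<close> is at most the energy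
      density, with h / 2 to spare.\<close>
    have "0 \<le> (sqrt (h (crep \<gamma> x)) - \<bar>wder \<gamma> x\<bar>)\<^sup>2" by simp
    also have "\<dots> = h (crep \<gamma> x) + wder \<gamma> x * wder \<gamma> x - 2 * \<bar>r x\<bar>"
      using h_nonneg[of "crep \<gamma> x"] by (simp add: power2_diff r_def abs_mult) (simp add: power2_eq_square)
    finally show ?thesis using h_nonneg[of "crep \<gamma> x"] by (simp add: e_def)
  qed
  have e0: "e x \<ge> 0" for x using re[of x] by linarith
  have step: "\<bar>Q (crep \<gamma> x) - Q (crep \<gamma> y)\<bar> \<le> E \<gamma>" if "y \<le> x" for y
  proof -
    have "\<bar>Q (crep \<gamma> x) - Q (crep \<gamma> y)\<bar> \<le> integral {y..x} (\<lambda>x. \<bar>r x\<bar>)"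
      by (rule primitive_diff_bound[OF pr that])
    also have "\<dots> \<le> integral {y..x} e"
      using absolutely_integrable_onD[OF primitiveD(1)[OF pr]] re
        absolutely_integrable_onD(1)[OF integral_interval_LINT(2)[OF ei]]
      by (intro integral_le) auto
    also have "\<dots> = (LINT z|lebesgue. indicator {y..x} z * e z)"
      by (rule integral_interval_LINT(1)[OF ei])
    also have "\<dots> \<le> (LINT z|lebesgue. e z)"
      using integrable_mult_indicator[OF _ ei, of "{y..x}"] ei e0
      by (intro integral_mono) (auto simp: indicator_def)
    finally show ?thesis by (simp add: eE)
  qed
  \<comment> \<open>Letting y tend to minus infinity removes the comparison value, as \<gamma>
    vanishes there and \<open>Q 0 = 0\<close>.\<close>
  have "isCont Q 0" by (rule DERIV_isCont[OF Q_deriv])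
  then have "((\<lambda>y. Q (crep \<gamma> y)) \<longlongrightarrow> Q 0) at_bot"
    by (rule isCont_tendsto_compose[OF _ H1_pair_decay(2)[OF crep_pair(1)]])
  then have "((\<lambda>y. \<bar>Q (crep \<gamma> x) - Q (crep \<gamma> y)\<bar>) \<longlongrightarrow> \<bar>Q (crep \<gamma> x) - 0\<bar>) at_bot"
    unfolding Q_0 by (intro tendsto_intros)
  then have "\<bar>Q (crep \<gamma> x) - 0\<bar> \<le> E \<gamma>"
    by (rule tendsto_upperbound) (use step in \<open>auto simp: eventually_at_bot_linorder\<close>)
  then show ?thesis by simp
qed

text \<open>The cutoff is 1 up to norm R and 0 beyond 2 R, and its slope 1 / R is compensated by the
  linear growth of \<open>S\<close>. As the Lipschitz constant of \<open>S\<close> involves one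
  argument only, it suffices that one of the two points lies in the ball of radius 2 R.\<close>

lemma cutoff_Lipschitz:
  assumes "R > 0"
  shows "\<exists>L>0. \<forall>\<gamma> \<gamma>'. norm (max 0 (min 1 (2 - norm \<gamma> / R)) *\<^sub>R S \<gamma> - max 0 (min 1 (2 - norm \<gamma>' / R)) *\<^sub>R S \<gamma>')
    \<le> L * norm (\<gamma> - \<gamma>')"
proof -
  define cut where "cut \<gamma> = max 0 (min 1 (2 - norm \<gamma> / R))" for \<gamma> :: H1
  have cut01: "0 \<le> cut \<gamma>" "cut \<gamma> \<le> 1" for \<gamma> by (auto simp: cut_def)
  have cut0: "cut \<gamma> = 0" if "norm \<gamma> > 2 * R" for \<gamma>
    using that assms by (simp add: cut_def max_def min_def field_simps)
  have cutL: "\<bar>cut \<gamma> - cut \<gamma>'\<bar> \<le> norm (\<gamma> - \<gamma>') / R" for \<gamma> \<gamma>'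
  proof -
    have "\<bar>cut \<gamma> - cut \<gamma>'\<bar> \<le> \<bar>(2 - norm \<gamma> / R) - (2 - norm \<gamma>' / R)\<bar>"
      unfolding cut_def by (simp add: max_def min_def)
    also have "\<dots> = \<bar>norm \<gamma> - norm \<gamma>'\<bar> / R" using assms by (simp add: diff_divide_distrib[symmetric] abs_minus_commute)
    also have "\<dots> \<le> norm (\<gamma> - \<gamma>') / R" using assms by (intro divide_right_mono norm_triangle_ineq3) simp
    finally show ?thesis .
  qed
  define L where "L = \<Lambda> / c * (1 + 4 * (\<Lambda> / c * (2 * R))) + \<Lambda> / c * 2"
  have L: "L > 0" unfolding L_def using Lambda c assms by (intro add_pos_pos mult_pos_pos) (auto intro!: add_pos_nonneg)
  have main: "norm (cut \<gamma> *\<^sub>R S \<gamma> - cut \<gamma>' *\<^sub>R S \<gamma>') \<le> L * norm (\<gamma> - \<gamma>')" if g: "norm \<gamma>' \<le> 2 * R" for \<gamma> \<gamma>'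
  proof -
    have "cut \<gamma> *\<^sub>R S \<gamma> - cut \<gamma>' *\<^sub>R S \<gamma>' = cut \<gamma> *\<^sub>R (S \<gamma> - S \<gamma>') + (cut \<gamma> - cut \<gamma>') *\<^sub>R S \<gamma>'"
      by (simp add: scaleR_diff_right scaleR_diff_left)
    then have "norm (cut \<gamma> *\<^sub>R S \<gamma> - cut \<gamma>' *\<^sub>R S \<gamma>') \<le> cut \<gamma> * norm (S \<gamma> - S \<gamma>') + \<bar>cut \<gamma> - cut \<gamma>'\<bar> * norm (S \<gamma>')"
      using norm_triangle_ineq[of "cut \<gamma> *\<^sub>R (S \<gamma> - S \<gamma>')" "(cut \<gamma> - cut \<gamma>') *\<^sub>R S \<gamma>'"] cut01 by simp
    also have "\<dots> \<le> 1 * (\<Lambda> / c * (1 + 4 * (\<Lambda> / c * (2 * R))) * norm (\<gamma> - \<gamma>')) + norm (\<gamma> - \<gamma>') / R * (\<Lambda> / c * (2 * R))"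
    proof (intro add_mono mult_mono cut01 cutL)
      show "norm (S \<gamma> - S \<gamma>') \<le> \<Lambda> / c * (1 + 4 * (\<Lambda> / c * (2 * R))) * norm (\<gamma> - \<gamma>')"
        by (rule S_diff_norm_bounded[OF g])
      show "norm (S \<gamma>') \<le> \<Lambda> / c * (2 * R)"
        by (rule order_trans[OF S_bound]) (use g Lambda c in \<open>intro mult_left_mono; auto\<close>)
    qed (use assms in auto)
    also have "\<dots> = L * norm (\<gamma> - \<gamma>')"
      using assms by (simp add: L_def algebra_simps)
    finally show ?thesis .
  qed
  have "norm (cut \<gamma> *\<^sub>R S \<gamma> - cut \<gamma>' *\<^sub>R S \<gamma>') \<le> L * norm (\<gamma> - \<gamma>')" for \<gamma> \<gamma>'
  proof -
    consider "norm \<gamma>' \<le> 2 * R" | "norm \<gamma> \<le> 2 * R" | "norm \<gamma> > 2 * R" "norm \<gamma>' > 2 * R" by linarith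
    then show ?thesis
    proof cases
      case 1 then show ?thesis by (rule main)
    next
      case 2 then show ?thesis using main[of \<gamma> \<gamma>'] by (simp add: norm_minus_commute)
    next
      case 3 then show ?thesis using cut0 L by simp
    qed
  qed
  then show ?thesis using L unfolding cut_def by blast
qed

text \<open>The cutoff makes the vector field globally Lipschitz and still conserves \<open>E\<close>, which in turn
  keeps the norm in the range where the cutoff is inactive.\<close>

lemma global_flow:
  "\<exists>\<gamma>. \<gamma> 0 = \<gamma>0 \<and> (\<forall>t\<ge>0. (\<gamma> has_vector_derivative S (\<gamma> t)) (at t within {0..}) \<and> E (\<gamma> t) = E \<gamma>0)"
proof -
  \<comment> \<open>\<open>norm_le_E\<close> bounds the flow by the square root; the added 1 makes R
    positive even for zero energy.\<close>
  define R where "R = sqrt ((2 * M / c + 2) * E \<gamma>0) + 1"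
  have "0 \<le> (2 * M / c + 2) * E \<gamma>0" using norm_le_E[of \<gamma>0] by (meson order_trans zero_le_power2)
  then have R: "R > 0" unfolding R_def by (simp add: add_nonneg_pos)
  define cut where "cut \<gamma> = max 0 (min 1 (2 - norm \<gamma> / R))" for \<gamma> :: H1
  obtain L where L: "L > 0" "\<And>\<gamma> \<gamma>'. norm (cut \<gamma> *\<^sub>R S \<gamma> - cut \<gamma>' *\<^sub>R S \<gamma>') \<le> L * norm (\<gamma> - \<gamma>')"
    using cutoff_Lipschitz[OF R] unfolding cut_def by blast
  obtain \<gamma> where \<gamma>: "\<gamma> 0 = \<gamma>0"
      "\<And>t. t \<ge> 0 \<Longrightarrow> (\<gamma> has_vector_derivative cut (\<gamma> t) *\<^sub>R S (\<gamma> t)) (at t within {0..})"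
    using global_Picard[of L "\<lambda>\<gamma>. cut \<gamma> *\<^sub>R S \<gamma>" \<gamma>0, OF L] by blast
  have D: "((\<lambda>s. E (\<gamma> s)) has_vector_derivative 0) (at t within {0..})" if "t \<ge> 0" for t
    using E_deriv[OF \<gamma>(2)[OF that]] by (simp add: E'_scaleR E'_S has_real_derivative_iff_has_vector_derivative)
  obtain e where "\<And>t. t \<in> {0..} \<Longrightarrow> E (\<gamma> t) = e"
    using has_vector_derivative_zero_constant[of "{0..}" "\<lambda>s. E (\<gamma> s)"] D by (auto simp: convex_real_interval)
  then have Ec: "E (\<gamma> t) = E \<gamma>0" if "t \<ge> 0" for t using that \<gamma>(1) by (metis atLeast_iff order_refl)
  have "cut (\<gamma> t) = 1" if "t \<ge> 0" for t
  proof -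
    have "norm (\<gamma> t) \<le> sqrt ((2 * M / c + 2) * E \<gamma>0)"
      using norm_le_E[of "\<gamma> t"] Ec[OF that] by (simp add: real_le_rsqrt)
    then have "norm (\<gamma> t) \<le> R" by (simp add: R_def)
    then show ?thesis using R by (simp add: cut_def max_def min_def field_simps)
  qed
  then show ?thesis using \<gamma> Ec by (intro exI[of _ \<gamma>]) auto
qed

end

section \<open>Superposition operators and curves in \<open>H\<^sup>1\<close>\<close>

text \<open>Pointwise differentiability suffices, because evaluation commutes with the integral in
  \<open>H1\<close> and its values determine the element. Thus no nonlinear map on \<open>H1\<close>
  has to be differentiated.\<close>

lemma H1_curve_integral:
  fixes f g :: "real \<Rightarrow> H1"
  assumes f: "continuous_on {a..b} f"
    and D: "\<And>z t. a \<le> t \<Longrightarrow> t \<le> b \<Longrightarrow> ((\<lambda>s. crep (g s) z) has_real_derivative crep (f t) z) (at t within {a..b})"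
    and t: "a \<le> t" "t \<le> b"
  shows "g t = g a + integral {a..t} f"
proof (rule crep_eqI)
  fix z
  have fi: "f integrable_on {a..t}"
    by (rule integrable_continuous_interval[OF continuous_on_subset[OF f]]) (use t in auto)
  have "((\<lambda>s. crep (f s) z) has_integral crep (g t) z - crep (g a) z) {a..t}"
  proof (rule fundamental_theorem_of_calculus[OF t(1)])
    fix s assume "s \<in> {a..t}"
    then have "((\<lambda>s. crep (g s) z) has_real_derivative crep (f s) z) (at s within {a..t})"
      using D[of s z] t by (auto intro: DERIV_subset)
    then show "((\<lambda>s. crep (g s) z) has_vector_derivative crep (f s) z) (at s within {a..t})"
      by (simp add: has_real_derivative_iff_has_vector_derivative)
  qed
  moreover have "integral {a..t} (\<lambda>s. crep (f s) z) = crep (integral {a..t} f) z"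
    using integral_linear[OF fi bounded_linear_crep[of z]] by (simp add: o_def)
  ultimately show "crep (g t) z = crep (g a + integral {a..t} f) z"
    by (simp add: crep_add integral_unique)
qed

lemma l2_mult_le:
  assumes "continuous_on UNIV F" "\<And>x. \<bar>F x\<bar> \<le> K" "square_integrable g"
  shows "square_integrable (\<lambda>x. F x * g x)" "l2 (\<lambda>x. F x * g x) \<le> K * l2 g"
proof -
  have "F \<in> borel_measurable lebesgue"
    by (rule continuous_measurable_lebesgue[OF assms(1)])
  then show "square_integrable (\<lambda>x. F x * g x)" "l2 (\<lambda>x. F x * g x) \<le> K * l2 g"
    using square_integrable_bounded_mult assms(2,3) by blast+
qed

lemma norm_abs_diff:
  assumes "H1_pair f g" "H1_pair f' g'"
  shows "norm (abs_H1 f - abs_H1 f') \<le> l2 (\<lambda>x. f x - f' x) + l2 (\<lambda>x. g x - g' x)"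
proof -
  have "AE x in lebesgue. wder (abs_H1 f - abs_H1 f') x = g x - g' x"
    using crep_abs(2)[OF assms(1)] crep_abs(2)[OF assms(2)] wder_diff[of "abs_H1 f" "abs_H1 f'"]
    by eventually_elim simp
  then have "l2 (wder (abs_H1 f - abs_H1 f')) = l2 (\<lambda>x. g x - g' x)"
    using square_integrable_diff[OF H1_pairD(2)[OF assms(1)] H1_pairD(2)[OF assms(2)]]
    by (intro square_integrable_cong_AE(2))
  moreover have "crep (abs_H1 f - abs_H1 f') = (\<lambda>x. f x - f' x)"
    by (simp add: fun_eq_iff crep_diff crep_abs(1)[OF assms(1)] crep_abs(1)[OF assms(2)])
  ultimately show ?thesis using norm_H1_le[of "abs_H1 f - abs_H1 f'"] by simp
qed

text \<open>Made for the map that sends \<gamma> and u to f(\<gamma>) u. Its spatial derivative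
  contains f'(\<gamma>) \<gamma>_z u, so continuity in H^1 uses a Lipschitz bound on
  \<open>f'\<close>. A single \<open>M\<close> serves all bounds.\<close>

locale superposition =
  fixes I :: "real set" and f f' :: "real \<Rightarrow> real" and M :: real
  assumes I: "convex I"
    and f_deriv: "\<And>x. x \<in> I \<Longrightarrow> (f has_real_derivative f' x) (at x within I)"
    and f_bound: "\<And>x. x \<in> I \<Longrightarrow> \<bar>f x\<bar> \<le> M"
    and f'_bound: "\<And>x. x \<in> I \<Longrightarrow> \<bar>f' x\<bar> \<le> M"
    and f'_Lip: "\<And>x y. x \<in> I \<Longrightarrow> y \<in> I \<Longrightarrow> \<bar>f' x - f' y\<bar> \<le> M * \<bar>x - y\<bar>"
    and M0: "M \<ge> 0"
begin

lemma f_Lip: "x \<in> I \<Longrightarrow> y \<in> I \<Longrightarrow> \<bar>f x - f y\<bar> \<le> M * \<bar>x - y\<bar>"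
  using field_differentiable_bound[OF I f_deriv, where B = M] f'_bound by force

lemma f_cont: "continuous_on I f"
  by (meson DERIV_continuous continuous_on_eq_continuous_within f_deriv)

lemma f'_cont: "continuous_on I f'"
  by (rule lipschitz_on_continuous_on[of M]) (use f'_Lip M0 in \<open>auto intro!: lipschitz_onI simp: dist_real_def\<close>)

lemma compose_cont:
  assumes "\<And>x. crep \<gamma> x \<in> I"
  shows "continuous_on A (\<lambda>x. f (crep \<gamma> x))" "continuous_on A (\<lambda>x. f' (crep \<gamma> x))"
  by (rule continuous_on_compose2[OF f_cont crep_continuous_on] continuous_on_compose2[OF f'_cont crep_continuous_on];
      use assms in auto)+

lemma pair:
  assumes \<gamma>: "\<And>x. crep \<gamma> x \<in> I"
  shows "H1_pair (\<lambda>x. f (crep \<gamma> x) * crep u x)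
     (\<lambda>x. f (crep \<gamma> x) * wder u x + f' (crep \<gamma> x) * wder \<gamma> x * crep u x)"
  unfolding H1_pair_def
proof (intro conjI square_integrable_add)
  note c = compose_cont[OF \<gamma>]
  show "square_integrable (\<lambda>x. f (crep \<gamma> x) * crep u x)" "square_integrable (\<lambda>x. f (crep \<gamma> x) * wder u x)"
    by (rule l2_mult_le(1)[OF c(1) f_bound[OF \<gamma>]]; rule crep_square_integrable wder_square_integrable)+
  have "square_integrable (\<lambda>x. (f' (crep \<gamma> x) * crep u x) * wder \<gamma> x)"
  proof (rule l2_mult_le(1)[OF _ _ wder_square_integrable])
    show "continuous_on UNIV (\<lambda>x. f' (crep \<gamma> x) * crep u x)"
      by (intro continuous_intros c crep_continuous_on)
    show "\<bar>f' (crep \<gamma> x) * crep u x\<bar> \<le> M * (2 * norm u)" for x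
      unfolding abs_mult by (intro mult_mono f'_bound \<gamma> crep_bound M0) auto
  qed
  then show "square_integrable (\<lambda>x. f' (crep \<gamma> x) * wder \<gamma> x * crep u x)" by (simp add: mult_ac)
  show "primitive (\<lambda>x. f (crep \<gamma> x) * crep u x)
     (\<lambda>x. f (crep \<gamma> x) * wder u x + f' (crep \<gamma> x) * wder \<gamma> x * crep u x)"
    by (intro primitive_mult crep_primitive primitive_chain[OF crep_primitive I, where P = f and P' = f'] \<gamma> f_deriv f'_cont)
qed

definition op :: "H1 \<Rightarrow> H1 \<Rightarrow> H1" where
  "op \<gamma> u = abs_H1 (\<lambda>x. f (crep \<gamma> x) * crep u x)"

text \<open>The product and its derivative are telescoped into terms with one difference each; in
  every term one factor is taken in L^2 and the others uniformly. What matters later is only that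
  the bound vanishes as both differences do.\<close>

lemma op_diff:
  assumes \<gamma>: "\<And>x. crep \<gamma> x \<in> I" and \<gamma>': "\<And>x. crep \<gamma>' x \<in> I"
  shows "norm (op \<gamma> u - op \<gamma>' v) \<le>
      (M * norm (u - v) + (2 * M * norm (\<gamma> - \<gamma>')) * norm v)
    + (M * norm (u - v) + (2 * M * norm (\<gamma> - \<gamma>')) * norm v + (M * (2 * norm u)) * norm (\<gamma> - \<gamma>')
      + (2 * M * norm (\<gamma> - \<gamma>') * (2 * norm u)) * norm \<gamma>' + (M * (2 * norm (u - v))) * norm \<gamma>')"
proof -
  note c = compose_cont[OF \<gamma>] compose_cont[OF \<gamma>']
  let ?g = "crep \<gamma>" and ?g' = "crep \<gamma>'"
  have g: "\<bar>?g x - ?g' x\<bar> \<le> 2 * norm (\<gamma> - \<gamma>')" for x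
    using crep_bound[of "\<gamma> - \<gamma>'" x] by (simp add: crep_diff)
  have fd: "\<bar>f (?g x) - f (?g' x)\<bar> \<le> 2 * M * norm (\<gamma> - \<gamma>')" for x
    using f_Lip[OF \<gamma> \<gamma>', of x x] mult_left_mono[OF g[of x] M0] by (simp add: mult_ac)
  have fd': "\<bar>f' (?g x) - f' (?g' x)\<bar> \<le> 2 * M * norm (\<gamma> - \<gamma>')" for x
    using f'_Lip[OF \<gamma> \<gamma>', of x x] mult_left_mono[OF g[of x] M0] by (simp add: mult_ac)
  note suv = square_integrable_diff[OF crep_square_integrable[of u] crep_square_integrable[of v]]
    square_integrable_diff[OF wder_square_integrable[of u] wder_square_integrable[of v]]
    square_integrable_diff[OF wder_square_integrable[of \<gamma>] wder_square_integrable[of \<gamma>']]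
  have luv: "l2 (\<lambda>x. crep u x - crep v x) \<le> norm (u - v)" "l2 (\<lambda>x. wder u x - wder v x) \<le> norm (u - v)"
    "l2 (\<lambda>x. wder \<gamma> x - wder \<gamma>' x) \<le> norm (\<gamma> - \<gamma>')"
    unfolding l2_crep_diff l2_wder_diff by (rule l2_crep_le l2_wder_le)+
  have T: "square_integrable (\<lambda>x. F x * w x) \<and> l2 (\<lambda>x. F x * w x) \<le> K * N"
    if "continuous_on UNIV F" "\<And>x. \<bar>F x\<bar> \<le> K" "square_integrable w" "l2 w \<le> N" for F w K N
  proof -
    have "K \<ge> 0" using that(2)[of 0] by linarith
    then show ?thesis using l2_mult_le[OF that(1,2,3)] mult_left_mono[OF that(4)] by (meson order_trans)
  qed
  have t1: "square_integrable (\<lambda>x. f (?g x) * (crep u x - crep v x)) \<and>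
      l2 (\<lambda>x. f (?g x) * (crep u x - crep v x)) \<le> M * norm (u - v)"
    by (intro T c suv luv f_bound \<gamma>)
  have t2: "square_integrable (\<lambda>x. (f (?g x) - f (?g' x)) * crep v x) \<and>
      l2 (\<lambda>x. (f (?g x) - f (?g' x)) * crep v x) \<le> (2 * M * norm (\<gamma> - \<gamma>')) * norm v"
    by (intro T continuous_intros c fd crep_square_integrable l2_crep_le)
  have s1: "square_integrable (\<lambda>x. f (?g x) * (wder u x - wder v x)) \<and>
      l2 (\<lambda>x. f (?g x) * (wder u x - wder v x)) \<le> M * norm (u - v)"
    by (intro T c suv luv f_bound \<gamma>)
  have s2: "square_integrable (\<lambda>x. (f (?g x) - f (?g' x)) * wder v x) \<and>
      l2 (\<lambda>x. (f (?g x) - f (?g' x)) * wder v x) \<le> (2 * M * norm (\<gamma> - \<gamma>')) * norm v"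
    by (intro T continuous_intros c fd wder_square_integrable l2_wder_le)
  have s3: "square_integrable (\<lambda>x. (f' (?g x) * crep u x) * (wder \<gamma> x - wder \<gamma>' x)) \<and>
      l2 (\<lambda>x. (f' (?g x) * crep u x) * (wder \<gamma> x - wder \<gamma>' x)) \<le> (M * (2 * norm u)) * norm (\<gamma> - \<gamma>')"
    by (intro T continuous_intros c crep_continuous_on suv luv)
      (unfold abs_mult, intro mult_mono f'_bound \<gamma> crep_bound M0, simp)
  have s4: "square_integrable (\<lambda>x. ((f' (?g x) - f' (?g' x)) * crep u x) * wder \<gamma>' x) \<and>
      l2 (\<lambda>x. ((f' (?g x) - f' (?g' x)) * crep u x) * wder \<gamma>' x) \<le> (2 * M * norm (\<gamma> - \<gamma>') * (2 * norm u)) * norm \<gamma>'"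
    by (intro T continuous_intros c crep_continuous_on wder_square_integrable l2_wder_le)
      (unfold abs_mult, intro mult_mono fd' crep_bound, use M0 in auto)
  have s5: "square_integrable (\<lambda>x. (f' (?g' x) * (crep u x - crep v x)) * wder \<gamma>' x) \<and>
      l2 (\<lambda>x. (f' (?g' x) * (crep u x - crep v x)) * wder \<gamma>' x) \<le> (M * (2 * norm (u - v))) * norm \<gamma>'"
    by (intro T continuous_intros c crep_continuous_on wder_square_integrable l2_wder_le)
      (unfold abs_mult crep_diff[symmetric], intro mult_mono f'_bound \<gamma>' crep_bound M0, simp)
  have add: "square_integrable (\<lambda>x. F x + F' x) \<and> l2 (\<lambda>x. F x + F' x) \<le> K + K'"
    if "square_integrable F \<and> l2 F \<le> K" "square_integrable F' \<and> l2 F' \<le> K'" for F F' K K'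
    using that l2_triangle[of F F'] square_integrable_add[of F F'] by auto
  have X: "f (?g x) * crep u x - f (?g' x) * crep v x
      = f (?g x) * (crep u x - crep v x) + (f (?g x) - f (?g' x)) * crep v x" for x
    by (simp add: algebra_simps)
  have Y: "(f (?g x) * wder u x + f' (?g x) * wder \<gamma> x * crep u x) - (f (?g' x) * wder v x + f' (?g' x) * wder \<gamma>' x * crep v x)
      = f (?g x) * (wder u x - wder v x) + (f (?g x) - f (?g' x)) * wder v x
        + (f' (?g x) * crep u x) * (wder \<gamma> x - wder \<gamma>' x) + ((f' (?g x) - f' (?g' x)) * crep u x) * wder \<gamma>' x
        + (f' (?g' x) * (crep u x - crep v x)) * wder \<gamma>' x" for x
    by (simp add: algebra_simps)
  show ?thesis
    unfolding op_def
    by (rule order_trans[OF norm_abs_diff[OF pair[OF \<gamma>] pair[OF \<gamma>']]])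
      (unfold X Y, intro add_mono conjunct2[OF add[OF t1 t2]]
        conjunct2[OF add[OF add[OF add[OF add[OF s1 s2] s3] s4] s5]])
qed

lemma op_continuous:
  assumes \<gamma>: "continuous_on T \<gamma>" "\<And>t x. t \<in> T \<Longrightarrow> crep (\<gamma> t) x \<in> I" and u: "continuous_on T u"
  shows "continuous_on T (\<lambda>t. op (\<gamma> t) (u t))"
  unfolding continuous_on_def
proof
  fix t assume t: "t \<in> T"
  have lg: "(\<gamma> \<longlongrightarrow> \<gamma> t) (at t within T)" and lu: "(u \<longlongrightarrow> u t) (at t within T)"
    using \<gamma>(1) u t by (auto simp: continuous_on_def)
  define e where "e s = (M * norm (u s - u t) + (2 * M * norm (\<gamma> s - \<gamma> t)) * norm (u t))
      + (M * norm (u s - u t) + (2 * M * norm (\<gamma> s - \<gamma> t)) * norm (u t) + (M * (2 * norm (u s))) * norm (\<gamma> s - \<gamma> t)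
      + (2 * M * norm (\<gamma> s - \<gamma> t) * (2 * norm (u s))) * norm (\<gamma> t) + (M * (2 * norm (u s - u t))) * norm (\<gamma> t))" for s
  have "((\<lambda>s. op (\<gamma> s) (u s) - op (\<gamma> t) (u t)) \<longlongrightarrow> 0) (at t within T)"
  proof (rule Lim_null_comparison)
    show "\<forall>\<^sub>F s in at t within T. norm (op (\<gamma> s) (u s) - op (\<gamma> t) (u t)) \<le> e s"
      unfolding eventually_at_filter e_def by (intro always_eventually allI impI op_diff \<gamma>(2) t)
    have "(e \<longlongrightarrow> e t) (at t within T)"
      unfolding e_def by (intro tendsto_intros lg lu)
    then show "(e \<longlongrightarrow> 0) (at t within T)" by (simp add: e_def)
  qed
  then show "((\<lambda>t. op (\<gamma> t) (u t)) \<longlongrightarrow> op (\<gamma> t) (u t)) (at t within T)"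
    by (rule LIM_zero_cancel)
qed

end

section \<open>The change of variables\<close>

text \<open>\<open>Gdom m\<close> is the range of \<open>G m\<close> on the positive reals; elsewhere \<open>Ginv m\<close> has junk values.\<close>

definition G :: "real \<Rightarrow> real \<Rightarrow> real" where
  "G m x = (if m = 1 then ln x else (x powr (1 - m) - 1) / (1 - m))"

definition Ginv :: "real \<Rightarrow> real \<Rightarrow> real" where
  "Ginv m y = (if m = 1 then exp y else (1 + (1 - m) * y) powr (1 / (1 - m)))"

definition Gdom :: "real \<Rightarrow> real set" where
  "Gdom m = (if m = 1 then UNIV else {y. 1 + (1 - m) * y > 0})"

lemma G_1: "G m 1 = 0"
  by (simp add: G_def)

lemma G_deriv:
  assumes "x > 0" shows "(G m has_real_derivative x powr (- m)) (at x)"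
proof (cases "m = 1")
  case True
  then have "G m = ln" by (simp add: G_def fun_eq_iff)
  then show ?thesis
    using assms True DERIV_ln_divide[of x] by (simp add: powr_minus divide_inverse)
next
  case False
  have "((\<lambda>x. (x powr (1 - m) - 1) / (1 - m)) has_real_derivative (1 - m) * x powr (1 - m - 1) / (1 - m)) (at x)"
    using assms by (auto intro!: derivative_eq_intros has_real_derivative_powr)
  moreover have "(1 - m) * x powr (1 - m - 1) / (1 - m) = x powr (- m)" using False by simp
  moreover have "G m = (\<lambda>x. (x powr (1 - m) - 1) / (1 - m))" using False by (simp add: G_def fun_eq_iff)
  ultimately show ?thesis by simp
qed

lemma G_in_Gdom: "x > 0 \<Longrightarrow> G m x \<in> Gdom m"
  by (simp add: G_def Gdom_def)

lemma Ginv_G: "x > 0 \<Longrightarrow> Ginv m (G m x) = x"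
  by (simp add: G_def Ginv_def powr_powr)

lemma G_Ginv: "y \<in> Gdom m \<Longrightarrow> G m (Ginv m y) = y"
  by (simp add: G_def Ginv_def Gdom_def powr_powr split: if_splits)

lemma Ginv_pos: "y \<in> Gdom m \<Longrightarrow> Ginv m y > 0"
  by (simp add: Ginv_def Gdom_def split: if_splits)

lemma Ginv_deriv:
  assumes "y \<in> Gdom m" shows "(Ginv m has_real_derivative Ginv m y powr m) (at y)"
proof (cases "m = 1")
  case True
  then have "Ginv m = exp" by (simp add: Ginv_def fun_eq_iff)
  then show ?thesis using True DERIV_exp[of y] by simp
next
  case False
  have pos: "1 + (1 - m) * y > 0" using assms False by (simp add: Gdom_def)
  have "((\<lambda>y. (1 + (1 - m) * y) powr (1 / (1 - m))) has_real_derivative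
      (1 / (1 - m)) * (1 + (1 - m) * y) powr (1 / (1 - m) - 1) * (1 - m)) (at y)"
    by (rule DERIV_chain2[where f = "\<lambda>z. z powr (1 / (1 - m))" and g = "\<lambda>y. 1 + (1 - m) * y",
          OF has_real_derivative_powr[OF pos]]) (auto intro!: derivative_eq_intros)
  moreover have "(1 / (1 - m)) * (1 + (1 - m) * y) powr (1 / (1 - m) - 1) * (1 - m) = Ginv m y powr m"
    using False by (simp add: Ginv_def powr_powr field_simps)
  moreover have "Ginv m = (\<lambda>y. (1 + (1 - m) * y) powr (1 / (1 - m)))" using False by (simp add: Ginv_def fun_eq_iff)
  ultimately show ?thesis by simp
qed

text \<open>\<open>Gdom m\<close> is a half-line or the whole line; the sign of 1 - m decides which
  endpoint controls positivity.\<close>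

lemma Gdom_convex:
  assumes "\<alpha> \<in> Gdom m" "\<beta> \<in> Gdom m" "\<alpha> \<le> y" "y \<le> \<beta>"
  shows "y \<in> Gdom m"
proof (cases "m < 1")
  case True
  then have "(1 - m) * \<alpha> \<le> (1 - m) * y" using assms by (intro mult_left_mono) auto
  then show ?thesis using assms by (simp add: Gdom_def split: if_splits)
next
  case False
  then have "(1 - m) * \<beta> \<le> (1 - m) * y" using assms by (intro mult_left_mono_neg) auto
  then show ?thesis using assms by (simp add: Gdom_def split: if_splits)
qed

lemma G_strict_mono:
  assumes "0 < x" "x < y" shows "G m x < G m y"
  by (rule DERIV_pos_imp_increasing[OF assms(2)]) (use assms G_deriv in \<open>metis less_le_trans powr_gt_zero less_irrefl\<close>)

lemma G_mono: "0 < x \<Longrightarrow> x \<le> y \<Longrightarrow> G m x \<le> G m y"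
  using G_strict_mono by (cases "x = y") (auto simp: less_imp_le)

lemma Ginv_between:
  assumes "0 < a" "a \<le> b" "G m a \<le> y" "y \<le> G m b"
  shows "a \<le> Ginv m y" "Ginv m y \<le> b"
proof -
  have y: "y \<in> Gdom m"
    using Gdom_convex[OF G_in_Gdom G_in_Gdom assms(3,4)] assms(1,2) by simp
  note pos = Ginv_pos[OF y] and inv = G_Ginv[OF y]
  show "a \<le> Ginv m y"
    using G_strict_mono[OF pos, of a m] inv assms by linarith
  show "Ginv m y \<le> b"
    using G_strict_mono[of b "Ginv m y" m] inv assms by linarith
qed

section \<open>The truncated magma equation\<close>

text \<open>The sign of the exponent is left open, so the power may be increasing or
  decreasing.\<close>

lemma powr_between:
  fixes a b x e :: real
  assumes "0 < a" "a \<le> x" "x \<le> b"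
  shows "min (a powr e) (b powr e) \<le> x powr e" "x powr e \<le> max (a powr e) (b powr e)"
proof -
  have "(a powr e \<le> x powr e \<and> x powr e \<le> b powr e) \<or> (b powr e \<le> x powr e \<and> x powr e \<le> a powr e)"
    using assms powr_mono2[of e a x] powr_mono2[of e x b] powr_mono2'[of e a x] powr_mono2'[of e x b]
    by (cases "e \<ge> 0") auto
  then show "min (a powr e) (b powr e) \<le> x powr e" "x powr e \<le> max (a powr e) (b powr e)" by auto
qed

lemma LINT_cong_lebesgue:
  fixes f g :: "real \<Rightarrow> real"
  assumes "AE x in lebesgue. g x = f x" "integrable lebesgue g"
  shows "integrable lebesgue f" "(LINT x|lebesgue. f x) = (LINT x|lebesgue. g x)"
proof -
  have m: "f \<in> borel_measurable lebesgue"
    by (rule borel_measurable_AE[OF borel_measurable_integrable[OF assms(2)] assms(1)])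
  show "integrable lebesgue f"
    by (rule integrable_cong_AE_imp[OF assms(2) m assms(1)])
  show "(LINT x|lebesgue. f x) = (LINT x|lebesgue. g x)"
    using assms m by (intro integral_cong_AE) (auto elim: eventually_mono)
qed

locale magma_truncation =
  fixes n m a b :: real
  assumes ab: "0 < a" "a < 1" "1 < b"
begin

definition J :: "real set" where "J = {G m a..G m b}"

text \<open>The clamp acts before \<open>G m\<close> is inverted, so the argument of
  \<open>Ginv m\<close> stays in its domain and the coefficients built from it are bounded and
  Lipschitz on the whole line.\<close>

definition \<Gamma> :: "real \<Rightarrow> real" where "\<Gamma> y = Ginv m (max (G m a) (min (G m b) y))"

definition p :: "real \<Rightarrow> real" where "p y = \<Gamma> y powr n"

definition q :: "real \<Rightarrow> real" where "q y = \<Gamma> y powr m"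

lemma G_ab: "G m a < 0" "0 < G m b"
  using G_strict_mono[of a 1 m] G_strict_mono[of 1 b m] ab by (auto simp: G_1)

lemma J_Gdom: "y \<in> J \<Longrightarrow> y \<in> Gdom m"
  unfolding J_def using Gdom_convex[OF G_in_Gdom[of a m] G_in_Gdom[of b m]] ab by auto

lemma J_convex: "convex J"
  by (simp add: J_def)

lemma clamp_J: "max (G m a) (min (G m b) y) \<in> J"
  using G_ab by (auto simp: J_def)

lemma Ginv_J: "y \<in> J \<Longrightarrow> a \<le> Ginv m y" "y \<in> J \<Longrightarrow> Ginv m y \<le> b"
  unfolding J_def using Ginv_between[of a b m y] ab by auto

lemma \<Gamma>_between: "a \<le> \<Gamma> y" "\<Gamma> y \<le> b"
  unfolding \<Gamma>_def by (rule Ginv_J[OF clamp_J])+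

lemma \<Gamma>_J: "y \<in> J \<Longrightarrow> \<Gamma> y = Ginv m y"
  by (auto simp: \<Gamma>_def J_def max_absorb2 min_absorb2)

lemma G_J: "a \<le> x \<Longrightarrow> x \<le> b \<Longrightarrow> G m x \<in> J"
  unfolding J_def using ab by (auto intro!: G_mono)

lemma \<Gamma>_G: "a \<le> x \<Longrightarrow> x \<le> b \<Longrightarrow> \<Gamma> (G m x) = x"
  using G_J \<Gamma>_J Ginv_G ab by simp

lemma Ginv_powr_deriv:
  assumes "y \<in> J"
  shows "((\<lambda>y. Ginv m y powr e) has_real_derivative e * Ginv m y powr (e - 1 + m)) (at y within J)"
proof -
  have pos: "Ginv m y > 0" using Ginv_pos[OF J_Gdom[OF assms]] .
  have "((\<lambda>y. Ginv m y powr e) has_real_derivative e * Ginv m y powr (e - 1) * Ginv m y powr m) (at y)"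
    by (rule DERIV_chain2[where f = "\<lambda>z. z powr e" and g = "Ginv m", OF has_real_derivative_powr[OF pos] Ginv_deriv[OF J_Gdom[OF assms]]])
  then show ?thesis
    using pos by (simp add: powr_add mult.assoc has_field_derivative_at_within)
qed

text \<open>The derivative of \<open>Ginv m\<close> is its own m-th power, so differentiating a
  power of it gives a multiple of another power; all bounds reduce to bounds of powers on
  [a, b].\<close>

lemma superposition_powr:
  "\<exists>K. superposition J (\<lambda>y. Ginv m y powr e) (\<lambda>y. e * Ginv m y powr (e - 1 + m)) K"
proof -
  define C where "C r = max (a powr r) (b powr r)" for r
  have C: "\<bar>Ginv m y powr r\<bar> \<le> C r" if "y \<in> J" for y r
    using powr_between(2)[OF ab(1) Ginv_J[OF that]] by (simp add: C_def)
  have C0: "C r \<ge> 0" for r by (simp add: C_def max_def)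
  define e1 where "e1 = e - 1 + m"
  define K where "K = C e + \<bar>e\<bar> * C e1 + \<bar>e\<bar> * (\<bar>e1\<bar> * C (e1 - 1 + m))"
  have nn: "0 \<le> C e" "0 \<le> \<bar>e\<bar> * C e1" "0 \<le> \<bar>e\<bar> * (\<bar>e1\<bar> * C (e1 - 1 + m))"
    using C0 by auto
  have b1: "\<bar>e * Ginv m y powr e1\<bar> \<le> \<bar>e\<bar> * C e1" if "y \<in> J" for y
    using mult_left_mono[OF C[OF that, of e1], of "\<bar>e\<bar>"] by (simp add: abs_mult)
  have "superposition J (\<lambda>y. Ginv m y powr e) (\<lambda>y. e * Ginv m y powr e1) K"
  proof
    show "((\<lambda>y. Ginv m y powr e) has_real_derivative e * Ginv m x powr e1) (at x within J)" if "x \<in> J" for x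
      unfolding e1_def by (rule Ginv_powr_deriv[OF that])
    show "\<bar>Ginv m x powr e\<bar> \<le> K" "\<bar>e * Ginv m x powr e1\<bar> \<le> K" if "x \<in> J" for x
      using C[OF that, of e] b1[OF that] nn by (auto simp: K_def)
    fix x y assume xy: "x \<in> J" "y \<in> J"
    have "norm (Ginv m x powr e1 - Ginv m y powr e1) \<le> (\<bar>e1\<bar> * C (e1 - 1 + m)) * norm (x - y)"
    proof (rule field_differentiable_bound[OF J_convex Ginv_powr_deriv _ xy])
      show "norm (e1 * Ginv m z powr (e1 - 1 + m)) \<le> \<bar>e1\<bar> * C (e1 - 1 + m)" if "z \<in> J" for z
        using mult_left_mono[OF C[OF that, of "e1 - 1 + m"], of "\<bar>e1\<bar>"] by (simp add: abs_mult)
    qed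
    then have "\<bar>e\<bar> * \<bar>Ginv m x powr e1 - Ginv m y powr e1\<bar> \<le> \<bar>e\<bar> * ((\<bar>e1\<bar> * C (e1 - 1 + m)) * \<bar>x - y\<bar>)"
      by (intro mult_left_mono) auto
    also have "\<dots> = \<bar>e\<bar> * (\<bar>e1\<bar> * C (e1 - 1 + m)) * \<bar>x - y\<bar>" by simp
    also have "\<dots> \<le> K * \<bar>x - y\<bar>" using nn by (intro mult_right_mono) (auto simp: K_def)
    finally show "\<bar>e * Ginv m x powr e1 - e * Ginv m y powr e1\<bar> \<le> K * \<bar>x - y\<bar>"
      by (simp add: right_diff_distrib[symmetric] abs_mult)
  qed (use nn J_convex in \<open>auto simp: K_def\<close>)
  then show ?thesis unfolding e1_def by blast
qed

lemma \<Gamma>_powr_Lip: "\<exists>\<Lambda>\<ge>0. \<forall>x y. \<bar>\<Gamma> x powr e - \<Gamma> y powr e\<bar> \<le> \<Lambda> * \<bar>x - y\<bar>"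
proof -
  obtain K where K: "superposition J (\<lambda>y. Ginv m y powr e) (\<lambda>y. e * Ginv m y powr (e - 1 + m)) K"
    using superposition_powr by blast
  interpret superposition J "\<lambda>y. Ginv m y powr e" "\<lambda>y. e * Ginv m y powr (e - 1 + m)" K by (rule K)
  have "\<bar>\<Gamma> x powr e - \<Gamma> y powr e\<bar> \<le> K * \<bar>x - y\<bar>" for x y
  proof -
    have "\<bar>\<Gamma> x powr e - \<Gamma> y powr e\<bar> \<le> K * \<bar>max (G m a) (min (G m b) x) - max (G m a) (min (G m b) y)\<bar>"
      unfolding \<Gamma>_def by (rule f_Lip[OF clamp_J clamp_J])
    also have "\<dots> \<le> K * \<bar>x - y\<bar>" using M0 by (intro mult_left_mono) auto
    finally show ?thesis .
  qed
  then show ?thesis using M0 by blast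
qed

lemma ex_coefficients: "\<exists>\<Lambda> c M. bounded_coefficients p q \<Lambda> c M"
proof -
  obtain \<Lambda>1 where L1: "\<Lambda>1 \<ge> 0" "\<And>x y. \<bar>p x - p y\<bar> \<le> \<Lambda>1 * \<bar>x - y\<bar>"
    unfolding p_def using \<Gamma>_powr_Lip[of n] by blast
  obtain \<Lambda>2 where L2: "\<Lambda>2 \<ge> 0" "\<And>x y. \<bar>q x - q y\<bar> \<le> \<Lambda>2 * \<bar>x - y\<bar>"
    unfolding q_def using \<Gamma>_powr_Lip[of m] by blast
  define \<Lambda> where "\<Lambda> = \<Lambda>1 + \<Lambda>2 + 1"
  define c where "c = min (min (a powr n) (b powr n)) (min (a powr m) (b powr m))"
  define M where "M = max (max (a powr n) (b powr n)) (max (a powr m) (b powr m))"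
  have "bounded_coefficients p q \<Lambda> c M"
  proof
    show "p 0 = 1" using \<Gamma>_G[of 1] ab by (simp add: p_def G_1)
    show "c > 0" using ab by (simp add: c_def)
    show "\<Lambda> > 0" using L1 L2 by (simp add: \<Lambda>_def)
    show "\<bar>p x - p y\<bar> \<le> \<Lambda> * \<bar>x - y\<bar>" for x y
      using L1(2)[of x y] mult_right_mono[of \<Lambda>1 \<Lambda> "\<bar>x - y\<bar>"] L1(1) L2(1) by (simp add: \<Lambda>_def)
    show "\<bar>q x - q y\<bar> \<le> \<Lambda> * \<bar>x - y\<bar>" for x y
      using L2(2)[of x y] mult_right_mono[of \<Lambda>2 \<Lambda> "\<bar>x - y\<bar>"] L1(1) L2(1) by (simp add: \<Lambda>_def)
    show "c \<le> p x" "p x \<le> M" for x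
      using powr_between[OF ab(1) \<Gamma>_between(1)[of x] \<Gamma>_between(2)[of x], of n] by (auto simp: p_def c_def M_def)
    show "c \<le> q x" "q x \<le> M" for x
      using powr_between[OF ab(1) \<Gamma>_between(1)[of x] \<Gamma>_between(2)[of x], of m] by (auto simp: q_def c_def M_def)
  qed
  then show ?thesis by blast
qed

text \<open>\<open>ex_coefficients\<close> only gives existence; naming the constants by choice
  allows the locale \<open>bounded_coefficients\<close> to be instantiated.\<close>

definition coeff_consts :: "real \<times> real \<times> real" where
  "coeff_consts = (SOME (\<Lambda>, c, M). bounded_coefficients p q \<Lambda> c M)"

sublocale coeff: bounded_coefficients p q "fst coeff_consts" "fst (snd coeff_consts)" "snd (snd coeff_consts)"
proof -
  have "\<exists>x. (\<lambda>(\<Lambda>, c, M). bounded_coefficients p q \<Lambda> c M) x"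
    using ex_coefficients by auto
  from someI_ex[OF this]
  have "(\<lambda>(\<Lambda>, c, M). bounded_coefficients p q \<Lambda> c M) coeff_consts"
    unfolding coeff_consts_def .
  then show "bounded_coefficients p q (fst coeff_consts) (fst (snd coeff_consts)) (snd (snd coeff_consts))"
    by (simp only: case_prod_beta)
qed

text \<open>Testing with smooth functions determines \<open>u\<close>: the equation says that the flux
  \<open>\<phi>\<^sup>n u\<^sub>z - (\<phi>\<^sup>n - 1)\<close> has the weak derivative \<open>\<phi>\<^sup>m u\<close>, so it is in \<open>H\<^sup>1\<close> and may be
  integrated by parts against every function in \<open>H\<^sup>1\<close>.\<close>

lemma weak_solution_iff:
  assumes \<phi>: "AE z in lebesgue. \<phi> z = \<Gamma> (crep \<gamma> z)"
  shows "weak_solution n m \<phi> v \<longleftrightarrow> in_H1 v \<and> abs_H1 v = coeff.S \<gamma>"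
proof (cases "in_H1 v")
  case v: True
  define u where "u = abs_H1 v"
  have vu: "AE z in lebesgue. v z = crep u z"
    using crep_abs_AE[OF v] unfolding u_def by eventually_elim simp
  have wu: "AE z in lebesgue. weak_deriv v z = wder u z"
    using wder_abs_AE[OF v] unfolding u_def by eventually_elim simp
  define F where "F z = p (crep \<gamma> z) * wder u z - (p (crep \<gamma> z) - 1)" for z
  define H where "H z = q (crep \<gamma> z) * crep u z" for z
  note s1 = square_integrable_bounded_mult(1)[OF wder_square_integrable[of u] coeff.coeff_measurable(1)[of \<gamma>] coeff.coeff_abs(1)]
  note s2 = coeff.p_minus_1_square_integrable(1)[of \<gamma>]
  have sF: "square_integrable F" unfolding F_def by (rule square_integrable_diff[OF s1 s2])
  have sH: "square_integrable H"
    unfolding H_def by (rule square_integrable_bounded_mult(1)[OF crep_square_integrable[of u] coeff.coeff_measurable(2)[of \<gamma>] coeff.coeff_abs(2)])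
  have split: "(LINT z|lebesgue. F z * w z) = (LINT z|lebesgue. p (crep \<gamma> z) * wder u z * w z) - (LINT z|lebesgue. (p (crep \<gamma> z) - 1) * w z)"
    if "square_integrable w" for w
    unfolding F_def using square_integrable_mult[OF s1 that] square_integrable_mult[OF s2 that]
    by (simp add: left_diff_distrib)
  have test: "integrable lebesgue (\<lambda>z. \<phi> z powr n * weak_deriv v z * deriv \<eta> z) \<and>
        integrable lebesgue (\<lambda>z. \<phi> z powr m * v z * \<eta> z) \<and>
        integrable lebesgue (\<lambda>z. \<phi> z powr n * deriv \<eta> z) \<and>
        (LINT z|lebesgue. \<phi> z powr n * weak_deriv v z * deriv \<eta> z) = (LINT z|lebesgue. p (crep \<gamma> z) * wder u z * deriv \<eta> z) \<and>
        (LINT z|lebesgue. \<phi> z powr m * v z * \<eta> z) = (LINT z|lebesgue. H z * \<eta> z) \<and>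
        (LINT z|lebesgue. \<phi> z powr n * deriv \<eta> z) = (LINT z|lebesgue. (p (crep \<gamma> z) - 1) * deriv \<eta> z)"
    if \<eta>: "test_fun \<eta>" for \<eta>
  proof -
    note t = square_integrable_test_fun[OF \<eta>] square_integrable_test_fun[OF test_fun_deriv[OF \<eta>]]
    note ti = continuous_mult_test_fun(2)[OF continuous_on_const[of _ 1] \<eta>]
      continuous_mult_test_fun(2)[OF continuous_on_const[of _ 1] test_fun_deriv[OF \<eta>]]
    have 1: "AE z in lebesgue. p (crep \<gamma> z) * wder u z * deriv \<eta> z = \<phi> z powr n * weak_deriv v z * deriv \<eta> z"
      using \<phi> wu by eventually_elim (simp add: p_def)
    have 2: "AE z in lebesgue. H z * \<eta> z = \<phi> z powr m * v z * \<eta> z"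
      using \<phi> vu by eventually_elim (simp add: q_def H_def)
    have 3: "AE z in lebesgue. (p (crep \<gamma> z) - 1) * deriv \<eta> z + deriv \<eta> z = \<phi> z powr n * deriv \<eta> z"
      using \<phi> by eventually_elim (simp add: p_def left_diff_distrib)
    note i = square_integrable_mult[OF s1 t(2)] square_integrable_mult[OF sH t(1)] square_integrable_mult[OF s2 t(2)]
    have i3: "integrable lebesgue (\<lambda>z. (p (crep \<gamma> z) - 1) * deriv \<eta> z + deriv \<eta> z)"
      using i(3) ti(2) by simp
    \<comment> \<open>This is why \<phi>^n and \<phi>^n - 1 give the same right-hand side.\<close>
    have "(LINT z|lebesgue. deriv \<eta> z) = 0"
      using ti by (intro primitive_decay(3)[OF H1_pairD(3)[OF H1_pair_test_fun[OF \<eta>]]]) auto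
    then have "(LINT z|lebesgue. (p (crep \<gamma> z) - 1) * deriv \<eta> z + deriv \<eta> z) = (LINT z|lebesgue. (p (crep \<gamma> z) - 1) * deriv \<eta> z)"
      using i(3) ti(2) by simp
    then show ?thesis
      using LINT_cong_lebesgue[OF 1 i(1)] LINT_cong_lebesgue[OF 2 i(2)] LINT_cong_lebesgue[OF 3 i3] by simp
  qed
  define X where "X \<eta> \<longleftrightarrow> integrable lebesgue (\<lambda>z. \<phi> z powr n * weak_deriv v z * deriv \<eta> z) \<and>
        integrable lebesgue (\<lambda>z. \<phi> z powr m * v z * \<eta> z) \<and>
        integrable lebesgue (\<lambda>z. \<phi> z powr n * deriv \<eta> z) \<and>
        (LINT z|lebesgue. \<phi> z powr n * weak_deriv v z * deriv \<eta> z) + (LINT z|lebesgue. \<phi> z powr m * v z * \<eta> z)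
        = (LINT z|lebesgue. \<phi> z powr n * deriv \<eta> z)" for \<eta>
  have "X \<eta> \<longleftrightarrow> (LINT z|lebesgue. F z * deriv \<eta> z) = - (LINT z|lebesgue. H z * \<eta> z)" if "test_fun \<eta>" for \<eta>
    using test[OF that] split[OF square_integrable_test_fun[OF test_fun_deriv[OF that]]]
    unfolding X_def by (elim conjE) (simp only: simp_thms, rule iffI; linarith)
  then have "weak_solution n m \<phi> v \<longleftrightarrow> has_weak_deriv F H"
    using v unfolding weak_solution_def has_weak_deriv_def X_def[symmetric] by auto
  also have "\<dots> \<longleftrightarrow> (\<forall>w. coeff.B \<gamma> u w = coeff.rhs \<gamma> w)"
  proof
    assume wd: "has_weak_deriv F H"
    have F1: "in_H1 F" by (rule in_H1I[OF sF sH wd])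
    obtain f where f: "H1_pair f (weak_deriv F)" "AE z in lebesgue. F z = f z"
      using in_H1_pair[OF F1] by blast
    have FH: "AE z in lebesgue. weak_deriv F z = H z"
      by (rule weak_deriv_eqI[OF F1 sH wd])
    show "\<forall>w. coeff.B \<gamma> u w = coeff.rhs \<gamma> w"
    proof
      fix w
      have "AE z in lebesgue. F z * wder w z = f z * wder w z"
        using f(2) by eventually_elim simp
      from LINT_cong_lebesgue(2)[OF this square_integrable_mult[OF sF wder_square_integrable]]
      have "(LINT z|lebesgue. F z * wder w z) = (LINT z|lebesgue. f z * wder w z)" by simp
      also have "\<dots> = - (LINT z|lebesgue. weak_deriv F z * crep w z)"
        by (rule H1_pair_by_parts[OF f(1) crep_pair(1)])
      also have "(LINT z|lebesgue. weak_deriv F z * crep w z) = (LINT z|lebesgue. H z * crep w z)"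
      proof -
        have "AE z in lebesgue. H z * crep w z = weak_deriv F z * crep w z"
          using FH by eventually_elim simp
        from LINT_cong_lebesgue(2)[OF this square_integrable_mult[OF sH crep_square_integrable]]
        show ?thesis .
      qed
      finally show "coeff.B \<gamma> u w = coeff.rhs \<gamma> w"
        using split[OF wder_square_integrable] by (simp add: coeff.B_def coeff.rhs_def H_def)
    qed
  next
    assume B: "\<forall>w. coeff.B \<gamma> u w = coeff.rhs \<gamma> w"
    show "has_weak_deriv F H"
      unfolding has_weak_deriv_def
    proof (intro allI impI)
      fix \<eta> assume \<eta>: "test_fun \<eta>"
      define w where "w = abs_H1 \<eta>"
      note t = square_integrable_test_fun[OF test_fun_deriv[OF \<eta>]]
      have cw: "crep w = \<eta>" and ww: "AE z in lebesgue. wder w z = deriv \<eta> z"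
        unfolding w_def using crep_abs[OF H1_pair_test_fun[OF \<eta>]] by auto
      have "AE z in lebesgue. F z * wder w z = F z * deriv \<eta> z"
        using ww by eventually_elim simp
      from LINT_cong_lebesgue(2)[OF this square_integrable_mult[OF sF wder_square_integrable]]
      have "(LINT z|lebesgue. F z * deriv \<eta> z) = (LINT z|lebesgue. F z * wder w z)" .
      also have "\<dots> = - (LINT z|lebesgue. H z * crep w z)"
        using split[OF wder_square_integrable, of w] B[rule_format, of w]
        by (simp add: coeff.B_def coeff.rhs_def H_def)
      finally show "(LINT z|lebesgue. F z * deriv \<eta> z) = - (LINT z|lebesgue. H z * \<eta> z)"
        by (simp add: cw)
    qed
  qed
  also have "\<dots> \<longleftrightarrow> u = coeff.S \<gamma>"
    using coeff.S_unique coeff.S_weak by blast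
  finally show ?thesis using v by (simp add: u_def)
qed (simp add: weak_solution_def)

lemma Ginv_pair:
  assumes "\<And>z. crep \<gamma> z \<in> J"
  shows "H1_pair (\<lambda>z. Ginv m (crep \<gamma> z) - 1) (\<lambda>z. Ginv m (crep \<gamma> z) powr m * wder \<gamma> z)"
proof (rule H1_pair_chain[OF crep_pair(1) J_convex assms, where M = "max (a powr m) (b powr m)"
      and P = "\<lambda>y. Ginv m y - 1" and P' = "\<lambda>y. Ginv m y powr m"])
  show "0 \<in> J" using G_ab by (simp add: J_def)
  show "((\<lambda>y. Ginv m y - 1) has_real_derivative Ginv m x powr m) (at x within J)" if "x \<in> J" for x
    using DERIV_diff[OF has_field_derivative_at_within[OF Ginv_deriv[OF J_Gdom[OF that]]] DERIV_const[of 1]] by simp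
  show "Ginv m 0 - 1 = 0" using Ginv_G[of 1 m] by (simp add: G_1)
  show "continuous_on J (\<lambda>y. Ginv m y powr m)"
    by (rule DERIV_continuous_on[OF Ginv_powr_deriv])
  show "\<bar>Ginv m x powr m\<bar> \<le> max (a powr m) (b powr m)" if "x \<in> J" for x
    using powr_between(2)[OF ab(1) Ginv_J[OF that], of m] by simp
qed

lemma one_plus_powr_bound:
  assumes "x \<in> {a - 1..b - 1}"
  shows "\<bar>(1 + x) powr - m\<bar> \<le> max (a powr - m) (b powr - m)"
  using powr_between(2)[OF ab(1), of "1 + x" b "- m"] assms by simp

lemma G_one_plus_deriv:
  assumes "x \<in> {a - 1..b - 1}"
  shows "((\<lambda>y. G m (1 + y)) has_real_derivative (1 + x) powr - m) (at x within A)"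
proof -
  have "((\<lambda>y. G m (1 + y)) has_real_derivative (1 + x) powr - m * 1) (at x)"
    by (rule DERIV_chain2[where f = "G m" and g = "\<lambda>y. 1 + y", OF G_deriv])
      (use assms ab in \<open>auto intro!: derivative_eq_intros\<close>)
  then show ?thesis by (simp add: has_field_derivative_at_within)
qed

lemma G_pair:
  assumes "\<And>z. crep w z \<in> {a - 1..b - 1}"
  shows "H1_pair (\<lambda>z. G m (1 + crep w z)) (\<lambda>z. (1 + crep w z) powr - m * wder w z)"
proof (rule H1_pair_chain[OF crep_pair(1), where I = "{a - 1..b - 1}"
      and P = "\<lambda>y. G m (1 + y)" and P' = "\<lambda>y. (1 + y) powr - m"])
  show "continuous_on {a - 1..b - 1} (\<lambda>y. (1 + y) powr - m)"
    using ab by (intro continuous_intros) auto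
qed (use assms G_one_plus_deriv one_plus_powr_bound ab in \<open>auto simp: G_1\<close>)

text \<open>By the chain rule \<phi>_t = \<phi>^m u at each point; \<open>H1_curve_integral\<close>
  lifts this to \<open>H1\<close>, and continuity of the velocity \<open>F\<close> makes the curve
  C^1. On \<open>J\<close> the truncation is invisible, so \<open>weak_solution_iff\<close> gives
  both the elliptic equation and its uniqueness.\<close>

lemma flow_solution:
  assumes \<gamma>: "\<And>t. t \<ge> 0 \<Longrightarrow> (\<gamma> has_vector_derivative coeff.S (\<gamma> t)) (at t within {0..})"
    and J: "\<And>t z. t \<ge> 0 \<Longrightarrow> crep (\<gamma> t) z \<in> J"
    and \<phi>0: "in_H1 (\<lambda>z. \<phi>0 z - 1)" "AE z in lebesgue. \<phi>0 z = Ginv m (crep (\<gamma> 0) z)"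
  shows "magma_solution n m \<phi>0 (\<lambda>t z. Ginv m (crep (\<gamma> t) z))"
proof -
  obtain K where K: "superposition J (\<lambda>y. Ginv m y powr m) (\<lambda>y. m * Ginv m y powr (m - 1 + m)) K"
    using superposition_powr by blast
  interpret sup: superposition J "\<lambda>y. Ginv m y powr m" "\<lambda>y. m * Ginv m y powr (m - 1 + m)" K by (rule K)
  define u where "u t = coeff.S (\<gamma> t)" for t
  define W where "W t = abs_H1 (\<lambda>z. Ginv m (crep (\<gamma> t) z) - 1)" for t
  define F where "F t = abs_H1 (\<lambda>z. Ginv m (crep (\<gamma> t) z) powr m * crep (u t) z)" for t
  have pF: "H1_pair (\<lambda>z. Ginv m (crep (\<gamma> t) z) powr m * crep (u t) z)
      (\<lambda>z. Ginv m (crep (\<gamma> t) z) powr m * wder (u t) z + m * Ginv m (crep (\<gamma> t) z) powr (m - 1 + m) * wder (\<gamma> t) z * crep (u t) z)"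
    if "t \<ge> 0" for t
    by (rule sup.pair[OF J[OF that]])
  have cF: "crep (F t) z = Ginv m (crep (\<gamma> t) z) powr m * crep (u t) z" if "t \<ge> 0" for t z
    unfolding F_def using crep_abs(1)[OF pF[OF that]] by simp
  have cW: "crep (W t) z = Ginv m (crep (\<gamma> t) z) - 1" if "t \<ge> 0" for t z
    unfolding W_def using crep_abs(1)[OF Ginv_pair[OF J[OF that]]] by simp
  have \<gamma>c: "continuous_on {0..} \<gamma>"
    by (rule continuous_on_vector_derivative) (use \<gamma> in auto)
  have uc: "continuous_on {0..} u"
    unfolding u_def by (rule coeff.S_continuous[OF \<gamma>c])
  have Fc: "continuous_on {0..} F"
    using sup.op_continuous[OF \<gamma>c _ uc] J unfolding F_def sup.op_def by auto
  have WF: "W t = W 0 + integral {0..t} F" if t: "t \<ge> 0" for t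
  proof (rule H1_curve_integral[of 0 t])
    show "continuous_on {0..t} F" by (rule continuous_on_subset[OF Fc]) auto
    fix z s assume s: "0 \<le> s" "s \<le> t"
    have "((\<lambda>s. crep (\<gamma> s) z) has_vector_derivative crep (u s) z) (at s within {0..t})"
      unfolding u_def
      by (rule bounded_linear.has_vector_derivative[OF bounded_linear_crep])
        (rule has_vector_derivative_within_subset[OF \<gamma>[OF s(1)]], auto)
    then have "((\<lambda>s. crep (\<gamma> s) z) has_real_derivative crep (u s) z) (at s within {0..t})"
      by (simp add: has_real_derivative_iff_has_vector_derivative)
    then have "((\<lambda>s. Ginv m (crep (\<gamma> s) z)) has_real_derivative Ginv m (crep (\<gamma> s) z) powr m * crep (u s) z) (at s within {0..t})"
      by (rule DERIV_chain2[where f = "Ginv m" and g = "\<lambda>s. crep (\<gamma> s) z", OF Ginv_deriv[OF J_Gdom[OF J[OF s(1)]]]])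
    then have "((\<lambda>s. Ginv m (crep (\<gamma> s) z) - 1) has_real_derivative crep (F s) z) (at s within {0..t})"
      unfolding cF[OF s(1)] by (auto intro!: derivative_eq_intros)
    then show "((\<lambda>s. crep (W s) z) has_real_derivative crep (F s) z) (at s within {0..t})"
      by (rule has_field_derivative_transform_within[OF _ zero_less_one]) (use s cW in auto)
  qed (use t in auto)
  have WD: "(W has_vector_derivative F t) (at t within {0..})" if t: "t \<ge> 0" for t
  proof -
    have "((\<lambda>t. W 0 + integral {0..t} F) has_vector_derivative 0 + F t) (at t within {0..})"
      by (intro has_vector_derivative_add has_vector_derivative_const integral_has_vector_derivative_atLeast Fc t)
    then show ?thesis
      by (intro has_vector_derivative_transform[OF _ WF, where f' = "F t"]) (use t in auto)
  qed
  have W0: "abs_H1 (\<lambda>z. \<phi>0 z - 1) = W 0"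
    unfolding W_def
    using \<phi>0 H1_pair_weak_deriv(2)[OF Ginv_pair[OF J[OF order_refl]]]
    by (subst abs_H1_eq_iff) (auto elim: eventually_mono)
  show ?thesis
    unfolding magma_solution_def
  proof (intro conjI exI[of _ "\<lambda>s. crep (u s)"] allI impI)
    fix t :: real assume t: "t \<ge> 0"
    show "AE z in lebesgue. 0 < Ginv m (crep (\<gamma> t) z)"
      using Ginv_pos[OF J_Gdom[OF J[OF t]]] by simp
    show "in_H1 (\<lambda>z. Ginv m (crep (\<gamma> t) z) - 1)"
      by (rule H1_pair_weak_deriv(2)[OF Ginv_pair[OF J[OF t]]])
    have A: "AE z in lebesgue. Ginv m (crep (\<gamma> t) z) = \<Gamma> (crep (\<gamma> t) z)"
      using \<Gamma>_J[OF J[OF t]] by simp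
    show "weak_solution n m (\<lambda>z. Ginv m (crep (\<gamma> t) z)) (crep (u t))"
      unfolding weak_solution_iff[OF A] by (simp add: crep_in_H1 abs_crep u_def)
    show "AE z in lebesgue. v z = crep (u t) z" if "weak_solution n m (\<lambda>z. Ginv m (crep (\<gamma> t) z)) v" for v
      using that crep_abs_AE[of v] unfolding weak_solution_iff[OF A] u_def by (auto elim: eventually_mono)
    show "in_H1 (\<lambda>z. Ginv m (crep (\<gamma> t) z) powr m * crep (u t) z)"
      by (rule H1_pair_weak_deriv(2)[OF pF[OF t]])
    show "(\<lambda>s. abs_H1 (\<lambda>z. Ginv m (crep (\<gamma> s) z) powr m * crep (u s) z)) integrable_on {0..t}"
      unfolding F_def[symmetric]
      by (intro integrable_continuous_interval continuous_on_subset[OF Fc]) auto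
    show "abs_H1 (\<lambda>z. Ginv m (crep (\<gamma> t) z) - 1) = abs_H1 (\<lambda>z. \<phi>0 z - 1)
        + integral {0..t} (\<lambda>s. abs_H1 (\<lambda>z. Ginv m (crep (\<gamma> s) z) powr m * crep (u s) z))"
      using WF[OF t] unfolding W0 F_def W_def .
  next
    show "C1_on_nonneg (\<lambda>t. abs_H1 (\<lambda>z. Ginv m (crep (\<gamma> t) z) - 1))"
      unfolding C1_on_nonneg_def W_def[symmetric] using Fc WD by blast
  qed
qed

end

lemma C1_on_nonneg_continuous:
  assumes "C1_on_nonneg F" shows "continuous_on {0..} F"
proof -
  obtain F' where "\<And>t. t \<ge> 0 \<Longrightarrow> (F has_vector_derivative F' t) (at t within {0..})"
    using assms unfolding C1_on_nonneg_def by blast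
  then show ?thesis
    by (intro continuous_on_vector_derivative[of _ F F']) simp
qed

context magma_truncation
begin

text \<open>While a solution \<open>\<psi>\<close> keeps its values in \<open>[a, b]\<close>, the curve \<open>G \<circ> \<psi>\<close> solves the same
  equation as \<open>\<gamma>\<close>.\<close>

lemma solution_agrees:
  assumes \<psi>: "magma_solution n m \<phi>0 \<psi>" and W: "\<And>t. W t = abs_H1 (\<lambda>z. \<psi> t z - 1)"
    and s: "0 \<le> s0" "s0 \<le> s1"
    and inside: "\<And>t z. s0 \<le> t \<Longrightarrow> t \<le> s1 \<Longrightarrow> a \<le> 1 + crep (W t) z \<and> 1 + crep (W t) z \<le> b"
    and \<gamma>: "\<And>t. s0 \<le> t \<Longrightarrow> t \<le> s1 \<Longrightarrow> (\<gamma> has_vector_derivative coeff.S (\<gamma> t)) (at t within {s0..s1})"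
    and \<gamma>J: "\<And>t z. s0 \<le> t \<Longrightarrow> t \<le> s1 \<Longrightarrow> crep (\<gamma> t) z \<in> J"
    and R: "\<And>t. s0 \<le> t \<Longrightarrow> t \<le> s1 \<Longrightarrow> norm (\<gamma> t) \<le> R"
    and start: "\<And>z. 1 + crep (W s0) z = Ginv m (crep (\<gamma> s0) z)"
  shows "1 + crep (W s1) z = Ginv m (crep (\<gamma> s1) z)"
proof -
  let ?I = "{a - 1..b - 1}"
  let ?K = "max (a powr - m) (b powr - m)"
  have K0: "?K \<ge> 0" by (simp add: max_def)
  have WI: "crep (W t) z \<in> ?I" if "s0 \<le> t" "t \<le> s1" for t z
    using inside[OF that, of z] by auto
  note PD = G_one_plus_deriv and PB = one_plus_powr_bound
  define GG where "GG t = abs_H1 (\<lambda>z. G m (1 + crep (W t) z))" for t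
  note GP = G_pair[OF WI]
  have cG: "crep (GG t) z = G m (1 + crep (W t) z)" if "s0 \<le> t" "t \<le> s1" for t z
    unfolding GG_def crep_abs(1)[OF GP[OF that]] ..
  obtain u where u0: "(\<forall>s\<ge>0. weak_solution n m (\<psi> s) (u s) \<and>
                (\<forall>v. weak_solution n m (\<psi> s) v \<longrightarrow> (AE z in lebesgue. v z = u s z)) \<and>
                in_H1 (\<lambda>z. \<psi> s z powr m * u s z)) \<and>
        (\<forall>t\<ge>0. (\<lambda>s. abs_H1 (\<lambda>z. \<psi> s z powr m * u s z)) integrable_on {0..t} \<and>
                abs_H1 (\<lambda>z. \<psi> t z - 1) = abs_H1 (\<lambda>z. \<phi>0 z - 1)
                  + integral {0..t} (\<lambda>s. abs_H1 (\<lambda>z. \<psi> s z powr m * u s z)))"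
    using \<psi>[unfolded magma_solution_def, THEN conjunct2, THEN conjunct2, THEN conjunct2] by (rule exE)
  have u: "weak_solution n m (\<psi> s) (u s)" "in_H1 (\<lambda>z. \<psi> s z powr m * u s z)"
      "(\<lambda>s. abs_H1 (\<lambda>z. \<psi> s z powr m * u s z)) integrable_on {0..s}"
      "W s = abs_H1 (\<lambda>z. \<phi>0 z - 1) + integral {0..s} (\<lambda>s. abs_H1 (\<lambda>z. \<psi> s z powr m * u s z))"
    if "s \<ge> 0" for s
    using u0[THEN conjunct1, rule_format, OF that] u0[THEN conjunct2, rule_format, OF that] unfolding W by simp_all
  have \<psi>H: "in_H1 (\<lambda>z. \<psi> t z - 1)" if "t \<ge> 0" for t
    using \<psi> that by (simp add: magma_solution_def)
  have \<psi>W: "AE z in lebesgue. \<psi> t z = 1 + crep (W t) z" if "t \<ge> 0" for t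
    using crep_abs_AE[OF \<psi>H[OF that]] unfolding W by eventually_elim simp
  define v where "v t = coeff.S (GG t)" for t
  have uS: "in_H1 (u t)" "abs_H1 (u t) = v t" if t: "s0 \<le> t" "t \<le> s1" for t
  proof -
    have t0: "t \<ge> 0" using s t by simp
    have "AE z in lebesgue. \<psi> t z = \<Gamma> (crep (GG t) z)"
      using \<psi>W[OF t0]
    proof eventually_elim
      case (elim z)
      then show ?case using \<Gamma>_G[of "1 + crep (W t) z"] inside[OF t] cG[OF t] by simp
    qed
    from weak_solution_iff[OF this] u(1)[OF t0]
    show "in_H1 (u t)" "abs_H1 (u t) = v t" by (simp_all add: v_def)
  qed
  have Wc: "continuous_on {s0..s1} W"
  proof -
    have "C1_on_nonneg W"
      using \<psi>[unfolded magma_solution_def, THEN conjunct2, THEN conjunct2, THEN conjunct1]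
      unfolding W[abs_def] .
    then show ?thesis
      by (rule continuous_on_subset[OF C1_on_nonneg_continuous]) (use s in auto)
  qed
  have vc: "continuous_on {s0..s1} v"
    unfolding continuous_on_def
  proof
    fix t assume t: "t \<in> {s0..s1}"
    define C where "C = fst coeff_consts * ?K / fst (snd coeff_consts) * (1 + 4 * norm (v t))"
    have "((\<lambda>s. v s - v t) \<longlongrightarrow> 0) (at t within {s0..s1})"
    proof (rule Lim_null_comparison)
      show "\<forall>\<^sub>F s in at t within {s0..s1}. norm (v s - v t) \<le> C * norm (W s - W t)"
        unfolding eventually_at_filter
      proof (intro always_eventually allI impI)
        fix s assume s: "s \<in> {s0..s1}"
        show "norm (v s - v t) \<le> C * norm (W s - W t)"
          unfolding v_def C_def
        proof (rule coeff.S_diff[OF K0])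
          fix x
          have "norm (G m (1 + crep (W s) x) - G m (1 + crep (W t) x)) \<le> ?K * norm (crep (W s) x - crep (W t) x)"
            by (rule field_differentiable_bound[where S = ?I and f = "\<lambda>y. G m (1 + y)"])
              (use PD PB WI s t in auto)
          then show "\<bar>crep (GG s) x - crep (GG t) x\<bar> \<le> ?K * \<bar>crep (W s - W t) x\<bar>"
            using s t cG by (simp add: crep_diff)
        qed
      qed
      have "((\<lambda>s. C * norm (W s - W t)) \<longlongrightarrow> C * norm (W t - W t)) (at t within {s0..s1})"
        using Wc t by (intro tendsto_intros) (auto simp: continuous_on_def)
      then show "((\<lambda>s. C * norm (W s - W t)) \<longlongrightarrow> 0) (at t within {s0..s1})" by simp
    qed
    then show "(v \<longlongrightarrow> v t) (at t within {s0..s1})" by (rule LIM_zero_cancel)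
  qed
  define F where "F s = abs_H1 (\<lambda>z. \<psi> s z powr m * u s z)" for s
  \<comment> \<open>The pointwise velocity. \<open>F\<close> is only known to be integrable in time,
    whereas \<open>f z\<close> turns out continuous, so the integral equation can be differentiated
    at each z.\<close>
  define f where "f z s = (1 + crep (W s) z) powr m * crep (v s) z" for z s
  have cF: "crep (F t) z = f z t" if t: "s0 \<le> t" "t \<le> s1" for t z
  proof -
    have t0: "t \<ge> 0" using s t by simp
    have "crep (F t) = (\<lambda>z. f z t)"
    proof (rule continuous_AE_eq[OF crep_continuous_on])
      have "1 + crep (W t) z > 0" for z using inside[OF t, of z] ab by linarith
      then show "continuous_on UNIV (\<lambda>z. f z t)"
        unfolding f_def by (intro continuous_intros crep_continuous_on) (auto simp: less_imp_neq[symmetric])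
      show "AE z in lebesgue. crep (F t) z = f z t"
        unfolding F_def using crep_abs_AE[OF u(2)[OF t0]] \<psi>W[OF t0] crep_abs_AE[OF uS(1)[OF t]]
        by eventually_elim (simp add: uS(2)[OF t] f_def)
    qed
    then show ?thesis by simp
  qed
  have fc: "continuous_on {s0..s1} (f z)" for z
  proof -
    have "1 + crep (W t) z > 0" if "t \<in> {s0..s1}" for t using inside[of t z] that ab by force
    then show ?thesis
      unfolding f_def
      by (intro continuous_intros bounded_linear.continuous_on[OF bounded_linear_crep] Wc vc)
        (auto simp: less_imp_neq[symmetric])
  qed
  have Wf: "crep (W t) z = crep (W s0) z + integral {s0..t} (f z)" if t: "s0 \<le> t" "t \<le> s1" for t z
  proof -
    have Fi: "F integrable_on {0..t}" unfolding F_def using u(3) s t by simp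
    have "integral {0..s0} F + integral {s0..t} F = integral {0..t} F"
      by (rule Henstock_Kurzweil_Integration.integral_combine[OF s(1) t(1) Fi])
    then have "W t = W s0 + integral {s0..t} F"
      using u(4)[of t] u(4)[of s0] s t unfolding F_def[symmetric] by (simp add: algebra_simps)
    moreover have "crep (integral {s0..t} F) z = integral {s0..t} (\<lambda>s. crep (F s) z)"
      using integral_linear[OF integrable_on_subinterval[OF Fi] bounded_linear_crep[of z], of s0 t] s t
      by (simp add: o_def)
    moreover have "integral {s0..t} (\<lambda>s. crep (F s) z) = integral {s0..t} (f z)"
      by (rule integral_cong) (use cF t in auto)
    ultimately show ?thesis by (simp add: crep_add)
  qed
  \<comment> \<open>The derivative of \<open>G m\<close> cancels the power in \<open>f\<close>, so
    at each point \<open>GG\<close> has velocity \<open>v\<close>; \<open>H1_curve_integral\<close>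
    lifts this to \<open>H1\<close>, where \<open>GG\<close> thereby becomes differentiable.\<close>
  have GGv: "GG t = GG s0 + integral {s0..t} v" if t: "s0 \<le> t" "t \<le> s1" for t
  proof (rule H1_curve_integral[OF vc _ t])
    fix z t assume t: "s0 \<le> t" "t \<le> s1"
    have "((\<lambda>t. integral {s0..t} (f z)) has_real_derivative f z t) (at t within {s0..s1})"
      using integral_has_vector_derivative[OF fc, of t] t
      by (simp add: has_real_derivative_iff_has_vector_derivative)
    then have "((\<lambda>t. crep (W s0) z + integral {s0..t} (f z)) has_real_derivative 0 + f z t) (at t within {s0..s1})"
      by (intro DERIV_add DERIV_const)
    then have 1: "((\<lambda>t. crep (W t) z) has_real_derivative f z t) (at t within {s0..s1})"
      unfolding add_0
      by (rule has_field_derivative_transform_within[OF _ zero_less_one]) (use t in \<open>simp_all add: Wf[symmetric]\<close>)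
    have "((\<lambda>t. G m (1 + crep (W t) z)) has_real_derivative (1 + crep (W t) z) powr - m * f z t) (at t within {s0..s1})"
      by (rule DERIV_chain2[where f = "\<lambda>y. G m (1 + y)" and g = "\<lambda>t. crep (W t) z", OF PD[OF WI[OF t]] 1])
    moreover have "(1 + crep (W t) z) powr - m * f z t = crep (v t) z"
      using inside[OF t, of z] ab by (simp add: f_def mult.assoc[symmetric] powr_add[symmetric])
    ultimately have "((\<lambda>t. G m (1 + crep (W t) z)) has_real_derivative crep (v t) z) (at t within {s0..s1})"
      by simp
    then show "((\<lambda>t. crep (GG t) z) has_real_derivative crep (v t) z) (at t within {s0..s1})"
      by (rule has_field_derivative_transform_within[OF _ zero_less_one]) (use t cG in auto)
  qed
  have GD: "(GG has_vector_derivative v t) (at t within {s0..s1})" if t: "s0 \<le> t" "t \<le> s1" for t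
  proof -
    have "((\<lambda>t. GG s0 + integral {s0..t} v) has_vector_derivative 0 + v t) (at t within {s0..s1})"
      using t by (intro has_vector_derivative_add has_vector_derivative_const integral_has_vector_derivative vc) auto
    then show ?thesis
      using t by (intro has_vector_derivative_transform[OF _ GGv, where f' = "v t"]) auto
  qed
  define D where "D t = GG t - \<gamma> t" for t
  define C where "C = fst coeff_consts / fst (snd coeff_consts) * (1 + 4 * (fst coeff_consts / fst (snd coeff_consts) * R))"
  \<comment> \<open>Both curves follow the field \<open>coeff.S\<close>. Its Lipschitz constant
    needs a bound on \<gamma> alone, so no norm bound for the other solution is required.\<close>
  have "D s1 = 0"
  proof (rule Gronwall_zero[of s0 s1 D "\<lambda>t. v t - coeff.S (\<gamma> t)" C])
    show "(D has_vector_derivative v t - coeff.S (\<gamma> t)) (at t within {s0..s1})" if "s0 \<le> t" "t \<le> s1" for t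
      unfolding D_def[abs_def] by (intro has_vector_derivative_diff GD \<gamma> that)
    show "norm (v t - coeff.S (\<gamma> t)) \<le> C * norm (D t)" if "s0 \<le> t" "t \<le> s1" for t
      unfolding v_def D_def C_def by (rule coeff.S_diff_norm_bounded[OF R[OF that]])
    show "D s0 = 0"
      unfolding D_def
      using cG[OF order_refl s(2)] start G_Ginv[OF J_Gdom[OF \<gamma>J[OF order_refl s(2)]]]
      by (auto intro!: crep_eqI)
  qed (rule s)
  then have "crep (\<gamma> s1) z = G m (1 + crep (W s1) z)"
    using cG[OF s(2) order_refl] by (simp add: D_def)
  moreover have "1 + crep (W s1) z > 0" using inside[OF s(2) order_refl, of z] ab by linarith
  ultimately show ?thesis by (simp add: Ginv_G)
qed

end

section \<open>The potential and the a priori bounds\<close>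

text \<open>\<open>potential N\<close> is the solution of \<open>H'' = x\<^sup>-\<^sup>N\<close>, \<open>H(1) = H'(1) = 0\<close>.\<close>

definition potential :: "real \<Rightarrow> real \<Rightarrow> real" where
  "potential N x = ((x - 1) + (x powr (2 - N) - 1) / (N - 2)) / (N - 1)"

definition potential' :: "real \<Rightarrow> real \<Rightarrow> real" where
  "potential' N x = (1 - x powr (1 - N)) / (N - 1)"

lemma potential_deriv:
  assumes "x > 0" "N > 2"
  shows "(potential N has_real_derivative potential' N x) (at x)"
proof -
  have p: "((\<lambda>x. x powr (2 - N)) has_real_derivative (2 - N) * x powr (2 - N - 1)) (at x)"
    by (rule has_real_derivative_powr[OF assms(1)])
  have "((\<lambda>x. ((x - 1) + (x powr (2 - N) - 1) / (N - 2)) / (N - 1)) has_real_derivative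
      ((1 - 0) + ((2 - N) * x powr (2 - N - 1) - 0) / (N - 2)) / (N - 1)) (at x)"
    by (intro DERIV_cdivide DERIV_add DERIV_diff DERIV_ident DERIV_const p)
  moreover have "((2 - N) * y - 0) / (N - 2) = - y" for y
    using assms by (simp add: field_simps)
  then have "((1 - 0) + ((2 - N) * x powr (2 - N - 1) - 0) / (N - 2)) / (N - 1) = potential' N x"
    by (simp only: potential'_def) simp
  ultimately show ?thesis by (simp add: potential_def[abs_def])
qed

lemma potential'_deriv:
  assumes "x > 0" "N > 2"
  shows "(potential' N has_real_derivative x powr - N) (at x)"
proof -
  have p: "((\<lambda>x. x powr (1 - N)) has_real_derivative (1 - N) * x powr (1 - N - 1)) (at x)"
    by (rule has_real_derivative_powr[OF assms(1)])
  have "((\<lambda>x. (1 - x powr (1 - N)) / (N - 1)) has_real_derivative (0 - (1 - N) * x powr (1 - N - 1)) / (N - 1)) (at x)"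
    by (intro DERIV_cdivide DERIV_diff DERIV_const p)
  moreover have "(0 - (1 - N) * x powr (1 - N - 1)) / (N - 1) = x powr - N"
    using assms by (simp add: field_simps)
  ultimately show ?thesis by (simp add: potential'_def[abs_def])
qed

lemma potential_1: "potential N 1 = 0" "potential' N 1 = 0"
  by (simp_all add: potential_def potential'_def)

lemma potential_cont:
  assumes "A \<subseteq> {0<..}" "N > 2" shows "continuous_on A (potential N)"
  using potential_deriv[OF _ assms(2)] assms(1)
  by (intro continuous_at_imp_continuous_on) (force intro: DERIV_isCont)

lemma potential_pos:
  assumes "N > 2" shows "potential N 2 > 0" "potential N (1/2) > 0"
proof -
  have "potential N 1 < potential N 2"
  proof (rule DERIV_pos_imp_increasing_open[where f = "potential N" and a = 1 and b = 2])
    fix x :: real assume x: "1 < x"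
    have "x powr (1 - N) < 1 powr (1 - N)" using x assms by (intro powr_less_mono2_neg) auto
    then show "\<exists>y. (potential N has_real_derivative y) (at x) \<and> 0 < y"
      using potential_deriv[of x N] x assms by (intro exI[of _ "potential' N x"]) (auto simp: potential'_def)
  qed (use assms in \<open>auto intro!: potential_cont\<close>)
  then show "potential N 2 > 0" by (simp add: potential_1)
  have "potential N 1 < potential N (1/2)"
  proof (rule DERIV_neg_imp_decreasing_open[where f = "potential N" and a = "1/2" and b = 1])
    fix x :: real assume x: "1/2 < x" "x < 1"
    have "1 powr (1 - N) < x powr (1 - N)" using x assms by (intro powr_less_mono2_neg) auto
    then show "\<exists>y. (potential N has_real_derivative y) (at x) \<and> y < 0"
      using potential_deriv[of x N] x assms
      by (intro exI[of _ "potential' N x"]) (auto simp: potential'_def divide_less_0_iff)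
  qed (use assms in \<open>auto intro!: potential_cont\<close>)
  then show "potential N (1/2) > 0" by (simp add: potential_1)
qed

text \<open>By convexity the slope beyond 2 is at least \<open>potential' N 2\<close>. The two
  entries of the minimum make the potential minus \<kappa> x nonnegative at 2 and nondecreasing from
  there on.\<close>

lemma potential_growth_above:
  assumes "N > 2"
  shows "\<exists>\<kappa>>0. \<forall>x\<ge>2. \<kappa> * x \<le> potential N x"
proof (intro exI conjI allI impI)
  define \<kappa> where "\<kappa> = min (potential N 2 / 2) (potential' N 2)"
  have "(2::real) powr (1 - N) < 1 powr (1 - N)" using assms by (intro powr_less_mono2_neg) auto
  then show "\<kappa> > 0" using potential_pos(1)[OF assms] assms by (simp add: \<kappa>_def potential'_def)
  fix x :: real assume x: "x \<ge> 2"
  have "potential N 2 - \<kappa> * 2 \<le> potential N x - \<kappa> * x"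
  proof (rule DERIV_nonneg_imp_nondecreasing[OF x])
    fix y :: real assume y: "2 \<le> y"
    have "y powr (1 - N) \<le> 2 powr (1 - N)" using y assms by (intro powr_mono2') auto
    then have "potential' N 2 \<le> potential' N y"
      using assms by (auto simp: potential'_def intro!: divide_right_mono)
    then have "potential' N y - \<kappa> \<ge> 0" by (simp add: \<kappa>_def)
    moreover have "((\<lambda>x. potential N x - \<kappa> * x) has_real_derivative potential' N y - \<kappa>) (at y)"
      using DERIV_diff[OF potential_deriv[of y N] DERIV_cmult_Id[of \<kappa>]] y assms by simp
    ultimately show "\<exists>d. ((\<lambda>x. potential N x - \<kappa> * x) has_real_derivative d) (at y) \<and> 0 \<le> d" by blast
  qed
  moreover have "potential N 2 - \<kappa> * 2 \<ge> 0" by (simp add: \<kappa>_def min_def)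
  ultimately show "\<kappa> * x \<le> potential N x" by linarith
qed

lemma potential_growth_below:
  assumes "N \<ge> 3"
  shows "\<exists>\<kappa>>0. \<forall>x. 0 < x \<and> x \<le> 1/2 \<longrightarrow> \<kappa> * x powr (2 - N) \<le> potential N x"
proof (intro exI conjI allI impI)
  \<comment> \<open>The first entry gives the comparison at 1/2. The second makes the difference
    nonincreasing up to 1/2: there Y = y^(1 - N) >= 4 because N >= 3, and the factor 3/4 leaves (1 -
    Y / 4) / (N - 1) <= 0.\<close>
  define \<kappa> where "\<kappa> = min (potential N (1/2) / (1/2) powr (2 - N)) (3 / 4 / ((N - 1) * (N - 2)))"
  show \<kappa>0: "\<kappa> > 0" using potential_pos(2)[of N] assms by (simp add: \<kappa>_def)
  have \<kappa>1: "\<kappa> * (N - 2) \<le> 3 / 4 / (N - 1)"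
  proof -
    have "\<kappa> \<le> 3 / 4 / ((N - 1) * (N - 2))" by (simp add: \<kappa>_def)
    then have "\<kappa> * (N - 2) \<le> 3 / 4 / ((N - 1) * (N - 2)) * (N - 2)"
      using assms by (intro mult_right_mono) auto
    also have "\<dots> = 3 / 4 / (N - 1)"
      using mult_divide_mult_cancel_right[of "N - 2" "3 / 4" "N - 1"] assms by (simp only: times_divide_eq_left)
    finally show ?thesis .
  qed
  fix x :: real assume x: "0 < x \<and> x \<le> 1/2"
  have "potential N (1/2) - \<kappa> * (1/2) powr (2 - N) \<le> potential N x - \<kappa> * x powr (2 - N)"
  proof (rule DERIV_nonpos_imp_nonincreasing[of x "1/2" "\<lambda>x. potential N x - \<kappa> * x powr (2 - N)"])
    fix y :: real assume y: "x \<le> y" "y \<le> 1/2"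
    then have y0: "y > 0" using x by simp
    define Y where "Y = y powr (1 - N)"
    have "(4::real) = (1/2) powr (-2)" by (simp add: powr_minus powr_numeral power2_eq_square)
    also have "\<dots> \<le> (1/2) powr (1 - N)" using assms by (intro powr_mono') auto
    also have "\<dots> \<le> Y" unfolding Y_def using y y0 assms by (intro powr_mono2') auto
    finally have Y: "Y \<ge> 4" .
    have "potential' N y - \<kappa> * ((2 - N) * y powr (2 - N - 1)) = (1 - Y) / (N - 1) + (\<kappa> * (N - 2)) * Y"
      by (simp add: potential'_def Y_def algebra_simps)
    also have "\<dots> \<le> (1 - Y) / (N - 1) + 3 / 4 / (N - 1) * Y"
      using \<kappa>1 Y by (intro add_left_mono mult_right_mono) auto
    also have "\<dots> = ((1 - Y) + 3 / 4 * Y) / (N - 1)" unfolding add_divide_distrib by simp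
    also have "(1 - Y) + 3 / 4 * Y = 1 - Y / 4" by simp
    also have "(1 - Y / 4) / (N - 1) \<le> 0" using Y assms by (simp add: divide_le_0_iff)
    finally have "potential' N y - \<kappa> * ((2 - N) * y powr (2 - N - 1)) \<le> 0" .
    moreover have "((\<lambda>x. potential N x - \<kappa> * x powr (2 - N)) has_real_derivative
        potential' N y - \<kappa> * ((2 - N) * y powr (2 - N - 1))) (at y)"
      using assms by (intro DERIV_diff potential_deriv DERIV_cmult has_real_derivative_powr y0) auto
    ultimately show "\<exists>d. ((\<lambda>x. potential N x - \<kappa> * x powr (2 - N)) has_real_derivative d) (at y) \<and> d \<le> 0" by blast
  qed (use x in auto)
  moreover have "\<kappa> * (1/2) powr (2 - N) \<le> potential N (1/2)"
  proof -
    have "\<kappa> \<le> potential N (1/2) / (1/2) powr (2 - N)" unfolding \<kappa>_def by (rule min.cobounded1)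
    then show ?thesis by (simp add: pos_le_divide_eq)
  qed
  ultimately show "\<kappa> * x powr (2 - N) \<le> potential N x" by linarith
qed

text \<open>The two growth conditions make \<open>\<integral> x\<^sup>-\<^sup>m \<surd>H dx\<close> diverge at \<open>0\<close> and at \<open>\<infinity>\<close>; this is where
  \<open>n + 3 m \<ge> 4\<close> and \<open>n + 3 m < 6\<close> enter.\<close>

lemma potential_growth:
  assumes "n + m \<ge> 3" "n + 3 * m \<ge> 4" "m \<le> 3 / 2"
  shows "\<exists>\<kappa>>0. \<forall>x>0. x \<le> 1/2 \<or> 2 \<le> x \<longrightarrow> \<kappa> / x \<le> sqrt (potential (n + m) x) * x powr - m"
proof -
  obtain \<kappa>1 where k1: "\<kappa>1 > 0" "\<And>x. x \<ge> 2 \<Longrightarrow> \<kappa>1 * x \<le> potential (n + m) x"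
    using potential_growth_above[of "n + m"] assms by auto
  obtain \<kappa>2 where k2: "\<kappa>2 > 0" "\<And>x. 0 < x \<Longrightarrow> x \<le> 1/2 \<Longrightarrow> \<kappa>2 * x powr (2 - (n + m)) \<le> potential (n + m) x"
    using potential_growth_below[of "n + m"] assms by auto
  define \<kappa> where "\<kappa> = min \<kappa>1 \<kappa>2"
  have \<kappa>: "\<kappa> > 0" "\<kappa> \<le> \<kappa>1" "\<kappa> \<le> \<kappa>2" using k1 k2 by (auto simp: \<kappa>_def)
  have "sqrt \<kappa> / x \<le> sqrt (potential (n + m) x) * x powr - m" if x: "x > 0" "x \<le> 1/2 \<or> 2 \<le> x" for x
  proof -
    \<comment> \<open>The square of the claim, solved for the potential.\<close>
    have "\<kappa> * x powr (2 * m - 2) \<le> potential (n + m) x"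
      using x(2)
    proof
      assume x2: "x \<le> 1/2"
      \<comment> \<open>For x < 1 this comparison of exponents is n + 3m >= 4.\<close>
      have "x powr (2 * m - 2) \<le> x powr (2 - (n + m))" using x x2 assms by (intro powr_mono') auto
      then have "\<kappa> * x powr (2 * m - 2) \<le> \<kappa>2 * x powr (2 - (n + m))" using \<kappa> by (intro mult_mono) auto
      then show ?thesis using k2(2)[OF x(1) x2] by linarith
    next
      assume x2: "2 \<le> x"
      \<comment> \<open>For x > 1 it is m <= 3/2.\<close>
      have "x powr (2 * m - 2) \<le> x powr 1" using x2 assms by (intro powr_mono) auto
      then have "\<kappa> * x powr (2 * m - 2) \<le> \<kappa>1 * x" using \<kappa> x by (intro mult_mono) auto
      then show ?thesis using k1(2)[OF x2] by linarith
    qed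
    then have "sqrt (\<kappa> * x powr (2 * m - 2)) \<le> sqrt (potential (n + m) x)" by (rule real_sqrt_le_mono)
    moreover have "sqrt (x powr (2 * m - 2)) = x powr (m - 1)"
    proof (rule real_sqrt_unique)
      show "(x powr (m - 1))\<^sup>2 = x powr (2 * m - 2)"
        by (simp add: power2_eq_square powr_add[symmetric])
    qed simp
    ultimately have "sqrt \<kappa> * x powr (m - 1) \<le> sqrt (potential (n + m) x)"
      by (simp only: real_sqrt_mult)
    then have "sqrt \<kappa> * x powr (m - 1) * x powr - m \<le> sqrt (potential (n + m) x) * x powr - m"
      by (rule mult_right_mono) simp
    moreover have "x powr (m - 1) * x powr - m = 1 / x"
      using x by (simp add: powr_add[symmetric] powr_neg_one)
    ultimately show ?thesis by (simp add: mult.assoc)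
  qed
  then show ?thesis using \<kappa>(1) by (intro exI[of _ "sqrt \<kappa>"]) auto
qed

section \<open>The potentials in the variable \<gamma>, and the growth of Q\<close>

context magma_truncation
begin

lemma p_G: "a \<le> x \<Longrightarrow> x \<le> b \<Longrightarrow> p (G m x) = x powr n"
  and q_G: "a \<le> x \<Longrightarrow> x \<le> b \<Longrightarrow> q (G m x) = x powr m"
  by (simp_all add: p_def q_def \<Gamma>_G)

lemma eq_on_interval:
  assumes "\<And>x. a \<le> x \<Longrightarrow> x \<le> b \<Longrightarrow> (f has_real_derivative d x) (at x)"
    and "\<And>x. a \<le> x \<Longrightarrow> x \<le> b \<Longrightarrow> (g has_real_derivative d x) (at x)"
    and "f 1 = g 1" "a \<le> x" "x \<le> b"
  shows "f x = (g x :: real)"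
proof -
  have "((\<lambda>x. f x - g x) has_real_derivative 0) (at x within {a..b})" if "x \<in> {a..b}" for x
    using DERIV_diff[OF assms(1)[of x] assms(2)[of x]] that by (auto intro: has_field_derivative_at_within)
  then obtain e where e: "\<And>x. x \<in> {a..b} \<Longrightarrow> f x - g x = e"
    using has_field_derivative_zero_constant[of "{a..b}" "\<lambda>x. f x - g x"] by auto
  show ?thesis using e[of x] e[of 1] assms(3-5) ab by simp
qed

text \<open>As the derivative of \<open>G m\<close> is x^(-m), the derivative 1 / p of
  \<open>coeff.k\<close> becomes x^(-n-m), the second derivative of the potential.\<close>

lemma k_G:
  assumes N: "n + m \<ge> 3" and x: "a \<le> x" "x \<le> b"
  shows "coeff.k (G m x) = potential' (n + m) x"
proof (rule eq_on_interval[OF _ _ _ x, where d = "\<lambda>x. x powr - (n + m)"])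
  fix y assume y: "a \<le> y" "y \<le> b"
  then have y0: "y > 0" using ab by simp
  have "((\<lambda>x. coeff.k (G m x)) has_real_derivative 1 / p (G m y) * y powr - m) (at y)"
    by (rule DERIV_chain2[where f = coeff.k and g = "G m", OF coeff.k_deriv G_deriv[OF y0]])
  moreover have "1 / p (G m y) * y powr - m = y powr - (n + m)"
    unfolding p_G[OF y] powr_minus_divide[symmetric] powr_add[symmetric] by simp
  ultimately show "((\<lambda>x. coeff.k (G m x)) has_real_derivative y powr - (n + m)) (at y)" by simp
  show "(potential' (n + m) has_real_derivative y powr - (n + m)) (at y)"
    using N by (intro potential'_deriv y0) simp
qed (simp add: G_1 coeff.k_0 potential_1)

text \<open>Between the levels the energy density is thus explicit and independent of the
  truncation, so the initial energy is known before the levels are chosen.\<close>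

lemma h_G:
  assumes N: "n + m \<ge> 3" and x: "a \<le> x" "x \<le> b"
  shows "coeff.h (G m x) = potential (n + m) x"
proof (rule eq_on_interval[OF _ _ _ x, where d = "\<lambda>x. potential' (n + m) x"])
  fix y assume y: "a \<le> y" "y \<le> b"
  then have y0: "y > 0" using ab by simp
  have "((\<lambda>x. coeff.h (G m x)) has_real_derivative q (G m y) * coeff.k (G m y) * y powr - m) (at y)"
    by (rule DERIV_chain2[where f = coeff.h and g = "G m", OF coeff.h_deriv G_deriv[OF y0]])
  moreover have "q (G m y) * coeff.k (G m y) * y powr - m = potential' (n + m) y"
    unfolding q_G[OF y] k_G[OF N y] using y0 by (simp add: powr_minus)
  ultimately show "((\<lambda>x. coeff.h (G m x)) has_real_derivative potential' (n + m) y) (at y)" by simp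
  show "(potential (n + m) has_real_derivative potential' (n + m) y) (at y)"
    using N by (intro potential_deriv y0) simp
qed (simp add: G_1 coeff.h_0 potential_1)

lemma Q_mono: "x \<le> y \<Longrightarrow> coeff.Q x \<le> coeff.Q y"
  by (rule DERIV_nonneg_imp_nondecreasing) (use coeff.Q_deriv coeff.h_nonneg in \<open>auto intro!: exI\<close>)

text \<open>Q(G x) has the derivative x^(-m) sqrt H, which is at least that of \<kappa> ln x
  wherever the growth condition holds.\<close>

lemma Q_G_growth:
  assumes N: "n + m \<ge> 3" and xy: "a \<le> x" "x \<le> y" "y \<le> b"
    and growth: "\<And>z. x \<le> z \<Longrightarrow> z \<le> y \<Longrightarrow> \<kappa> / z \<le> sqrt (potential (n + m) z) * z powr - m"
  shows "coeff.Q (G m x) - \<kappa> * ln x \<le> coeff.Q (G m y) - \<kappa> * ln y"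
proof (rule DERIV_nonneg_imp_nondecreasing[OF xy(2)])
  fix z assume z: "x \<le> z" "z \<le> y"
  then have z0: "z > 0" and zab: "a \<le> z" "z \<le> b" using ab xy by auto
  have "((\<lambda>x. coeff.Q (G m x)) has_real_derivative sqrt (coeff.h (G m z)) * z powr - m) (at z)"
    by (rule DERIV_chain2[where f = coeff.Q and g = "G m", OF coeff.Q_deriv G_deriv[OF z0]])
  then have "((\<lambda>x. coeff.Q (G m x) - \<kappa> * ln x) has_real_derivative sqrt (coeff.h (G m z)) * z powr - m - \<kappa> * (1 / z)) (at z)"
    by (intro DERIV_diff DERIV_cmult DERIV_ln_divide z0)
  moreover have "sqrt (coeff.h (G m z)) * z powr - m - \<kappa> * (1 / z) \<ge> 0"
    using growth[OF z] unfolding h_G[OF N zab] by simp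
  ultimately show "\<exists>d. ((\<lambda>x. coeff.Q (G m x) - \<kappa> * ln x) has_real_derivative d) (at z) \<and> 0 \<le> d" by blast
qed

text \<open>\<open>Q\<close> is monotone and vanishes at 0, hence is nonnegative at
  \<open>G m 2\<close> and nonpositive at \<open>G m (1/2)\<close>; logarithmic growth is added from
  these two points outwards.\<close>

lemma Q_levels:
  assumes N: "n + m \<ge> 3" and \<kappa>: "\<kappa> > 0"
    and growth: "\<And>x. x > 0 \<Longrightarrow> x \<le> 1/2 \<or> 2 \<le> x \<Longrightarrow> \<kappa> / x \<le> sqrt (potential (n + m) x) * x powr - m"
    and a1: "a \<le> a1" "a1 \<le> 1/2" and b1: "2 \<le> b1" "b1 \<le> b"
  shows "\<kappa> * ln (b1 / 2) \<le> coeff.Q (G m b1)" "coeff.Q (G m a1) \<le> \<kappa> * ln (2 * a1)"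
proof -
  have "G m 1 \<le> G m 2" "G m (1/2) \<le> G m 1" by (intro G_mono; simp)+
  then have *: "coeff.Q (G m 2) \<ge> 0" "coeff.Q (G m (1/2)) \<le> 0"
    using Q_mono[of 0 "G m 2"] Q_mono[of "G m (1/2)" 0] by (auto simp: G_1 coeff.Q_0)
  have "coeff.Q (G m 2) - \<kappa> * ln 2 \<le> coeff.Q (G m b1) - \<kappa> * ln b1"
    using ab a1 b1 by (intro Q_G_growth[OF N] growth) auto
  then show "\<kappa> * ln (b1 / 2) \<le> coeff.Q (G m b1)"
    using * b1 by (simp add: ln_div right_diff_distrib)
  have "coeff.Q (G m a1) - \<kappa> * ln a1 \<le> coeff.Q (G m (1/2)) - \<kappa> * ln (1/2)"
    using ab a1 b1 by (intro Q_G_growth[OF N] growth) auto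
  then show "coeff.Q (G m a1) \<le> \<kappa> * ln (2 * a1)"
    using * a1 ab by (simp add: ln_div ln_mult distrib_left)
qed

end

section \<open>Lower bounds and essentially bounded reciprocals\<close>

lemma reciprocal_ess_boundedD:
  assumes "reciprocal_ess_bounded f"
  shows "\<exists>e>0. AE z in lebesgue. e \<le> \<bar>f z\<bar>"
proof -
  define r where "r = enn2real (esssup lebesgue (\<lambda>z. inverse (ennreal \<bar>f z\<bar>)))"
  have r: "esssup lebesgue (\<lambda>z. inverse (ennreal \<bar>f z\<bar>)) = ennreal r" "r \<ge> 0"
    using assms unfolding reciprocal_ess_bounded_def r_def by (auto simp: less_top)
  have "AE z in lebesgue. inverse (ennreal \<bar>f z\<bar>) \<le> esssup lebesgue (\<lambda>z. inverse (ennreal \<bar>f z\<bar>))"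
    by (rule esssup_AE)
  \<comment> \<open>\<open>r\<close> is only known to be nonnegative, hence the added 1.\<close>
  then have "AE z in lebesgue. 1 / (r + 1) \<le> \<bar>f z\<bar>"
  proof eventually_elim
    case (elim z)
    then have le: "inverse (ennreal \<bar>f z\<bar>) \<le> ennreal r" by (simp add: r)
    \<comment> \<open>At a zero of \<open>f\<close> the reciprocal in \<open>ennreal\<close> would
      be infinite.\<close>
    have "f z \<noteq> 0" using le by (auto simp: top_unique)
    then have pos: "\<bar>f z\<bar> > 0" by simp
    then have "ennreal (inverse \<bar>f z\<bar>) \<le> ennreal r" using le by (simp add: inverse_ennreal)
    then have "inverse \<bar>f z\<bar> \<le> r" using r(2) by (simp add: ennreal_le_iff)
    then have "1 \<le> (r + 1) * \<bar>f z\<bar>" using pos by (simp add: field_simps)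
    then show ?case using r(2) by (simp add: field_simps)
  qed
  then show ?thesis using r(2) by (intro exI[of _ "1 / (r + 1)"]) auto
qed

lemma reciprocal_ess_boundedI:
  assumes "continuous_on UNIV f" "e > 0" "\<And>z. e \<le> f z"
  shows "reciprocal_ess_bounded f"
proof -
  have [measurable]: "f \<in> borel_measurable lebesgue"
    by (rule continuous_measurable_lebesgue[OF assms(1)])
  have "inverse (ennreal \<bar>f z\<bar>) \<le> ennreal (inverse e)" for z
    using assms(2) assms(3)[of z] by (simp add: inverse_ennreal le_imp_inverse_le)
  then have "esssup lebesgue (\<lambda>z. inverse (ennreal \<bar>f z\<bar>)) \<le> ennreal (inverse e)"
    by (intro esssup_I) auto
  then show ?thesis
    unfolding reciprocal_ess_bounded_def by (rule le_less_trans) simp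
qed

text \<open>The hypothesis bounds only \<open>\<bar>f z\<bar>\<close> from below. For the continuous
  representative this bound holds everywhere, so it cannot cross 0, and it tends to 1 at minus
  infinity; hence it is positive.\<close>

lemma initial_lower_bound:
  assumes H: "in_H1 (\<lambda>z. f z - 1)" and r: "reciprocal_ess_bounded f"
  shows "\<exists>e>0. \<forall>z. e \<le> 1 + crep (abs_H1 (\<lambda>z. f z - 1)) z"
proof -
  define g where "g z = 1 + crep (abs_H1 (\<lambda>z. f z - 1)) z" for z
  have gc: "continuous_on A g" for A
    unfolding g_def by (intro continuous_intros crep_continuous_on)
  obtain e where e: "e > 0" "AE z in lebesgue. e \<le> \<bar>f z\<bar>"
    using reciprocal_ess_boundedD[OF r] by blast
  have "AE z in lebesgue. g z \<in> {x. e \<le> \<bar>x\<bar>}"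
    using e(2) crep_abs_AE[OF H] by eventually_elim (simp add: g_def)
  moreover have "closed {x::real. e \<le> \<bar>x\<bar>}"
    by (intro closed_Collect_le continuous_intros)
  ultimately have ge: "e \<le> \<bar>g z\<bar>" for z
    using continuous_AE_all[OF gc] by blast
  have "(g \<longlongrightarrow> 1 + 0) at_bot"
    unfolding g_def by (intro tendsto_intros H1_pair_decay(2)[OF crep_pair(1)])
  then have "\<forall>\<^sub>F z in at_bot. g z > 0"
    by (intro order_tendstoD) auto
  then obtain z0 where z0: "\<And>z. z \<le> z0 \<Longrightarrow> g z > 0"
    unfolding eventually_at_bot_linorder by blast
  have "g z > 0" for z
  proof (rule ccontr)
    assume neg: "\<not> g z > 0"
    then have "z0 \<le> z" using z0 by (meson linear)
    then obtain y where "g y = 0"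
      using IVT2'[of g z 0 z0] neg z0[of z0] gc by force
    then show False using ge[of y] e(1) by simp
  qed
  then have "e \<le> g z" for z using ge[of z] by (simp add: abs_of_pos)
  then show ?thesis using e(1) unfolding g_def by blast
qed

section \<open>Choice of the levels, existence and uniqueness\<close>

theorem corollary5p7:
  fixes n m :: real and \<phi>0 :: "real \<Rightarrow> real"
  assumes "n + m \<ge> 3" and "n + 3 * m \<ge> 4" and "n + 3 * m < 6"
    and "in_H1 (\<lambda>z. \<phi>0 z - 1)"
    and "reciprocal_ess_bounded \<phi>0"
  shows "\<exists>\<phi>. magma_solution n m \<phi>0 \<phi> \<and>
           (\<forall>\<psi>. magma_solution n m \<phi>0 \<psi> \<longrightarrow> (\<forall>t\<ge>0. AE z in lebesgue. \<psi> t z = \<phi> t z)) \<and>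
           (\<forall>t\<ge>0. reciprocal_ess_bounded (\<phi> t))"
proof -
  note N = assms(1)
  define w0 where "w0 = abs_H1 (\<lambda>z. \<phi>0 z - 1)"
  define f0 where "f0 z = 1 + crep w0 z" for z
  have f0AE: "AE z in lebesgue. \<phi>0 z = f0 z"
    using crep_abs_AE[OF assms(4)] by eventually_elim (simp add: f0_def w0_def)
  obtain a0 where a0: "a0 > 0" "\<And>z. a0 \<le> f0 z"
    using initial_lower_bound[OF assms(4,5)] unfolding f0_def w0_def by blast
  define b0 where "b0 = 1 + 2 * norm w0"
  have b0: "f0 z \<le> b0" for z
    using crep_bound[of w0 z] by (simp add: f0_def b0_def)
  define g0 where "g0 = abs_H1 (\<lambda>z. G m (f0 z))"
  \<comment> \<open>Written with the untruncated potential, because the levels depend on it;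
    \<open>h_G\<close> later identifies it with \<open>coeff.E g0\<close>.\<close>
  define E0 where "E0 = (LINT z|lebesgue. wder g0 z * wder g0 z) / 2 + (LINT z|lebesgue. potential (n + m) (f0 z))"
  obtain \<kappa> where \<kappa>: "\<kappa> > 0"
      "\<And>x. x > 0 \<Longrightarrow> x \<le> 1/2 \<or> 2 \<le> x \<Longrightarrow> \<kappa> / x \<le> sqrt (potential (n + m) x) * x powr - m"
    using potential_growth[of n m] assms(1-3) by auto
  \<comment> \<open>By \<open>Q_levels\<close> the modulus of Q is at least \<kappa> X at 2 exp X
    and at exp (- X) / 2, so \<kappa> X > E0 makes these points unreachable. The levels below are
    moved further out, if necessary, to enclose the data.\<close>
  define X where "X = \<bar>E0\<bar> / \<kappa> + 1"
  have X: "X > 0" "\<kappa> * X > E0"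
  proof -
    have "\<kappa> * X = \<bar>E0\<bar> + \<kappa>" using \<kappa>(1) by (simp add: X_def distrib_left)
    then show "\<kappa> * X > E0" using \<kappa>(1) by linarith
    show "X > 0" unfolding X_def using \<kappa>(1) by (intro add_nonneg_pos) auto
  qed
  define a1 where "a1 = min a0 (exp (- X) / 2)"
  define b1 where "b1 = max b0 (2 * exp X)"
  have eX: "exp (- X) < 1" "1 < exp X" using X(1) by simp_all
  have a1: "0 < a1" "a1 \<le> a0" "2 * a1 \<le> exp (- X)"
    using a0(1) by (auto simp: a1_def min_def)
  then have a1': "a1 \<le> 1/2" using eX(1) by linarith
  note a1 = a1 a1'
  have b1: "b0 \<le> b1" "2 * exp X \<le> b1"
    by (simp_all add: b1_def)
  then have b1': "2 \<le> b1" "exp X \<le> b1 / 2" using eX(2) by linarith+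
  note b1 = b1 b1'
  \<comment> \<open>The factors 1/2 and 2 leave a margin around the range of the flow, in which a
    competing solution stays for a short time.\<close>
  interpret magma_truncation n m "a1 / 2" "2 * b1"
    by standard (use a1 b1 in auto)
  have f0I: "a1 / 2 \<le> f0 z" "f0 z \<le> 2 * b1" for z
    using a0(2)[of z] b0[of z] a1 b1 by linarith+
  have g0p: "H1_pair (\<lambda>z. G m (1 + crep w0 z)) (\<lambda>z. (1 + crep w0 z) powr - m * wder w0 z)"
    by (rule G_pair) (use f0I in \<open>auto simp: f0_def algebra_simps\<close>)
  have cg0: "crep g0 z = G m (f0 z)" for z
    unfolding g0_def f0_def using crep_abs(1)[OF g0p] by simp
  have E0: "coeff.E g0 = E0"
    unfolding coeff.E_def E0_def cg0 h_G[OF N f0I] ..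
  obtain \<gamma> where \<gamma>: "\<gamma> 0 = g0"
      "\<And>t. t \<ge> 0 \<Longrightarrow> (\<gamma> has_vector_derivative coeff.S (\<gamma> t)) (at t within {0..})"
      "\<And>t. t \<ge> 0 \<Longrightarrow> coeff.E (\<gamma> t) = E0"
    using coeff.global_flow[of g0] E0 by metis
  have Qb: "E0 < coeff.Q (G m b1)"
  proof -
    have "X \<le> ln (b1 / 2)" using b1 by (subst ln_ge_iff) auto
    then have "\<kappa> * X \<le> \<kappa> * ln (b1 / 2)" using \<kappa>(1) by simp
    also have "\<dots> \<le> coeff.Q (G m b1)"
      using a1 b1 by (intro Q_levels(1)[OF N \<kappa>, of a1]) auto
    finally show ?thesis using X(2) by simp
  qed
  have Qa: "coeff.Q (G m a1) < - E0"
  proof -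
    have "coeff.Q (G m a1) \<le> \<kappa> * ln (2 * a1)"
      using a1 b1 by (intro Q_levels(2)[OF N \<kappa>, of a1 b1]) auto
    also have "ln (2 * a1) \<le> ln (exp (- X))" using a1 by (subst ln_le_cancel_iff) auto
    then have "\<kappa> * ln (2 * a1) \<le> \<kappa> * (- X)" using \<kappa>(1) by (intro mult_left_mono) auto
    finally show ?thesis using X(2) by simp
  qed
  \<comment> \<open>Along the flow |Q| <= E0, while Q is beyond that at both levels; monotonicity of
    Q does the rest.\<close>
  have between: "G m a1 \<le> crep (\<gamma> t) z" "crep (\<gamma> t) z \<le> G m b1" if "t \<ge> 0" for t z
    using coeff.Q_bound[of "\<gamma> t" z] \<gamma>(3)[OF that] Qa Qb
      Q_mono[of "crep (\<gamma> t) z" "G m a1"] Q_mono[of "G m b1" "crep (\<gamma> t) z"] by linarith+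
  define \<phi> where "\<phi> t z = Ginv m (crep (\<gamma> t) z)" for t z
  have \<phi>I: "a1 \<le> \<phi> t z" "\<phi> t z \<le> b1" if "t \<ge> 0" for t z
    unfolding \<phi>_def using Ginv_between[OF a1(1) _ between[OF that]] a1 b1 by auto
  have \<gamma>J: "crep (\<gamma> t) z \<in> J" if "t \<ge> 0" for t z
    unfolding J_def using between[OF that, of z] G_mono[of "a1 / 2" a1 m] G_mono[of b1 "2 * b1" m] a1 b1
    by auto
  have f0pos: "f0 z > 0" for z using a0(1) a0(2)[of z] by linarith
  have sol: "magma_solution n m \<phi>0 \<phi>"
    unfolding \<phi>_def
    by (rule flow_solution[OF \<gamma>(2) \<gamma>J assms(4)])
      (use f0AE Ginv_G[OF f0pos] in \<open>simp_all add: \<gamma>(1) cg0\<close>)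
  have \<phi>pair: "H1_pair (\<lambda>z. \<phi> t z - 1) (\<lambda>z. \<phi> t z powr m * wder (\<gamma> t) z)" if "t \<ge> 0" for t
    unfolding \<phi>_def by (rule Ginv_pair[OF \<gamma>J[OF that]])
  define V where "V t = abs_H1 (\<lambda>z. \<phi> t z - 1)" for t
  have cV: "crep (V t) z = \<phi> t z - 1" if "t \<ge> 0" for t z
    unfolding V_def using crep_abs(1)[OF \<phi>pair[OF that]] by simp
  have curve: "continuous_on {0..} (\<lambda>t. abs_H1 (\<lambda>z. \<theta> t z - 1))" "abs_H1 (\<lambda>z. \<theta> 0 z - 1) = w0"
    if s: "magma_solution n m \<phi>0 \<theta>" for \<theta>
  proof -
    show "continuous_on {0..} (\<lambda>t. abs_H1 (\<lambda>z. \<theta> t z - 1))"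
      by (rule C1_on_nonneg_continuous[OF s[unfolded magma_solution_def, THEN conjunct2, THEN conjunct2, THEN conjunct1]])
    obtain u where "\<forall>t\<ge>0. (\<lambda>s. abs_H1 (\<lambda>z. \<theta> s z powr m * u s z)) integrable_on {0..t} \<and>
                abs_H1 (\<lambda>z. \<theta> t z - 1) = abs_H1 (\<lambda>z. \<phi>0 z - 1)
                  + integral {0..t} (\<lambda>s. abs_H1 (\<lambda>z. \<theta> s z powr m * u s z))"
      using s[unfolded magma_solution_def, THEN conjunct2, THEN conjunct2, THEN conjunct2] by (elim exE conjE) (rule that)
    from this[rule_format, of 0] show "abs_H1 (\<lambda>z. \<theta> 0 z - 1) = w0" by (simp add: w0_def)
  qed
  note Vc = curve(1)[OF sol, folded V_def]
  define R where "R = sqrt ((2 * snd (snd coeff_consts) / fst (snd coeff_consts) + 2) * E0)"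
  have R: "norm (\<gamma> t) \<le> R" if "t \<ge> 0" for t
    unfolding R_def using coeff.norm_le_E[of "\<gamma> t"] \<gamma>(3)[OF that] by (simp add: real_le_rsqrt)
  have unique: "abs_H1 (\<lambda>z. \<psi> T z - 1) = V T" if \<psi>: "magma_solution n m \<phi>0 \<psi>" and T: "T \<ge> 0" for \<psi> T
  proof -
    define W where "W t = abs_H1 (\<lambda>z. \<psi> t z - 1)" for t
    note Wc = curve(1)[OF \<psi>, folded W_def]
    have W0: "W 0 = V 0" using curve(2)[OF \<psi>] curve(2)[OF sol] by (simp add: W_def V_def)
    have "0 \<le> (0::real) \<longrightarrow> 0 \<le> T \<longrightarrow> W 0 = V 0 \<longrightarrow> W T = V T"
      using T
    \<comment> \<open>The relation "agreement at s implies agreement at t" is transitive, so by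
      bisection it has to be checked only on short intervals around each x.\<close>
    proof (induction rule: Bolzano[where P = "\<lambda>s t. 0 \<le> s \<longrightarrow> s \<le> t \<longrightarrow> W s = V s \<longrightarrow> W t = V t"])
      case (trans s t r)
      then show ?case by force
    next
      case (local x)
      show ?case
      proof (cases "W x = V x")
        case True
        \<comment> \<open>A distance a1 / 4 in norm is less than a1 / 2 in the supremum norm and so
          fits into the margin around [a1, b1].\<close>
        obtain d where d: "d > 0" "\<And>t. t \<ge> 0 \<Longrightarrow> \<bar>t - x\<bar> < d \<Longrightarrow> norm (W t - W x) < a1 / 4"
          using Wc local(1) a1(1) unfolding continuous_on_iff dist_norm real_norm_def
          by (metis atLeast_iff divide_pos_pos zero_less_numeral)
        show ?thesis
        proof (intro exI[of _ d] conjI allI impI d(1))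
          fix s t assume st: "s \<le> x \<and> x \<le> t \<and> t - s < d" "0 \<le> s" "s \<le> t" "W s = V s"
          have eq: "1 + crep (W t) z = Ginv m (crep (\<gamma> t) z)" for z
          proof (rule solution_agrees[OF \<psi> W_def st(2,3)])
            fix r z assume r: "s \<le> r" "r \<le> t"
            have "norm (W r - W x) < a1 / 4" using d(2)[of r] r st by auto
            then have "\<bar>crep (W r) z - crep (W x) z\<bar> < a1 / 2"
              using crep_bound[of "W r - W x" z] by (simp add: crep_diff)
            moreover have "crep (W x) z = \<phi> x z - 1" using True cV[OF local(1)] by simp
            ultimately show "a1 / 2 \<le> 1 + crep (W r) z \<and> 1 + crep (W r) z \<le> 2 * b1"
              using \<phi>I[OF local(1), of z] a1 b1 by linarith
          next
            fix r assume r: "s \<le> r" "r \<le> t"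
            show "(\<gamma> has_vector_derivative coeff.S (\<gamma> r)) (at r within {s..t})"
              by (rule has_vector_derivative_within_subset[OF \<gamma>(2)]) (use r st in auto)
            show "norm (\<gamma> r) \<le> R" using R r st by simp
            show "crep (\<gamma> r) z \<in> J" for z using \<gamma>J r st by simp
          next
            show "1 + crep (W s) z = Ginv m (crep (\<gamma> s) z)" for z
              using st cV by (simp add: \<phi>_def)
          qed
          show "W t = V t"
          proof (rule crep_eqI)
            show "crep (W t) y = crep (V t) y" for y
              using eq[of y] cV[of t y] st(2,3) unfolding \<phi>_def by linarith
          qed
        qed
      next
        \<comment> \<open>Curves that differ at x differ nearby by continuity, so the premise
          \<open>W s = V s\<close> fails.\<close>
        case False
        have "continuous_on {0..} (\<lambda>t. W t - V t)" by (intro continuous_intros Wc Vc)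
        then obtain d where d: "d > 0" "\<And>t. t \<ge> 0 \<Longrightarrow> \<bar>t - x\<bar> < d \<Longrightarrow> norm ((W t - V t) - (W x - V x)) < norm (W x - V x)"
          using local(1) False unfolding continuous_on_iff dist_norm real_norm_def
          by (metis atLeast_iff zero_less_norm_iff right_minus_eq)
        show ?thesis
        proof (intro exI[of _ d] conjI allI impI d(1))
          fix s t assume st: "s \<le> x \<and> x \<le> t \<and> t - s < d" "0 \<le> s" "s \<le> t" "W s = V s"
          have "norm ((W s - V s) - (W x - V x)) < norm (W x - V x)" using d(2)[of s] st by auto
          then show "W t = V t" using st(4) by (simp add: norm_minus_commute)
        qed
      qed
    qed
    then show ?thesis using W0 T by (simp add: W_def)
  qed
  show ?thesis
  proof (intro exI[of _ \<phi>] conjI allI impI sol)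
    fix \<psi> t assume \<psi>: "magma_solution n m \<phi>0 \<psi>" and t: "(t::real) \<ge> 0"
    have "in_H1 (\<lambda>z. \<psi> t z - 1)" using \<psi> t by (simp add: magma_solution_def)
    then have "AE z in lebesgue. \<psi> t z - 1 = \<phi> t z - 1"
      using unique[OF \<psi> t] H1_pair_weak_deriv(2)[OF \<phi>pair[OF t]] unfolding V_def
      by (subst (asm) abs_H1_eq_iff) auto
    then show "AE z in lebesgue. \<psi> t z = \<phi> t z" by simp
  next
    fix t :: real assume t: "t \<ge> 0"
    have "continuous_on UNIV (\<lambda>z. (\<phi> t z - 1) + 1)"
      by (intro continuous_intros primitive_continuous_on[OF H1_pairD(3)[OF \<phi>pair[OF t]]])
    then have "continuous_on UNIV (\<phi> t)" by simp
    then show "reciprocal_ess_bounded (\<phi> t)"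
      by (rule reciprocal_ess_boundedI[OF _ a1(1) \<phi>I(1)[OF t]])
  qed
qed

end
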